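(* Let $(\mathscr{C},\mathbb{E},\mathfrak{s})$ be an extriangulated category satisfying Condition (WIC), and let $\mathcal{P}=((\mathcal{S},\mathcal{T}),(\mathcal{U},\mathcal{V}))$ be a Hovey twin cotorsion pair on it. Then for $\mathbb{W}=w\mathit{Fib}\circ w\mathit{Cof}$ there is an equivalence $\mathcal{Z}/\mathcal{I}\xrightarrow{\simeq}\mathscr{C}[\mathbb{W}^{-1}]$ which makes the square formed by the inclusion $\mathcal{Z}\to\mathscr{C}$, the ideal quotient functor $\mathcal{Z}\to\mathcal{Z}/\mathcal{I}$, the localization functor $\ell\colon\mathscr{C}\to\mathscr{C}[\mathbb{W}^{-1}]$ and this equivalence commutative up to natural isomorphism. In particular, the map \[ (\mathcal{Z}/\mathcal{I})(X,Y)\to\mathscr{C}[\mathbb{W}^{-1}](X,Y),\qquad \overline{f}\mapsto\ell(f), \] is an isomorphism for any $X,Y\in\mathcal{Z}$.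
   Context: Extriangulated categories. Let $\mathscr{C}$ be an additive category and $\mathbb{E}\colon\mathscr{C}^{\mathrm{op}}\times\mathscr{C}\to\mathit{Ab}$ a functor. Elements $\delta\in\mathbb{E}(C,A)$ are called $\mathbb{E}$-extensions; for $a\colon A\to A'$ and $c\colon C'\to C$ put $a_*\delta=\mathbb{E}(C,a)(\delta)$ and $c^*\delta=\mathbb{E}(c,A)(\delta)$. A morphism $(a,c)\colon\delta\to\delta'$ from $\delta\in\mathbb{E}(C,A)$ to $\delta'\in\mathbb{E}(C',A')$ is a pair $a\colon A\to A'$, $c\colon C\to C'$ with $a_*\delta=c^*\delta'$. Sequences $A\xrightarrow{x}B\xrightarrow{y}C$ and $A\xrightarrow{x'}B'\xrightarrow{y'}C$ are equivalent if there is an isomorphism $b\colon B\to B'$ with $bx=x'$, $y'b=y$; the class is written $[A\xrightarrow{x}B\xrightarrow{y}C]$. A realization $\mathfrak{s}$ assigns to each $\delta\in\mathbb{E}(C,A)$ such a class $\mathfrak{s}(\delta)=[A\xrightarrow{x}B\xrightarrow{y}C]$ so that for every morphism $(a,c)\colon\delta\to\delta'$, with $\mathfrak{s}(\delta')=[A'\xrightarrow{x'}B'\xrightarrow{y'}C']$, there is $b\colon B\to B'$ with $bx=x'a$, $y'b=cy$ (then $(a,b,c)$ is said to realize $(a,c)$). It is additive if $\mathfrak{s}(0)=[A\to A\oplus C\to C]$ (canonical inclusion and projection) and $\mathfrak{s}(\delta\oplus\delta')=[A\oplus A'\xrightarrow{x\oplus x'}B\oplus B'\xrightarrow{y\oplus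 y'}C\oplus C']$, where $\delta\oplus\delta'\in\mathbb{E}(C\oplus C',A\oplus A')$ corresponds to $(\delta,0,0,\delta')$. If $\mathfrak{s}(\delta)=[A\xrightarrow{x}B\xrightarrow{y}C]$, the sequence is called a conflation, $x$ an inflation, $y$ a deflation, and one speaks of the $\mathbb{E}$-triangle $A\xrightarrow{x}B\xrightarrow{y}C\overset{\delta}{\dashrightarrow}$. The triple $(\mathscr{C},\mathbb{E},\mathfrak{s})$ is an extriangulated category if: (ET1) $\mathbb{E}$ is biadditive; (ET2) $\mathfrak{s}$ is an additive realization; (ET3) for $\mathbb{E}$-triangles $A\xrightarrow{x}B\xrightarrow{y}C\overset{\delta}{\dashrightarrow}$, $A'\xrightarrow{x'}B'\xrightarrow{y'}C'\overset{\delta'}{\dashrightarrow}$ and $a,b$ with $bx=x'a$ there is $c$ such that $(a,c)\colon\delta\to\delta'$ is a morphism realized by $(a,b,c)$; (ET3)$^{\mathrm{op}}$ for $b,c$ with $y'b=cy$ there is $a$ such that $(a,c)\colon\delta\to\delta'$ is a morphism realized by $(a,b,c)$; (ET4) for $\mathbb{E}$-triangles $A\xrightarrow{f}B\xrightarrow{f'}D\overset{\delta}{\dashrightarrow}$ and $B\xrightarrow{g}C\xrightarrow{g'}F\overset{\delta'}{\dashrightarrow}$ there are an $\mathbb{E}$-triangle $A\xrightarrow{h}C\xrightarrow{h'}E\overset{\delta''}{\dashrightarrow}$ with $h=gf$ and $d\colon D\to E$, $e\colon E\to F$ with $df'=h'g$, $eh'=g'$, such that $D\xrightarrow{d}E\xrightarrow{e}F$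 realizes $f'_*\delta'$, $d^*\delta''=\delta$ and $f_*\delta''=e^*\delta'$; (ET4)$^{\mathrm{op}}$ for $\mathbb{E}$-triangles $D\xrightarrow{f'}A\xrightarrow{f}B\overset{\delta}{\dashrightarrow}$ and $F\xrightarrow{g'}B\xrightarrow{g}C\overset{\delta'}{\dashrightarrow}$ there are an $\mathbb{E}$-triangle $E\xrightarrow{h'}A\xrightarrow{h}C\overset{\delta''}{\dashrightarrow}$ with $h=gf$ and $d\colon D\to E$, $e\colon E\to F$ with $h'd=f'$, $fh'=g'e$, such that $D\xrightarrow{d}E\xrightarrow{e}F$ realizes $g'^*\delta$, $\delta'=e_*\delta''$ and $d_*\delta=g^*\delta''$. Condition (WIC): for all composable $f\colon A\to B$, $g\colon B\to C$: if $gf$ is an inflation then so is $f$; if $gf$ is a deflation then so is $g$. Cotorsion pairs. A cotorsion pair on $\mathscr{C}$ is a pair $(\mathcal{U},\mathcal{V})$ of full additive subcategories closed under isomorphisms and direct summands such that $\mathbb{E}(U,V)=0$ for all $U\in\mathcal{U},V\in\mathcal{V}$, and every $C\in\mathscr{C}$ admits conflations $V^C\to U^C\to C$ and $C\to V_C\to U_C$ with $U^C,U_C\in\mathcal{U}$, $V^C,V_C\in\mathcal{V}$. A twin cotorsion pair is a pair $((\mathcal{S},\mathcal{T}),(\mathcal{U},\mathcal{V}))$ of cotorsion pairs with $\mathbb{E}(\mathcal{S},\mathcal{V})=0$. Let $\mathcal{N}^i$ (resp. $\mathcal{N}^f$) be the full subcategory of objects $X$ admitting a conflation $V\to S\to X$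 (resp. $X\to V\to S$) with $V\in\mathcal{V},S\in\mathcal{S}$. The twin cotorsion pair is Hovey if $\mathcal{N}^i=\mathcal{N}^f$; in that case $\mathcal{S}\cap\mathcal{T}=\mathcal{U}\cap\mathcal{V}$, and one puts $\mathcal{I}=\mathcal{S}\cap\mathcal{T}=\mathcal{U}\cap\mathcal{V}$ and $\mathcal{Z}=\mathcal{T}\cap\mathcal{U}$. $\mathcal{Z}/\mathcal{I}$ is the quotient by the ideal of morphisms factoring through objects of $\mathcal{I}$, with $\overline{f}$ the class of $f$. $w\mathit{Fib}$ is the class of deflations $f\colon A\to B$ admitting a conflation $V\to A\xrightarrow{f}B$ with $V\in\mathcal{V}$; $w\mathit{Cof}$ is the class of inflations $f\colon A\to B$ admitting a conflation $A\xrightarrow{f}B\to S$ with $S\in\mathcal{S}$; $\mathbb{W}=w\mathit{Fib}\circ w\mathit{Cof}$ is the class of composites $p\circ i$ with $i\in w\mathit{Cof}$, $p\in w\mathit{Fib}$; $\ell\colon\mathscr{C}\to\mathscr{C}[\mathbb{W}^{-1}]$ is the localization functor (identity on objects). *)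

theory Defs
  imports "HOL-Algebra.Group"
begin

section \<open>Categories, functors, natural isomorphisms and equivalences\<close>

record ('o, 'm) category =
  Obj :: "'o set"
  Mor :: "'m set"
  Dom :: "'m \<Rightarrow> 'o"
  Cod :: "'m \<Rightarrow> 'o"
  Ident :: "'o \<Rightarrow> 'm"
  Comp :: "'m \<Rightarrow> 'm \<Rightarrow> 'm" (infixl "\<cdot>\<index>" 70)

definition Hom :: "('o, 'm, 'z) category_scheme \<Rightarrow> 'o \<Rightarrow> 'o \<Rightarrow> 'm set" where
  "Hom \<C> A B = {f \<in> Mor \<C>. Dom \<C> f = A \<and> Cod \<C> f = B}"

locale category =
  fixes \<C> :: "('o, 'm, 'z) category_scheme" (structure)
  assumes Dom_Obj: "f \<in> Mor \<C> \<Longrightarrow> Dom \<C> f \<in> Obj \<C>"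
    and Cod_Obj: "f \<in> Mor \<C> \<Longrightarrow> Cod \<C> f \<in> Obj \<C>"
    and Ident_Hom: "A \<in> Obj \<C> \<Longrightarrow> Ident \<C> A \<in> Hom \<C> A A"
    and Comp_Hom: "\<lbrakk>f \<in> Hom \<C> A B; g \<in> Hom \<C> B D\<rbrakk> \<Longrightarrow> g \<cdot> f \<in> Hom \<C> A D"
    and Comp_Ident_right: "f \<in> Hom \<C> A B \<Longrightarrow> f \<cdot> Ident \<C> A = f"
    and Comp_Ident_left: "f \<in> Hom \<C> A B \<Longrightarrow> Ident \<C> B \<cdot> f = f"
    and Comp_assoc: "\<lbrakk>f \<in> Hom \<C> A B; g \<in> Hom \<C> B D; h \<in> Hom \<C> D E\<rbrakk> \<Longrightarrow> h \<cdot> (g \<cdot> f) = (h \<cdot> g) \<cdot> f"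

definition iso_mor :: "('o, 'm, 'z) category_scheme \<Rightarrow> 'm \<Rightarrow> bool" where
  "iso_mor \<C> f \<longleftrightarrow> f \<in> Mor \<C> \<and>
     (\<exists>g \<in> Hom \<C> (Cod \<C> f) (Dom \<C> f).
        g \<cdot>\<^bsub>\<C>\<^esub> f = Ident \<C> (Dom \<C> f) \<and> f \<cdot>\<^bsub>\<C>\<^esub> g = Ident \<C> (Cod \<C> f))"

definition isomorphic :: "('o, 'm, 'z) category_scheme \<Rightarrow> 'o \<Rightarrow> 'o \<Rightarrow> bool" where
  "isomorphic \<C> A B \<longleftrightarrow> (\<exists>f \<in> Hom \<C> A B. iso_mor \<C> f)"

definition full_subcategory ::
  "('o, 'm, 'z) category_scheme \<Rightarrow> 'o set \<Rightarrow> ('o, 'm, 'z) category_scheme" where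
  "full_subcategory \<C> \<Z> =
     \<C>\<lparr>Obj := \<Z>, Mor := {f \<in> Mor \<C>. Dom \<C> f \<in> \<Z> \<and> Cod \<C> f \<in> \<Z>}\<rparr>"

record ('o, 'm, 'p, 'n) cfunctor =
  on_obj :: "'o \<Rightarrow> 'p"
  on_mor :: "'m \<Rightarrow> 'n"

definition is_functor ::
  "('o, 'm, 'y) category_scheme \<Rightarrow> ('p, 'n, 'z) category_scheme \<Rightarrow> ('o, 'm, 'p, 'n) cfunctor \<Rightarrow> bool" where
  "is_functor \<A> \<B> F \<longleftrightarrow> category \<A> \<and> category \<B> \<and>
     (\<forall>A \<in> Obj \<A>. on_obj F A \<in> Obj \<B>) \<and>
     (\<forall>f \<in> Mor \<A>. on_mor F f \<in> Hom \<B> (on_obj F (Dom \<A> f)) (on_obj F (Cod \<A> f))) \<and>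
     (\<forall>A \<in> Obj \<A>. on_mor F (Ident \<A> A) = Ident \<B> (on_obj F A)) \<and>
     (\<forall>f \<in> Mor \<A>. \<forall>g \<in> Mor \<A>. Cod \<A> f = Dom \<A> g \<longrightarrow>
        on_mor F (g \<cdot>\<^bsub>\<A>\<^esub> f) = on_mor F g \<cdot>\<^bsub>\<B>\<^esub> on_mor F f)"

text \<open>Serves both as the identity functor and as the inclusion of a full subcategory.\<close>

definition inclusion_functor :: "('o, 'm, 'o, 'm) cfunctor" where
  "inclusion_functor = \<lparr>on_obj = (\<lambda>A. A), on_mor = (\<lambda>f. f)\<rparr>"

definition compose_functor ::
  "('p, 'n, 'q, 'k) cfunctor \<Rightarrow> ('o, 'm, 'p, 'n) cfunctor \<Rightarrow> ('o, 'm, 'q, 'k) cfunctor"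
  (infixl "\<circ>\<^sub>F" 55) where
  "G \<circ>\<^sub>F F = \<lparr>on_obj = on_obj G \<circ> on_obj F, on_mor = on_mor G \<circ> on_mor F\<rparr>"

definition nat_iso ::
  "('o, 'm, 'y) category_scheme \<Rightarrow> ('p, 'n, 'z) category_scheme
    \<Rightarrow> ('o, 'm, 'p, 'n) cfunctor \<Rightarrow> ('o, 'm, 'p, 'n) cfunctor \<Rightarrow> ('o \<Rightarrow> 'n) \<Rightarrow> bool" where
  "nat_iso \<A> \<B> F G \<eta> \<longleftrightarrow> is_functor \<A> \<B> F \<and> is_functor \<A> \<B> G \<and>
     (\<forall>A \<in> Obj \<A>. \<eta> A \<in> Hom \<B> (on_obj F A) (on_obj G A) \<and> iso_mor \<B> (\<eta> A)) \<and>
     (\<forall>f \<in> Mor \<A>. on_mor G f \<cdot>\<^bsub>\<B>\<^esub> \<eta> (Dom \<A> f) = \<eta> (Cod \<A> f) \<cdot>\<^bsub>\<B>\<^esub> on_mor F f)"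

definition naturally_isomorphic ::
  "('o, 'm, 'y) category_scheme \<Rightarrow> ('p, 'n, 'z) category_scheme
    \<Rightarrow> ('o, 'm, 'p, 'n) cfunctor \<Rightarrow> ('o, 'm, 'p, 'n) cfunctor \<Rightarrow> bool" where
  "naturally_isomorphic \<A> \<B> F G \<longleftrightarrow> (\<exists>\<eta>. nat_iso \<A> \<B> F G \<eta>)"

definition is_equivalence ::
  "('o, 'm, 'y) category_scheme \<Rightarrow> ('p, 'n, 'z) category_scheme \<Rightarrow> ('o, 'm, 'p, 'n) cfunctor \<Rightarrow> bool" where
  "is_equivalence \<A> \<B> F \<longleftrightarrow> is_functor \<A> \<B> F \<and>
     (\<exists>G. is_functor \<B> \<A> G \<and>
        naturally_isomorphic \<A> \<A> (G \<circ>\<^sub>F F) inclusion_functor \<and>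
        naturally_isomorphic \<B> \<B> (F \<circ>\<^sub>F G) inclusion_functor)"


section \<open>Additive categories and ideal quotients\<close>

record ('o, 'm) add_category = "('o, 'm) category" +
  MAdd :: "'m \<Rightarrow> 'm \<Rightarrow> 'm" (infixl "\<boxplus>\<index>" 65)
  MZero :: "'o \<Rightarrow> 'o \<Rightarrow> 'm"

text \<open>The abelian groups \<open>\<C>(A, B)\<close> and \<open>\<E>(C, A)\<close> are instances of \<^locale>\<open>comm_group\<close>, whose notation
  is multiplicative: its unit is the zero morphism, respectively the split extension \<open>0\<close>.\<close>

definition Hom_group :: "('o, 'm, 'z) add_category_scheme \<Rightarrow> 'o \<Rightarrow> 'o \<Rightarrow> 'm monoid" where
  "Hom_group \<C> A B = \<lparr>carrier = Hom \<C> A B, mult = MAdd \<C>, one = MZero \<C> A B\<rparr>"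

definition is_zero_object :: "('o, 'm, 'z) category_scheme \<Rightarrow> 'o \<Rightarrow> bool" where
  "is_zero_object \<C> Z \<longleftrightarrow> Z \<in> Obj \<C> \<and>
     (\<forall>A \<in> Obj \<C>. (\<exists>!f. f \<in> Hom \<C> A Z) \<and> (\<exists>!f. f \<in> Hom \<C> Z A))"

text \<open>\<open>P = A \<oplus> B\<close> with inclusions \<open>i\<close>, \<open>j\<close> and projections \<open>p\<close>, \<open>q\<close>.\<close>

definition is_biproduct ::
  "('o, 'm, 'z) add_category_scheme \<Rightarrow> 'o \<Rightarrow> 'o \<Rightarrow> 'o \<Rightarrow> 'm \<Rightarrow> 'm \<Rightarrow> 'm \<Rightarrow> 'm \<Rightarrow> bool" where
  "is_biproduct \<C> A B P i j p q \<longleftrightarrow>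
     A \<in> Obj \<C> \<and> B \<in> Obj \<C> \<and> P \<in> Obj \<C> \<and>
     i \<in> Hom \<C> A P \<and> j \<in> Hom \<C> B P \<and> p \<in> Hom \<C> P A \<and> q \<in> Hom \<C> P B \<and>
     p \<cdot>\<^bsub>\<C>\<^esub> i = Ident \<C> A \<and> q \<cdot>\<^bsub>\<C>\<^esub> j = Ident \<C> B \<and>
     q \<cdot>\<^bsub>\<C>\<^esub> i = MZero \<C> A B \<and> p \<cdot>\<^bsub>\<C>\<^esub> j = MZero \<C> B A \<and>
     (i \<cdot>\<^bsub>\<C>\<^esub> p) \<boxplus>\<^bsub>\<C>\<^esub> (j \<cdot>\<^bsub>\<C>\<^esub> q) = Ident \<C> P"

locale additive_category = category \<C>
  for \<C> :: "('o, 'm, 'z) add_category_scheme" (structure) +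
  assumes Hom_comm_group: "\<lbrakk>A \<in> Obj \<C>; B \<in> Obj \<C>\<rbrakk> \<Longrightarrow> comm_group (Hom_group \<C> A B)"
    and Comp_MAdd_right:
      "\<lbrakk>f \<in> Hom \<C> A B; f' \<in> Hom \<C> A B; g \<in> Hom \<C> B D\<rbrakk> \<Longrightarrow> g \<cdot> (f \<boxplus> f') = (g \<cdot> f) \<boxplus> (g \<cdot> f')"
    and Comp_MAdd_left:
      "\<lbrakk>f \<in> Hom \<C> A B; g \<in> Hom \<C> B D; g' \<in> Hom \<C> B D\<rbrakk> \<Longrightarrow> (g \<boxplus> g') \<cdot> f = (g \<cdot> f) \<boxplus> (g' \<cdot> f)"
    and zero_object_ex: "\<exists>Z. is_zero_object \<C> Z"
    and biproduct_ex: "\<lbrakk>A \<in> Obj \<C>; B \<in> Obj \<C>\<rbrakk> \<Longrightarrow> \<exists>P i j p q. is_biproduct \<C> A B P i j p q"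

definition factors_through ::
  "('o, 'm, 'z) category_scheme \<Rightarrow> 'o set \<Rightarrow> 'm \<Rightarrow> bool" where
  "factors_through \<C> \<I> h \<longleftrightarrow>
     (\<exists>J \<in> \<I>. \<exists>u \<in> Hom \<C> (Dom \<C> h) J. \<exists>v \<in> Hom \<C> J (Cod \<C> h). h = v \<cdot>\<^bsub>\<C>\<^esub> u)"

definition ideal_rel :: "('o, 'm, 'z) add_category_scheme \<Rightarrow> 'o set \<Rightarrow> ('m \<times> 'm) set" where
  "ideal_rel \<C> \<I> = {(f, g). \<exists>X \<in> Obj \<C>. \<exists>Y \<in> Obj \<C>. f \<in> Hom \<C> X Y \<and> g \<in> Hom \<C> X Y \<and>
     (\<exists>h \<in> Hom \<C> X Y. factors_through \<C> \<I> h \<and> f = g \<boxplus>\<^bsub>\<C>\<^esub> h)}"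

definition ideal_class :: "('o, 'm, 'z) add_category_scheme \<Rightarrow> 'o set \<Rightarrow> 'm \<Rightarrow> 'm set" where
  "ideal_class \<C> \<I> f = ideal_rel \<C> \<I> `` {f}"

definition ideal_quotient ::
  "('o, 'm, 'z) add_category_scheme \<Rightarrow> 'o set \<Rightarrow> ('o, 'm set) category" where
  "ideal_quotient \<C> \<I> =
     \<lparr>Obj = Obj \<C>,
      Mor = Mor \<C> // ideal_rel \<C> \<I>,
      Dom = (\<lambda>F. Dom \<C> (SOME f. f \<in> F)),
      Cod = (\<lambda>F. Cod \<C> (SOME f. f \<in> F)),
      Ident = (\<lambda>X. ideal_class \<C> \<I> (Ident \<C> X)),
      Comp = (\<lambda>G F. ideal_class \<C> \<I> ((SOME g. g \<in> G) \<cdot>\<^bsub>\<C>\<^esub> (SOME f. f \<in> F)))\<rparr>"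

definition quotient_functor ::
  "('o, 'm, 'z) add_category_scheme \<Rightarrow> 'o set \<Rightarrow> ('o, 'm, 'o, 'm set) cfunctor" where
  "quotient_functor \<C> \<I> = \<lparr>on_obj = (\<lambda>X. X), on_mor = ideal_class \<C> \<I>\<rparr>"


section \<open>Localization of a category at a class of morphisms\<close>

text \<open>The Gabriel-Zisman construction: the morphisms of \<open>\<C>[\<W>\<inverse>]\<close> are zigzags of morphisms of
  \<open>\<C>\<close> and formal inverses of morphisms of \<open>\<W>\<close>, modulo the congruence generated by the relations
  of \<open>\<C>\<close> and the cancellation of mutually inverse steps. Zigzags are read from left to right.
  The universal property is shown below.\<close>

datatype 'm step = Fwd 'm | Bwd 'm

inductive zigzag ::
  "('o, 'm, 'z) category_scheme \<Rightarrow> 'm set \<Rightarrow> 'o \<Rightarrow> 'm step list \<Rightarrow> 'o \<Rightarrow> bool"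
  for \<C> \<W> where
  Nil: "X \<in> Obj \<C> \<Longrightarrow> zigzag \<C> \<W> X [] X"
| Fwd: "\<lbrakk>f \<in> Hom \<C> X Y; zigzag \<C> \<W> Y p Z\<rbrakk> \<Longrightarrow> zigzag \<C> \<W> X (Fwd f # p) Z"
| Bwd: "\<lbrakk>w \<in> \<W>; w \<in> Hom \<C> Y X; zigzag \<C> \<W> Y p Z\<rbrakk> \<Longrightarrow> zigzag \<C> \<W> X (Bwd w # p) Z"

inductive zigzag_eq ::
  "('o, 'm, 'z) category_scheme \<Rightarrow> 'm set \<Rightarrow> 'o \<Rightarrow> 'o \<Rightarrow> 'm step list \<Rightarrow> 'm step list \<Rightarrow> bool"
  for \<C> \<W> where
  refl: "zigzag \<C> \<W> X p Y \<Longrightarrow> zigzag_eq \<C> \<W> X Y p p"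
| sym: "zigzag_eq \<C> \<W> X Y p q \<Longrightarrow> zigzag_eq \<C> \<W> X Y q p"
| trans: "\<lbrakk>zigzag_eq \<C> \<W> X Y p q; zigzag_eq \<C> \<W> X Y q r\<rbrakk> \<Longrightarrow> zigzag_eq \<C> \<W> X Y p r"
| comp: "\<lbrakk>zigzag \<C> \<W> X u A; f \<in> Hom \<C> A D; g \<in> Hom \<C> D B; zigzag \<C> \<W> B v Y\<rbrakk>
    \<Longrightarrow> zigzag_eq \<C> \<W> X Y (u @ [Fwd f, Fwd g] @ v) (u @ [Fwd (g \<cdot>\<^bsub>\<C>\<^esub> f)] @ v)"
| ident: "\<lbrakk>zigzag \<C> \<W> X u A; zigzag \<C> \<W> A v Y\<rbrakk>
    \<Longrightarrow> zigzag_eq \<C> \<W> X Y (u @ [Fwd (Ident \<C> A)] @ v) (u @ v)"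
| Fwd_Bwd: "\<lbrakk>zigzag \<C> \<W> X u A; w \<in> \<W>; w \<in> Hom \<C> A B; zigzag \<C> \<W> A v Y\<rbrakk>
    \<Longrightarrow> zigzag_eq \<C> \<W> X Y (u @ [Fwd w, Bwd w] @ v) (u @ v)"
| Bwd_Fwd: "\<lbrakk>zigzag \<C> \<W> X u B; w \<in> \<W>; w \<in> Hom \<C> A B; zigzag \<C> \<W> B v Y\<rbrakk>
    \<Longrightarrow> zigzag_eq \<C> \<W> X Y (u @ [Bwd w, Fwd w] @ v) (u @ v)"

definition zigzags :: "('o, 'm, 'z) category_scheme \<Rightarrow> 'm set \<Rightarrow> ('o \<times> 'm step list \<times> 'o) set" where
  "zigzags \<C> \<W> = {(X, p, Y). zigzag \<C> \<W> X p Y}"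

definition zigzag_rel ::
  "('o, 'm, 'z) category_scheme \<Rightarrow> 'm set
    \<Rightarrow> (('o \<times> 'm step list \<times> 'o) \<times> ('o \<times> 'm step list \<times> 'o)) set" where
  "zigzag_rel \<C> \<W> = {((X, p, Y), (X', q, Y')). X' = X \<and> Y' = Y \<and> zigzag_eq \<C> \<W> X Y p q}"

definition zigzag_class ::
  "('o, 'm, 'z) category_scheme \<Rightarrow> 'm set \<Rightarrow> 'o \<Rightarrow> 'm step list \<Rightarrow> 'o
    \<Rightarrow> ('o \<times> 'm step list \<times> 'o) set" where
  "zigzag_class \<C> \<W> X p Y = zigzag_rel \<C> \<W> `` {(X, p, Y)}"

definition localization ::
  "('o, 'm, 'z) category_scheme \<Rightarrow> 'm set \<Rightarrow> ('o, ('o \<times> 'm step list \<times> 'o) set) category" where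
  "localization \<C> \<W> =
     \<lparr>Obj = Obj \<C>,
      Mor = zigzags \<C> \<W> // zigzag_rel \<C> \<W>,
      Dom = (\<lambda>F. fst (SOME t. t \<in> F)),
      Cod = (\<lambda>F. snd (snd (SOME t. t \<in> F))),
      Ident = (\<lambda>X. zigzag_class \<C> \<W> X [] X),
      Comp = (\<lambda>G F. let (X, p, _) = (SOME t. t \<in> F); (_, q, Z) = (SOME t. t \<in> G)
                    in zigzag_class \<C> \<W> X (p @ q) Z)\<rparr>"

definition localization_functor ::
  "('o, 'm, 'z) category_scheme \<Rightarrow> 'm set \<Rightarrow> ('o, 'm, 'o, ('o \<times> 'm step list \<times> 'o) set) cfunctor" where
  "localization_functor \<C> \<W> =
     \<lparr>on_obj = (\<lambda>X. X), on_mor = (\<lambda>f. zigzag_class \<C> \<W> (Dom \<C> f) [Fwd f] (Cod \<C> f))\<rparr>"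

subsection \<open>Universal property\<close>

lemma zigzag_append: "zigzag \<C> \<W> X p Y \<Longrightarrow> zigzag \<C> \<W> Y q Z \<Longrightarrow> zigzag \<C> \<W> X (p @ q) Z"
  by (induction rule: zigzag.induct) (auto intro: zigzag.intros)

lemma Hom_iff: "f \<in> Hom \<C> A B \<longleftrightarrow> f \<in> Mor \<C> \<and> Dom \<C> f = A \<and> Cod \<C> f = B"
  by (simp add: Hom_def)

context category
begin

lemma Hom_Obj: "f \<in> Hom \<C> A B \<Longrightarrow> A \<in> Obj \<C> \<and> B \<in> Obj \<C>"
  using Dom_Obj Cod_Obj by (auto simp: Hom_def)

lemma zigzag_Obj: "zigzag \<C> \<W> X p Y \<Longrightarrow> X \<in> Obj \<C> \<and> Y \<in> Obj \<C>"
  by (induction rule: zigzag.induct) (auto dest: Hom_Obj)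

lemma zigzag_single: "f \<in> Hom \<C> X Y \<Longrightarrow> zigzag \<C> \<W> X [Fwd f] Y"
  by (meson Hom_Obj zigzag.intros)

lemma zigzag_Bwd: "w \<in> \<W> \<Longrightarrow> w \<in> Hom \<C> X Y \<Longrightarrow> zigzag \<C> \<W> Y [Bwd w] X"
  by (meson Hom_Obj zigzag.intros)

lemma zigzag_eq_zigzag: "zigzag_eq \<C> \<W> X Y p q \<Longrightarrow> zigzag \<C> \<W> X p Y \<and> zigzag \<C> \<W> X q Y"
proof (induction rule: zigzag_eq.induct)
  case (comp X u A f D g B v Y)
  then show ?case
    by (auto intro!: zigzag_append[OF comp(1)] zigzag.intros intro: Comp_Hom)
next
  case (ident X u A v Y)
  then show ?case
    by (auto intro!: zigzag_append[OF ident(1)] zigzag.intros intro: Ident_Hom dest: zigzag_Obj)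
next
  case (Fwd_Bwd X u A w B v Y)
  then show ?case
    by (auto intro!: zigzag_append[OF Fwd_Bwd(1)] intro: zigzag.intros)
next
  case (Bwd_Fwd X u B w A v Y)
  then show ?case
    by (auto intro!: zigzag_append[OF Bwd_Fwd(1)] intro: zigzag.intros)
qed auto

lemma zigzag_eq_append_left:
  "zigzag_eq \<C> \<W> X Y p q \<Longrightarrow> zigzag \<C> \<W> A u X \<Longrightarrow> zigzag_eq \<C> \<W> A Y (u @ p) (u @ q)"
proof (induction rule: zigzag_eq.induct)
  case (refl X p Y)
  then show ?case by (simp add: zigzag_append zigzag_eq.refl)
next
  case (comp X u' A' f D g B v Y)
  from zigzag_eq.comp[OF zigzag_append[OF comp(5,1)] comp(2-4)] show ?case by simp
next
  case (ident X u' A' v Y)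
  from zigzag_eq.ident[OF zigzag_append[OF ident(3,1)] ident(2)] show ?case by simp
next
  case (Fwd_Bwd X u' A' w B v Y)
  from zigzag_eq.Fwd_Bwd[OF zigzag_append[OF Fwd_Bwd(5,1)] Fwd_Bwd(2-4)] show ?case by simp
next
  case (Bwd_Fwd X u' B w A' v Y)
  from zigzag_eq.Bwd_Fwd[OF zigzag_append[OF Bwd_Fwd(5,1)] Bwd_Fwd(2-4)] show ?case by simp
qed (auto intro: zigzag_eq.sym zigzag_eq.trans)

lemma zigzag_eq_append_right:
  "zigzag_eq \<C> \<W> X Y p q \<Longrightarrow> zigzag \<C> \<W> Y u A \<Longrightarrow> zigzag_eq \<C> \<W> X A (p @ u) (q @ u)"
proof (induction rule: zigzag_eq.induct)
  case (refl X p Y)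
  then show ?case by (simp add: zigzag_append zigzag_eq.refl)
next
  case (comp X u' A' f D g B v Y)
  from zigzag_eq.comp[OF comp(1-3) zigzag_append[OF comp(4,5)]] show ?case by simp
next
  case (ident X u' A' v Y)
  from zigzag_eq.ident[OF ident(1) zigzag_append[OF ident(2,3)]] show ?case by simp
next
  case (Fwd_Bwd X u' A' w B v Y)
  from zigzag_eq.Fwd_Bwd[OF Fwd_Bwd(1-3) zigzag_append[OF Fwd_Bwd(4,5)]] show ?case by simp
next
  case (Bwd_Fwd X u' B w A' v Y)
  from zigzag_eq.Bwd_Fwd[OF Bwd_Fwd(1-3) zigzag_append[OF Bwd_Fwd(4,5)]] show ?case by simp
qed (auto intro: zigzag_eq.sym zigzag_eq.trans)

lemma zigzag_eq_append:
  assumes "zigzag_eq \<C> \<W> X Y p p'" "zigzag_eq \<C> \<W> Y Z q q'"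
  shows "zigzag_eq \<C> \<W> X Z (p @ q) (p' @ q')"
  using assms zigzag_eq_append_left zigzag_eq_append_right zigzag_eq_zigzag zigzag_eq.trans by metis

lemma equiv_zigzag_rel: "equiv (zigzags \<C> \<W>) (zigzag_rel \<C> \<W>)"
  by (rule equivI)
    (auto simp: zigzag_rel_def zigzags_def refl_on_def sym_on_def trans_on_def
      intro: zigzag_eq.intros dest: zigzag_eq_zigzag)

lemma zigzag_class_eq_iff:
  assumes "zigzag \<C> \<W> X p Y"
  shows "zigzag_class \<C> \<W> X p Y = zigzag_class \<C> \<W> X' q Y' \<longleftrightarrow>
    X = X' \<and> Y = Y' \<and> zigzag_eq \<C> \<W> X Y p q"
proof
  assume *: "zigzag_class \<C> \<W> X p Y = zigzag_class \<C> \<W> X' q Y'"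
  have "(X, p, Y) \<in> zigzag_class \<C> \<W> X p Y"
    using assms by (simp add: zigzag_class_def zigzag_rel_def zigzag_eq.refl)
  with * show "X = X' \<and> Y = Y' \<and> zigzag_eq \<C> \<W> X Y p q"
    by (auto simp: zigzag_class_def zigzag_rel_def intro: zigzag_eq.sym)
next
  assume "X = X' \<and> Y = Y' \<and> zigzag_eq \<C> \<W> X Y p q"
  then show "zigzag_class \<C> \<W> X p Y = zigzag_class \<C> \<W> X' q Y'"
    by (auto simp: zigzag_class_def zigzag_rel_def intro: zigzag_eq.intros)
qed

lemma zigzag_class_SOME:
  assumes "zigzag \<C> \<W> X p Y"
  obtains q where "(SOME t. t \<in> zigzag_class \<C> \<W> X p Y) = (X, q, Y)" "zigzag_eq \<C> \<W> X Y p q"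
proof -
  have "(X, p, Y) \<in> zigzag_class \<C> \<W> X p Y"
    using assms by (simp add: zigzag_class_def zigzag_rel_def zigzag_eq.refl)
  then have "(SOME t. t \<in> zigzag_class \<C> \<W> X p Y) \<in> zigzag_class \<C> \<W> X p Y"
    by (rule someI)
  then show ?thesis
    using that by (auto simp: zigzag_class_def zigzag_rel_def)
qed

lemma localization_Obj: "Obj (localization \<C> \<W>) = Obj \<C>"
  by (simp add: localization_def)

lemma localization_Hom:
  "Hom (localization \<C> \<W>) X Y = {zigzag_class \<C> \<W> X p Y | p. zigzag \<C> \<W> X p Y}"
proof -
  have "Mor (localization \<C> \<W>) = {zigzag_class \<C> \<W> X p Y | X p Y. zigzag \<C> \<W> X p Y}"
    by (auto simp: localization_def quotient_def zigzags_def zigzag_class_def)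
  then have mor: "K \<in> Mor (localization \<C> \<W>) \<longleftrightarrow> (\<exists>X p Y. K = zigzag_class \<C> \<W> X p Y \<and> zigzag \<C> \<W> X p Y)" for K
    by simp
  have dom_cod: "Dom (localization \<C> \<W>) (zigzag_class \<C> \<W> X p Y) = X \<and>
      Cod (localization \<C> \<W>) (zigzag_class \<C> \<W> X p Y) = Y" if p: "zigzag \<C> \<W> X p Y" for X p Y
  proof -
    obtain q where "(SOME t. t \<in> zigzag_class \<C> \<W> X p Y) = (X, q, Y)"
      using zigzag_class_SOME[OF p] .
    then show ?thesis by (simp add: localization_def)
  qed
  show ?thesis
  proof (intro equalityI subsetI)
    fix K assume K: "K \<in> Hom (localization \<C> \<W>) X Y"
    then obtain X' p Y' where "K = zigzag_class \<C> \<W> X' p Y'" "zigzag \<C> \<W> X' p Y'"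
      unfolding Hom_iff mor by metis
    moreover from this K have "X' = X" "Y' = Y"
      using dom_cod[of X' p Y'] by (simp_all add: Hom_iff)
    ultimately show "K \<in> {zigzag_class \<C> \<W> X p Y | p. zigzag \<C> \<W> X p Y}" by blast
  next
    fix K assume "K \<in> {zigzag_class \<C> \<W> X p Y | p. zigzag \<C> \<W> X p Y}"
    then obtain p where "K = zigzag_class \<C> \<W> X p Y" "zigzag \<C> \<W> X p Y" by blast
    then show "K \<in> Hom (localization \<C> \<W>) X Y"
      unfolding Hom_iff mor using dom_cod[of X p Y] by auto
  qed
qed

lemma localization_Comp:
  assumes "zigzag \<C> \<W> X p Y" "zigzag \<C> \<W> Y q Z"
  shows "zigzag_class \<C> \<W> Y q Z \<cdot>\<^bsub>localization \<C> \<W>\<^esub> zigzag_class \<C> \<W> X p Y = zigzag_class \<C> \<W> X (p @ q) Z"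
proof -
  obtain p' where p': "(SOME t. t \<in> zigzag_class \<C> \<W> X p Y) = (X, p', Y)" "zigzag_eq \<C> \<W> X Y p p'"
    using zigzag_class_SOME[OF assms(1)] .
  obtain q' where q': "(SOME t. t \<in> zigzag_class \<C> \<W> Y q Z) = (Y, q', Z)" "zigzag_eq \<C> \<W> Y Z q q'"
    using zigzag_class_SOME[OF assms(2)] .
  have "zigzag_eq \<C> \<W> X Z (p @ q) (p' @ q')"
    using p'(2) q'(2) by (rule zigzag_eq_append)
  then have "zigzag_class \<C> \<W> X (p @ q) Z = zigzag_class \<C> \<W> X (p' @ q') Z"
    using assms by (simp add: zigzag_class_eq_iff zigzag_append)
  then show ?thesis
    by (simp add: localization_def p' q')
qed

lemma localization_Ident: "Ident (localization \<C> \<W>) X = zigzag_class \<C> \<W> X [] X"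
  by (simp add: localization_def)

lemma category_localization: "category (localization \<C> \<W>)"
proof
  fix f assume "f \<in> Mor (localization \<C> \<W>)"
  then have "f \<in> Hom (localization \<C> \<W>) (Dom (localization \<C> \<W>) f) (Cod (localization \<C> \<W>) f)"
    by (simp add: Hom_def)
  then show "Dom (localization \<C> \<W>) f \<in> Obj (localization \<C> \<W>)"
    and "Cod (localization \<C> \<W>) f \<in> Obj (localization \<C> \<W>)"
    using zigzag_Obj by (fastforce simp: localization_Hom localization_Obj)+
next
  fix A assume "A \<in> Obj (localization \<C> \<W>)"
  then show "Ident (localization \<C> \<W>) A \<in> Hom (localization \<C> \<W>) A A"
    by (auto simp: localization_Hom localization_Obj localization_Ident intro: zigzag.Nil)
next
  fix f A B g D
  assume "f \<in> Hom (localization \<C> \<W>) A B" "g \<in> Hom (localization \<C> \<W>) B D"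
  then show "g \<cdot>\<^bsub>localization \<C> \<W>\<^esub> f \<in> Hom (localization \<C> \<W>) A D"
    by (auto simp: localization_Hom localization_Comp intro: zigzag_append)
next
  fix f A B
  assume "f \<in> Hom (localization \<C> \<W>) A B"
  then obtain p where p: "f = zigzag_class \<C> \<W> A p B" "zigzag \<C> \<W> A p B"
    unfolding localization_Hom by blast
  from p(2) have "zigzag \<C> \<W> A [] A" "zigzag \<C> \<W> B [] B"
    by (auto intro: zigzag.Nil dest: zigzag_Obj)
  with p show "f \<cdot>\<^bsub>localization \<C> \<W>\<^esub> Ident (localization \<C> \<W>) A = f"
    and "Ident (localization \<C> \<W>) B \<cdot>\<^bsub>localization \<C> \<W>\<^esub> f = f"
    by (simp_all add: localization_Ident localization_Comp)
next
  fix f A B g D h E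
  assume "f \<in> Hom (localization \<C> \<W>) A B" "g \<in> Hom (localization \<C> \<W>) B D"
    "h \<in> Hom (localization \<C> \<W>) D E"
  then obtain p q r where *: "f = zigzag_class \<C> \<W> A p B" "g = zigzag_class \<C> \<W> B q D"
    "h = zigzag_class \<C> \<W> D r E"
    and p: "zigzag \<C> \<W> A p B" and q: "zigzag \<C> \<W> B q D" and r: "zigzag \<C> \<W> D r E"
    unfolding localization_Hom by blast
  show "h \<cdot>\<^bsub>localization \<C> \<W>\<^esub> (g \<cdot>\<^bsub>localization \<C> \<W>\<^esub> f)
      = (h \<cdot>\<^bsub>localization \<C> \<W>\<^esub> g) \<cdot>\<^bsub>localization \<C> \<W>\<^esub> f"
    unfolding * localization_Comp[OF p q] localization_Comp[OF q r]
      localization_Comp[OF p zigzag_append[OF q r]] localization_Comp[OF zigzag_append[OF p q] r]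
    by simp
qed

lemma localization_functor_mor:
  "f \<in> Hom \<C> X Y \<Longrightarrow> on_mor (localization_functor \<C> \<W>) f = zigzag_class \<C> \<W> X [Fwd f] Y"
  by (simp add: localization_functor_def Hom_def)

lemma localization_functor_is_functor:
  "is_functor \<C> (localization \<C> \<W>) (localization_functor \<C> \<W>)"
  unfolding is_functor_def
proof (intro conjI ballI impI)
  show "category \<C>" by unfold_locales
  show "category (localization \<C> \<W>)" by (rule category_localization)
  fix A assume A: "A \<in> Obj \<C>"
  then show "on_obj (localization_functor \<C> \<W>) A \<in> Obj (localization \<C> \<W>)"
    by (simp add: localization_functor_def localization_Obj)
  have "zigzag_eq \<C> \<W> A A ([] @ [Fwd (Ident \<C> A)] @ []) ([] @ [])"
    using A by (intro zigzag_eq.ident zigzag.Nil)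
  then show "on_mor (localization_functor \<C> \<W>) (Ident \<C> A)
      = Ident (localization \<C> \<W>) (on_obj (localization_functor \<C> \<W>) A)"
    using A by (simp add: localization_functor_mor[OF Ident_Hom] localization_Ident
        zigzag_class_eq_iff zigzag_single Ident_Hom) (simp add: localization_functor_def)
next
  fix f assume f: "f \<in> Mor \<C>"
  then have "f \<in> Hom \<C> (Dom \<C> f) (Cod \<C> f)" by (simp add: Hom_def)
  then show "on_mor (localization_functor \<C> \<W>) f \<in> Hom (localization \<C> \<W>)
     (on_obj (localization_functor \<C> \<W>) (Dom \<C> f)) (on_obj (localization_functor \<C> \<W>) (Cod \<C> f))"
    by (auto simp: localization_functor_def localization_Hom intro: zigzag_single)
next
  fix f g assume *: "f \<in> Mor \<C>" "g \<in> Mor \<C>" "Cod \<C> f = Dom \<C> g"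
  let ?X = "Dom \<C> f" and ?Y = "Dom \<C> g" and ?Z = "Cod \<C> g"
  have f: "f \<in> Hom \<C> ?X ?Y" and g: "g \<in> Hom \<C> ?Y ?Z"
    using * by (auto simp: Hom_def)
  have gf: "g \<cdot> f \<in> Hom \<C> ?X ?Z" using f g by (rule Comp_Hom)
  have "zigzag_eq \<C> \<W> ?X ?Z ([] @ [Fwd f, Fwd g] @ []) ([] @ [Fwd (g \<cdot> f)] @ [])"
    using zigzag_eq.comp[OF zigzag.Nil f g zigzag.Nil] Hom_Obj[OF f] Hom_Obj[OF g] by blast
  then show "on_mor (localization_functor \<C> \<W>) (g \<cdot> f) =
      on_mor (localization_functor \<C> \<W>) g \<cdot>\<^bsub>localization \<C> \<W>\<^esub> on_mor (localization_functor \<C> \<W>) f"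
    using f g gf
    by (simp add: localization_functor_mor localization_Comp zigzag_single zigzag_class_eq_iff zigzag_eq.sym)
qed

lemma localization_inverts:
  assumes "w \<in> \<W>" "w \<in> Hom \<C> X Y"
  shows "zigzag_class \<C> \<W> X [Fwd w] Y \<in> Hom (localization \<C> \<W>) X Y"
    and "zigzag_class \<C> \<W> Y [Bwd w] X \<in> Hom (localization \<C> \<W>) Y X"
    and "zigzag_class \<C> \<W> Y [Bwd w] X \<cdot>\<^bsub>localization \<C> \<W>\<^esub> zigzag_class \<C> \<W> X [Fwd w] Y
           = Ident (localization \<C> \<W>) X"
    and "zigzag_class \<C> \<W> X [Fwd w] Y \<cdot>\<^bsub>localization \<C> \<W>\<^esub> zigzag_class \<C> \<W> Y [Bwd w] X
           = Ident (localization \<C> \<W>) Y"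
proof -
  have X: "zigzag \<C> \<W> X [] X" and Y: "zigzag \<C> \<W> Y [] Y"
    using assms Hom_Obj by (auto intro: zigzag.Nil)
  have F: "zigzag \<C> \<W> X [Fwd w] Y" and B: "zigzag \<C> \<W> Y [Bwd w] X"
    using assms by (auto intro: zigzag_single zigzag_Bwd)
  show "zigzag_class \<C> \<W> X [Fwd w] Y \<in> Hom (localization \<C> \<W>) X Y"
    and "zigzag_class \<C> \<W> Y [Bwd w] X \<in> Hom (localization \<C> \<W>) Y X"
    using F B by (auto simp: localization_Hom)
  have "zigzag_eq \<C> \<W> X X ([] @ [Fwd w, Bwd w] @ []) ([] @ [])"
    using X assms by (intro zigzag_eq.Fwd_Bwd)
  then show "zigzag_class \<C> \<W> Y [Bwd w] X \<cdot>\<^bsub>localization \<C> \<W>\<^esub> zigzag_class \<C> \<W> X [Fwd w] Y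
           = Ident (localization \<C> \<W>) X"
    using F B zigzag_append[OF F B] by (simp add: localization_Comp localization_Ident zigzag_class_eq_iff)
  have "zigzag_eq \<C> \<W> Y Y ([] @ [Bwd w, Fwd w] @ []) ([] @ [])"
    using Y assms by (intro zigzag_eq.Bwd_Fwd)
  then show "zigzag_class \<C> \<W> X [Fwd w] Y \<cdot>\<^bsub>localization \<C> \<W>\<^esub> zigzag_class \<C> \<W> Y [Bwd w] X
           = Ident (localization \<C> \<W>) Y"
    using F B zigzag_append[OF B F] by (simp add: localization_Comp localization_Ident zigzag_class_eq_iff)
qed

lemma localization_functor_inverts:
  assumes "w \<in> \<W>" "w \<in> Mor \<C>"
  shows "iso_mor (localization \<C> \<W>) (on_mor (localization_functor \<C> \<W>) w)"
proof -
  have w: "w \<in> Hom \<C> (Dom \<C> w) (Cod \<C> w)" using assms by (simp add: Hom_def)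
  from localization_inverts[OF assms(1) w] show ?thesis
    unfolding iso_mor_def localization_functor_mor[OF w] by (auto simp: Hom_iff)
qed

lemma inverse_unique:
  assumes "f \<in> Hom \<C> A B" "g \<in> Hom \<C> B A" "h \<in> Hom \<C> B A"
    and "g \<cdot> f = Ident \<C> A" "f \<cdot> h = Ident \<C> B"
  shows "g = h"
proof -
  have "g = g \<cdot> (f \<cdot> h)" using assms Comp_Ident_right by simp
  also have "\<dots> = (g \<cdot> f) \<cdot> h" using assms by (intro Comp_assoc)
  also have "\<dots> = h" using assms Comp_Ident_left by simp
  finally show ?thesis .
qed

end

definition inv_mor :: "('o, 'm, 'z) category_scheme \<Rightarrow> 'm \<Rightarrow> 'm" where
  "inv_mor \<D> f = (SOME g. g \<in> Hom \<D> (Cod \<D> f) (Dom \<D> f) \<and>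
     g \<cdot>\<^bsub>\<D>\<^esub> f = Ident \<D> (Dom \<D> f) \<and> f \<cdot>\<^bsub>\<D>\<^esub> g = Ident \<D> (Cod \<D> f))"

lemma inv_mor:
  assumes "iso_mor \<D> f" "f \<in> Hom \<D> A B"
  shows "inv_mor \<D> f \<in> Hom \<D> B A" "inv_mor \<D> f \<cdot>\<^bsub>\<D>\<^esub> f = Ident \<D> A" "f \<cdot>\<^bsub>\<D>\<^esub> inv_mor \<D> f = Ident \<D> B"
proof -
  have "\<exists>g. g \<in> Hom \<D> (Cod \<D> f) (Dom \<D> f) \<and>
     g \<cdot>\<^bsub>\<D>\<^esub> f = Ident \<D> (Dom \<D> f) \<and> f \<cdot>\<^bsub>\<D>\<^esub> g = Ident \<D> (Cod \<D> f)"
    using assms(1) by (auto simp: iso_mor_def)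
  from someI_ex[OF this] assms(2) show "inv_mor \<D> f \<in> Hom \<D> B A"
    "inv_mor \<D> f \<cdot>\<^bsub>\<D>\<^esub> f = Ident \<D> A" "f \<cdot>\<^bsub>\<D>\<^esub> inv_mor \<D> f = Ident \<D> B"
    by (auto simp: inv_mor_def Hom_iff)
qed

fun eval_zigzag ::
  "('o, 'm, 'y) category_scheme \<Rightarrow> ('p, 'n, 'z) category_scheme \<Rightarrow> ('o, 'm, 'p, 'n) cfunctor
    \<Rightarrow> 'm step list \<Rightarrow> 'o \<Rightarrow> 'n" where
  "eval_zigzag \<C> \<D> F [] Y = Ident \<D> (on_obj F Y)"
| "eval_zigzag \<C> \<D> F (Fwd f # p) Y = eval_zigzag \<C> \<D> F p Y \<cdot>\<^bsub>\<D>\<^esub> on_mor F f"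
| "eval_zigzag \<C> \<D> F (Bwd w # p) Y = eval_zigzag \<C> \<D> F p Y \<cdot>\<^bsub>\<D>\<^esub> inv_mor \<D> (on_mor F w)"

theorem localization_universal:
  fixes \<C> :: "('o, 'm, 'y) category_scheme"
  assumes F: "is_functor \<C> \<D> F"
    and inv: "\<And>w. w \<in> \<W> \<Longrightarrow> w \<in> Mor \<C> \<Longrightarrow> iso_mor \<D> (on_mor F w)"
  shows "\<exists>G. is_functor (localization \<C> \<W>) \<D> G \<and>
      (\<forall>X \<in> Obj \<C>. on_obj G X = on_obj F X) \<and>
      (\<forall>f \<in> Mor \<C>. on_mor G (on_mor (localization_functor \<C> \<W>) f) = on_mor F f)" (is ?ex)
    and "\<lbrakk>is_functor (localization \<C> \<W>) \<D> G; is_functor (localization \<C> \<W>) \<D> G';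
       \<forall>X \<in> Obj \<C>. on_obj G X = on_obj F X; \<forall>X \<in> Obj \<C>. on_obj G' X = on_obj F X;
       \<forall>f \<in> Mor \<C>. on_mor G (on_mor (localization_functor \<C> \<W>) f) = on_mor F f;
       \<forall>f \<in> Mor \<C>. on_mor G' (on_mor (localization_functor \<C> \<W>) f) = on_mor F f;
       h \<in> Mor (localization \<C> \<W>)\<rbrakk> \<Longrightarrow> on_mor G h = on_mor G' h"
proof -
  interpret C: category \<C> using F by (simp add: is_functor_def)
  interpret D: category \<D> using F by (simp add: is_functor_def)
  interpret L: category "localization \<C> \<W>" by (rule C.category_localization)
  have FH: "on_mor F f \<in> Hom \<D> (on_obj F X) (on_obj F Y)" if "f \<in> Hom \<C> X Y" for f X Y
    using F that by (auto simp: is_functor_def Hom_iff)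
  have FO: "on_obj F X \<in> Obj \<D>" if "X \<in> Obj \<C>" for X
    using F that by (auto simp: is_functor_def)
  have FC: "on_mor F (g \<cdot>\<^bsub>\<C>\<^esub> f) = on_mor F g \<cdot>\<^bsub>\<D>\<^esub> on_mor F f"
    if "f \<in> Hom \<C> X Y" "g \<in> Hom \<C> Y Z" for f g X Y Z
    using F that by (auto simp: is_functor_def Hom_iff)
  have FI: "on_mor F (Ident \<C> X) = Ident \<D> (on_obj F X)" if "X \<in> Obj \<C>" for X
    using F that by (auto simp: is_functor_def)
  have Finv: "inv_mor \<D> (on_mor F w) \<in> Hom \<D> (on_obj F Y) (on_obj F X)"
    "inv_mor \<D> (on_mor F w) \<cdot>\<^bsub>\<D>\<^esub> on_mor F w = Ident \<D> (on_obj F X)"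
    "on_mor F w \<cdot>\<^bsub>\<D>\<^esub> inv_mor \<D> (on_mor F w) = Ident \<D> (on_obj F Y)"
    if "w \<in> \<W>" "w \<in> Hom \<C> X Y" for w X Y
    using inv_mor[OF inv FH] that by (auto simp: Hom_iff)
  let ?ev = "eval_zigzag \<C> \<D> F"
  have ev: "?ev p Y \<in> Hom \<D> (on_obj F X) (on_obj F Y)" if "zigzag \<C> \<W> X p Y" for X p Y
    using that by induction (auto intro: D.Ident_Hom FO D.Comp_Hom FH Finv)
  have ev_append: "?ev (p @ q) Z = ?ev q Z \<cdot>\<^bsub>\<D>\<^esub> ?ev p Y"
    if "zigzag \<C> \<W> X p Y" "zigzag \<C> \<W> Y q Z" for X p Y q Z
    using that
  proof (induction)
    case (Nil X)
    then show ?case using D.Comp_Ident_right[OF ev] by simp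
  next
    case (Fwd f X Y p Y')
    then show ?case using D.Comp_assoc[OF FH[OF Fwd(1)] ev[OF Fwd(2)] ev[OF Fwd(4)]] by simp
  next
    case (Bwd w Y X p Y')
    then show ?case using D.Comp_assoc[OF Finv(1)[OF Bwd(1,2)] ev[OF Bwd(3)] ev[OF Bwd(5)]] by simp
  qed
  have mid: "?ev (u @ m @ v) Y = ?ev (u @ m' @ v) Y"
    if "zigzag \<C> \<W> X u A" "zigzag \<C> \<W> A m B" "zigzag \<C> \<W> A m' B" "zigzag \<C> \<W> B v Y"
      "?ev m B = ?ev m' B" for X u A m m' B v Y
    using that by (simp add: ev_append zigzag_append ev_append[OF _ zigzag_append])
  have ev_eq: "?ev p Y = ?ev q Y" if "zigzag_eq \<C> \<W> X Y p q" for X Y p q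
    using that
  proof (induction)
    case (comp X u A f D g B v Y)
    have fg: "g \<cdot>\<^bsub>\<C>\<^esub> f \<in> Hom \<C> A B" using comp C.Comp_Hom by blast
    have 1: "?ev [Fwd f, Fwd g] B = ?ev [Fwd (g \<cdot>\<^bsub>\<C>\<^esub> f)] B"
      using D.Comp_Ident_left[OF FH[OF comp(3)]] D.Comp_Ident_left[OF FH[OF fg]] FC[OF comp(2,3)] by simp
    show ?case
      by (rule mid[OF comp(1) _ C.zigzag_single[OF fg] comp(4) 1])
        (use comp in \<open>auto intro: zigzag.Fwd C.zigzag_single\<close>)
  next
    case (ident X u A v Y)
    have A: "A \<in> Obj \<C>" using ident C.zigzag_Obj by blast
    have 1: "?ev [Fwd (Ident \<C> A)] A = ?ev [] A"
      using D.Comp_Ident_left[OF D.Ident_Hom[OF FO[OF A]]] FI[OF A] by simp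
    show ?case
      using mid[OF ident(1) C.zigzag_single[OF C.Ident_Hom[OF A]] zigzag.Nil[OF A] ident(2) 1] by simp
  next
    case (Fwd_Bwd X u A w B v Y)
    have A: "A \<in> Obj \<C>" using Fwd_Bwd C.zigzag_Obj by blast
    have 1: "?ev [Fwd w, Bwd w] A = ?ev [] A"
      using Finv[OF Fwd_Bwd(2,3)] D.Comp_Ident_left by simp
    have 2: "zigzag \<C> \<W> A [Fwd w, Bwd w] A"
      using Fwd_Bwd C.zigzag_Bwd by (auto intro: zigzag.Fwd)
    show ?case
      using mid[OF Fwd_Bwd(1) 2 zigzag.Nil[OF A] Fwd_Bwd(4) 1] by simp
  next
    case (Bwd_Fwd X u B w A v Y)
    have B: "B \<in> Obj \<C>" using Bwd_Fwd C.zigzag_Obj by blast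
    have 1: "?ev [Bwd w, Fwd w] B = ?ev [] B"
      using Finv[OF Bwd_Fwd(2,3)] FH[OF Bwd_Fwd(3)] D.Comp_Ident_left by simp
    have 2: "zigzag \<C> \<W> B [Bwd w, Fwd w] B"
      using Bwd_Fwd C.zigzag_single by (auto intro: zigzag.Bwd)
    show ?case
      using mid[OF Bwd_Fwd(1) 2 zigzag.Nil[OF B] Bwd_Fwd(4) 1] by simp
  qed simp_all
  define L where "L = \<lparr>on_obj = on_obj F,
    on_mor = (\<lambda>K :: ('o \<times> 'm step list \<times> 'o) set. let (_, p, Y) = (SOME t. t \<in> K) in ?ev p Y)\<rparr>"
  have L_mor: "on_mor L (zigzag_class \<C> \<W> X p Y) = ?ev p Y" if p: "zigzag \<C> \<W> X p Y" for X p Y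
  proof -
    obtain q where q: "(SOME t. t \<in> zigzag_class \<C> \<W> X p Y) = (X, q, Y)" "zigzag_eq \<C> \<W> X Y p q"
      using C.zigzag_class_SOME[OF p] .
    then show ?thesis using ev_eq by (simp add: L_def)
  qed
  have MorE: "\<exists>p. h = zigzag_class \<C> \<W> X p Y \<and> zigzag \<C> \<W> X p Y"
    if "h \<in> Hom (localization \<C> \<W>) X Y" for h X Y
    using that by (auto simp: C.localization_Hom)
  have "is_functor (localization \<C> \<W>) \<D> L"
    unfolding is_functor_def
  proof (intro conjI ballI impI)
    fix A assume "A \<in> Obj (localization \<C> \<W>)"
    then have A: "A \<in> Obj \<C>" by (simp add: C.localization_Obj)
    then show "on_obj L A \<in> Obj \<D>" by (simp add: L_def FO)
    show "on_mor L (Ident (localization \<C> \<W>) A) = Ident \<D> (on_obj L A)"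
      using L_mor[OF zigzag.Nil[OF A]] by (simp add: C.localization_Ident) (simp add: L_def)
  next
    fix f assume "f \<in> Mor (localization \<C> \<W>)"
    then obtain p where "f = zigzag_class \<C> \<W> (Dom (localization \<C> \<W>) f) p (Cod (localization \<C> \<W>) f)"
      "zigzag \<C> \<W> (Dom (localization \<C> \<W>) f) p (Cod (localization \<C> \<W>) f)"
      using MorE by (metis Hom_iff)
    then show "on_mor L f \<in> Hom \<D> (on_obj L (Dom (localization \<C> \<W>) f)) (on_obj L (Cod (localization \<C> \<W>) f))"
      using ev L_mor by (simp add: L_def) metis
  next
    fix f g assume "f \<in> Mor (localization \<C> \<W>)" "g \<in> Mor (localization \<C> \<W>)"
      "Cod (localization \<C> \<W>) f = Dom (localization \<C> \<W>) g"
    then obtain X Y Z p q where "f = zigzag_class \<C> \<W> X p Y" "g = zigzag_class \<C> \<W> Y q Z"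
      and pq: "zigzag \<C> \<W> X p Y" "zigzag \<C> \<W> Y q Z"
      using MorE by (metis Hom_iff)
    then show "on_mor L (g \<cdot>\<^bsub>localization \<C> \<W>\<^esub> f) = on_mor L g \<cdot>\<^bsub>\<D>\<^esub> on_mor L f"
      by (simp add: C.localization_Comp L_mor zigzag_append ev_append[OF pq])
  qed (fact L.category_axioms D.category_axioms)+
  moreover have "on_mor L (on_mor (localization_functor \<C> \<W>) f) = on_mor F f" if "f \<in> Mor \<C>" for f
  proof -
    have f: "f \<in> Hom \<C> (Dom \<C> f) (Cod \<C> f)" using that by (simp add: Hom_def)
    show ?thesis
      using L_mor[OF C.zigzag_single[OF f]] D.Comp_Ident_left[OF FH[OF f]]
      by (simp add: C.localization_functor_mor[OF f])
  qed
  ultimately show ?ex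
    by (intro exI[of _ L]) (auto simp: L_def)

  have key: "on_mor K (zigzag_class \<C> \<W> X p Y) = ?ev p Y"
    if K: "is_functor (localization \<C> \<W>) \<D> K"
      and KO: "\<forall>X \<in> Obj \<C>. on_obj K X = on_obj F X"
      and KM: "\<forall>f \<in> Mor \<C>. on_mor K (on_mor (localization_functor \<C> \<W>) f) = on_mor F f"
      and p: "zigzag \<C> \<W> X p Y" for K X p Y
  proof -
    have KH: "on_mor K f \<in> Hom \<D> (on_obj F X) (on_obj F Y)"
      if "f \<in> Hom (localization \<C> \<W>) X Y" for f X Y
      using K KO that L.Hom_Obj[OF that] by (auto simp: is_functor_def Hom_iff C.localization_Obj)
    have KC: "on_mor K (g \<cdot>\<^bsub>localization \<C> \<W>\<^esub> f) = on_mor K g \<cdot>\<^bsub>\<D>\<^esub> on_mor K f"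
      if "f \<in> Hom (localization \<C> \<W>) X Y" "g \<in> Hom (localization \<C> \<W>) Y Z" for f g X Y Z
      using K that by (auto simp: is_functor_def Hom_iff)
    have KI: "on_mor K (Ident (localization \<C> \<W>) X) = Ident \<D> (on_obj F X)" if "X \<in> Obj \<C>" for X
      using K KO that by (auto simp: is_functor_def C.localization_Obj)
    have KF: "on_mor K (zigzag_class \<C> \<W> X [Fwd f] Y) = on_mor F f" if f: "f \<in> Hom \<C> X Y" for f X Y
      using KM f C.localization_functor_mor[OF f] by (metis Hom_iff)
    have KB: "on_mor K (zigzag_class \<C> \<W> Y [Bwd w] X) = inv_mor \<D> (on_mor F w)"
      if w: "w \<in> \<W>" "w \<in> Hom \<C> X Y" for w X Y
    proof (rule D.inverse_unique[OF FH[OF w(2)] KH Finv(1)[OF w] _ Finv(3)[OF w]])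
      note i = C.localization_inverts[OF w]
      show "zigzag_class \<C> \<W> Y [Bwd w] X \<in> Hom (localization \<C> \<W>) Y X" by (rule i)
      show "on_mor K (zigzag_class \<C> \<W> Y [Bwd w] X) \<cdot>\<^bsub>\<D>\<^esub> on_mor F w = Ident \<D> (on_obj F X)"
        using KC[OF i(1,2)] i(3) KI KF[OF w(2)] C.Hom_Obj[OF w(2)] by simp
    qed
    have app: "on_mor K (zigzag_class \<C> \<W> X (s # p) Y)
        = on_mor K (zigzag_class \<C> \<W> Z p Y) \<cdot>\<^bsub>\<D>\<^esub> on_mor K (zigzag_class \<C> \<W> X [s] Z)"
      if s: "zigzag \<C> \<W> X [s] Z" and p: "zigzag \<C> \<W> Z p Y" for X s Z p Y
    proof -
      have "zigzag_class \<C> \<W> X [s] Z \<in> Hom (localization \<C> \<W>) X Z"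
        "zigzag_class \<C> \<W> Z p Y \<in> Hom (localization \<C> \<W>) Z Y"
        using s p by (auto simp: C.localization_Hom)
      from KC[OF this] show ?thesis using C.localization_Comp[OF s p] by simp
    qed
    from p show ?thesis
    proof induction
      case (Nil X)
      then show ?case using KI by (simp add: C.localization_Ident)
    next
      case (Fwd f X Y p Z)
      then show ?case using app[OF C.zigzag_single[OF Fwd(1)] Fwd(2)] KF by simp
    next
      case (Bwd w Y X p Z)
      then show ?case using app[OF C.zigzag_Bwd[OF Bwd(1,2)] Bwd(3)] KB by simp
    qed
  qed
  show "on_mor G h = on_mor G' h"
    if hyps: "is_functor (localization \<C> \<W>) \<D> G" "is_functor (localization \<C> \<W>) \<D> G'"
       "\<forall>X \<in> Obj \<C>. on_obj G X = on_obj F X" "\<forall>X \<in> Obj \<C>. on_obj G' X = on_obj F X"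
       "\<forall>f \<in> Mor \<C>. on_mor G (on_mor (localization_functor \<C> \<W>) f) = on_mor F f"
       "\<forall>f \<in> Mor \<C>. on_mor G' (on_mor (localization_functor \<C> \<W>) f) = on_mor F f"
       "h \<in> Mor (localization \<C> \<W>)"
  proof -
    obtain X p Y where "h = zigzag_class \<C> \<W> X p Y" "zigzag \<C> \<W> X p Y"
      using hyps(7) MorE by (metis Hom_iff)
    then show ?thesis using key hyps by simp
  qed
qed


section \<open>Extriangulated categories\<close>

text \<open>\<open>Ext \<C> X A\<close> is the group \<open>\<E>(X, A)\<close>, \<open>ExtMap \<C> c a\<close> is \<open>\<E>(c, a)\<close>, and \<open>Real \<C> X A \<delta>\<close> is
  the class \<open>\<s>(\<delta>)\<close> of \<open>\<delta> \<in> \<E>(X, A)\<close>. The groups \<open>\<E>(X, A)\<close> need not be disjoint, hence the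
  object arguments of \<open>Real\<close>, \<open>push\<close> and \<open>pull\<close>.\<close>

record ('o, 'm, 'e) extri_category = "('o, 'm) add_category" +
  Ext :: "'o \<Rightarrow> 'o \<Rightarrow> 'e monoid"
  ExtMap :: "'m \<Rightarrow> 'm \<Rightarrow> 'e \<Rightarrow> 'e"
  Real :: "'o \<Rightarrow> 'o \<Rightarrow> 'e \<Rightarrow> ('m \<times> 'm) set"

definition ext_bifunctor :: "('o, 'm, 'e, 'z) extri_category_scheme \<Rightarrow> bool" where
  "ext_bifunctor \<C> \<longleftrightarrow>
     (\<forall>X \<in> Obj \<C>. \<forall>A \<in> Obj \<C>. comm_group (Ext \<C> X A)) \<and>
     (\<forall>X \<in> Obj \<C>. \<forall>X' \<in> Obj \<C>. \<forall>A \<in> Obj \<C>. \<forall>A' \<in> Obj \<C>. \<forall>c \<in> Hom \<C> X' X. \<forall>a \<in> Hom \<C> A A'.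
        ExtMap \<C> c a \<in> hom (Ext \<C> X A) (Ext \<C> X' A')) \<and>
     (\<forall>X \<in> Obj \<C>. \<forall>A \<in> Obj \<C>. \<forall>\<delta> \<in> carrier (Ext \<C> X A).
        ExtMap \<C> (Ident \<C> X) (Ident \<C> A) \<delta> = \<delta>) \<and>
     (\<forall>X X' X'' A A' A''. \<forall>c \<in> Hom \<C> X' X. \<forall>c' \<in> Hom \<C> X'' X'. \<forall>a \<in> Hom \<C> A A'. \<forall>a' \<in> Hom \<C> A' A''.
        \<forall>\<delta> \<in> carrier (Ext \<C> X A).
          ExtMap \<C> (c \<cdot>\<^bsub>\<C>\<^esub> c') (a' \<cdot>\<^bsub>\<C>\<^esub> a) \<delta> = ExtMap \<C> c' a' (ExtMap \<C> c a \<delta>))"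

definition push :: "('o, 'm, 'e, 'z) extri_category_scheme \<Rightarrow> 'o \<Rightarrow> 'm \<Rightarrow> 'e \<Rightarrow> 'e" where
  "push \<C> X a \<delta> = ExtMap \<C> (Ident \<C> X) a \<delta>"

definition pull :: "('o, 'm, 'e, 'z) extri_category_scheme \<Rightarrow> 'o \<Rightarrow> 'm \<Rightarrow> 'e \<Rightarrow> 'e" where
  "pull \<C> A c \<delta> = ExtMap \<C> c (Ident \<C> A) \<delta>"

definition ext_biadditive :: "('o, 'm, 'e, 'z) extri_category_scheme \<Rightarrow> bool" where
  "ext_biadditive \<C> \<longleftrightarrow>
     (\<forall>X \<in> Obj \<C>. \<forall>A A'. \<forall>a \<in> Hom \<C> A A'. \<forall>a' \<in> Hom \<C> A A'. \<forall>\<delta> \<in> carrier (Ext \<C> X A).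
        push \<C> X (a \<boxplus>\<^bsub>\<C>\<^esub> a') \<delta> = push \<C> X a \<delta> \<otimes>\<^bsub>Ext \<C> X A'\<^esub> push \<C> X a' \<delta>) \<and>
     (\<forall>A \<in> Obj \<C>. \<forall>X X'. \<forall>c \<in> Hom \<C> X' X. \<forall>c' \<in> Hom \<C> X' X. \<forall>\<delta> \<in> carrier (Ext \<C> X A).
        pull \<C> A (c \<boxplus>\<^bsub>\<C>\<^esub> c') \<delta> = pull \<C> A c \<delta> \<otimes>\<^bsub>Ext \<C> X' A\<^esub> pull \<C> A c' \<delta>)"

text \<open>\<open>(a, c) : \<delta> \<rightarrow> \<delta>'\<close> for \<open>\<delta> \<in> \<E>(X, A)\<close> and \<open>\<delta>' \<in> \<E>(X', A')\<close>.\<close>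

definition ext_morphism ::
  "('o, 'm, 'e, 'z) extri_category_scheme \<Rightarrow> 'o \<Rightarrow> 'o \<Rightarrow> 'e \<Rightarrow> 'o \<Rightarrow> 'o \<Rightarrow> 'e \<Rightarrow> 'm \<Rightarrow> 'm \<Rightarrow> bool" where
  "ext_morphism \<C> X A \<delta> X' A' \<delta>' a c \<longleftrightarrow>
     a \<in> Hom \<C> A A' \<and> c \<in> Hom \<C> X X' \<and>
     \<delta> \<in> carrier (Ext \<C> X A) \<and> \<delta>' \<in> carrier (Ext \<C> X' A') \<and>
     push \<C> X a \<delta> = pull \<C> A' c \<delta>'"

definition sequences :: "('o, 'm, 'z) category_scheme \<Rightarrow> 'o \<Rightarrow> 'o \<Rightarrow> ('m \<times> 'm) set" where
  "sequences \<C> A X = {(x, y). \<exists>B \<in> Obj \<C>. x \<in> Hom \<C> A B \<and> y \<in> Hom \<C> B X}"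

definition seq_rel ::
  "('o, 'm, 'z) category_scheme \<Rightarrow> 'o \<Rightarrow> 'o \<Rightarrow> (('m \<times> 'm) \<times> ('m \<times> 'm)) set" where
  "seq_rel \<C> A X = {((x, y), (x', y')). (x, y) \<in> sequences \<C> A X \<and> (x', y') \<in> sequences \<C> A X \<and>
     (\<exists>b \<in> Hom \<C> (Cod \<C> x) (Cod \<C> x'). iso_mor \<C> b \<and> b \<cdot>\<^bsub>\<C>\<^esub> x = x' \<and> y' \<cdot>\<^bsub>\<C>\<^esub> b = y)}"

definition seq_class ::
  "('o, 'm, 'z) category_scheme \<Rightarrow> 'o \<Rightarrow> 'o \<Rightarrow> 'm \<Rightarrow> 'm \<Rightarrow> ('m \<times> 'm) set" where
  "seq_class \<C> A X x y = seq_rel \<C> A X `` {(x, y)}"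

definition etriangle ::
  "('o, 'm, 'e, 'z) extri_category_scheme \<Rightarrow> 'o \<Rightarrow> 'o \<Rightarrow> 'o \<Rightarrow> 'm \<Rightarrow> 'm \<Rightarrow> 'e \<Rightarrow> bool" where
  "etriangle \<C> A B X x y \<delta> \<longleftrightarrow>
     A \<in> Obj \<C> \<and> B \<in> Obj \<C> \<and> X \<in> Obj \<C> \<and> x \<in> Hom \<C> A B \<and> y \<in> Hom \<C> B X \<and>
     \<delta> \<in> carrier (Ext \<C> X A) \<and> Real \<C> X A \<delta> = seq_class \<C> A X x y"

definition is_realization :: "('o, 'm, 'e, 'z) extri_category_scheme \<Rightarrow> bool" where
  "is_realization \<C> \<longleftrightarrow>
     (\<forall>X \<in> Obj \<C>. \<forall>A \<in> Obj \<C>. \<forall>\<delta> \<in> carrier (Ext \<C> X A).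
        Real \<C> X A \<delta> \<in> sequences \<C> A X // seq_rel \<C> A X) \<and>
     (\<forall>A B X x y \<delta> A' B' X' x' y' \<delta>' a c.
        etriangle \<C> A B X x y \<delta> \<and> etriangle \<C> A' B' X' x' y' \<delta>' \<and>
        ext_morphism \<C> X A \<delta> X' A' \<delta>' a c \<longrightarrow>
        (\<exists>b \<in> Hom \<C> B B'. b \<cdot>\<^bsub>\<C>\<^esub> x = x' \<cdot>\<^bsub>\<C>\<^esub> a \<and> y' \<cdot>\<^bsub>\<C>\<^esub> b = c \<cdot>\<^bsub>\<C>\<^esub> y))"

text \<open>The first clause is \<open>\<s>(0) = [A \<rightarrow> A \<oplus> X \<rightarrow> X]\<close>. In the second, \<open>\<epsilon>\<close> is the extension
  \<open>\<delta> \<oplus> \<delta>' \<in> \<E>(X \<oplus> X', A \<oplus> A')\<close>, given by its components \<open>(\<delta>, 0, 0, \<delta>')\<close>; the three direct sums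
  are those of the \<open>A\<close>'s, the \<open>B\<close>'s and the \<open>X\<close>'s, and \<open>x \<oplus> x' = i\<^sub>B x p\<^sub>A + j\<^sub>B x' q\<^sub>A\<close>, similarly for
  \<open>y \<oplus> y'\<close>.\<close>

definition additive_realization :: "('o, 'm, 'e, 'z) extri_category_scheme \<Rightarrow> bool" where
  "additive_realization \<C> \<longleftrightarrow>
     (\<forall>A X P i j p q. is_biproduct \<C> A X P i j p q \<longrightarrow>
        Real \<C> X A \<one>\<^bsub>Ext \<C> X A\<^esub> = seq_class \<C> A X i q) \<and>
     (\<forall>A B X x y \<delta> A' B' X' x' y' \<delta>' AA iA jA pA qA BB iB jB pB qB XX iX jX pX qX \<epsilon>.
        etriangle \<C> A B X x y \<delta> \<and> etriangle \<C> A' B' X' x' y' \<delta>' \<and>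
        is_biproduct \<C> A A' AA iA jA pA qA \<and>
        is_biproduct \<C> B B' BB iB jB pB qB \<and>
        is_biproduct \<C> X X' XX iX jX pX qX \<and>
        \<epsilon> \<in> carrier (Ext \<C> XX AA) \<and>
        ExtMap \<C> iX pA \<epsilon> = \<delta> \<and>
        ExtMap \<C> iX qA \<epsilon> = \<one>\<^bsub>Ext \<C> X A'\<^esub> \<and>
        ExtMap \<C> jX pA \<epsilon> = \<one>\<^bsub>Ext \<C> X' A\<^esub> \<and>
        ExtMap \<C> jX qA \<epsilon> = \<delta>' \<longrightarrow>
        Real \<C> XX AA \<epsilon> = seq_class \<C> AA XX
          ((iB \<cdot>\<^bsub>\<C>\<^esub> x \<cdot>\<^bsub>\<C>\<^esub> pA) \<boxplus>\<^bsub>\<C>\<^esub> (jB \<cdot>\<^bsub>\<C>\<^esub> x' \<cdot>\<^bsub>\<C>\<^esub> qA))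
          ((iX \<cdot>\<^bsub>\<C>\<^esub> y \<cdot>\<^bsub>\<C>\<^esub> pB) \<boxplus>\<^bsub>\<C>\<^esub> (jX \<cdot>\<^bsub>\<C>\<^esub> y' \<cdot>\<^bsub>\<C>\<^esub> qB)))"

locale extriangulated_category = additive_category \<C>
  for \<C> :: "('o, 'm, 'e, 'z) extri_category_scheme" (structure) +
  assumes Ext_bifunctor: "ext_bifunctor \<C>"
    and ET1: "ext_biadditive \<C>"
    and ET2: "is_realization \<C>" "additive_realization \<C>"
    and ET3: "\<lbrakk>etriangle \<C> A B X x y \<delta>; etriangle \<C> A' B' X' x' y' \<delta>';
        a \<in> Hom \<C> A A'; b \<in> Hom \<C> B B'; b \<cdot> x = x' \<cdot> a\<rbrakk>
      \<Longrightarrow> \<exists>c. ext_morphism \<C> X A \<delta> X' A' \<delta>' a c \<and> y' \<cdot> b = c \<cdot> y"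
    and ET3_op: "\<lbrakk>etriangle \<C> A B X x y \<delta>; etriangle \<C> A' B' X' x' y' \<delta>';
        b \<in> Hom \<C> B B'; c \<in> Hom \<C> X X'; y' \<cdot> b = c \<cdot> y\<rbrakk>
      \<Longrightarrow> \<exists>a. ext_morphism \<C> X A \<delta> X' A' \<delta>' a c \<and> b \<cdot> x = x' \<cdot> a"
    and ET4: "\<lbrakk>etriangle \<C> A B D f f' \<delta>; etriangle \<C> B C F g g' \<delta>'\<rbrakk>
      \<Longrightarrow> \<exists>E h' \<delta>'' d e.
            etriangle \<C> A C E (g \<cdot> f) h' \<delta>'' \<and>
            d \<in> Hom \<C> D E \<and> e \<in> Hom \<C> E F \<and> d \<cdot> f' = h' \<cdot> g \<and> e \<cdot> h' = g' \<and>
            etriangle \<C> D E F d e (push \<C> F f' \<delta>') \<and>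
            pull \<C> A d \<delta>'' = \<delta> \<and> push \<C> E f \<delta>'' = pull \<C> B e \<delta>'"
    and ET4_op: "\<lbrakk>etriangle \<C> D A B f' f \<delta>; etriangle \<C> F B C g' g \<delta>'\<rbrakk>
      \<Longrightarrow> \<exists>E h' \<delta>'' d e.
            etriangle \<C> E A C h' (g \<cdot> f) \<delta>'' \<and>
            d \<in> Hom \<C> D E \<and> e \<in> Hom \<C> E F \<and> h' \<cdot> d = f' \<and> f \<cdot> h' = g' \<cdot> e \<and>
            etriangle \<C> D E F d e (pull \<C> D g' \<delta>) \<and>
            \<delta>' = push \<C> C e \<delta>'' \<and> push \<C> B d \<delta> = pull \<C> E g \<delta>''"

definition conflation ::
  "('o, 'm, 'e, 'z) extri_category_scheme \<Rightarrow> 'o \<Rightarrow> 'o \<Rightarrow> 'o \<Rightarrow> 'm \<Rightarrow> 'm \<Rightarrow> bool" where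
  "conflation \<C> A B X x y \<longleftrightarrow> (\<exists>\<delta>. etriangle \<C> A B X x y \<delta>)"

definition inflation :: "('o, 'm, 'e, 'z) extri_category_scheme \<Rightarrow> 'm \<Rightarrow> bool" where
  "inflation \<C> x \<longleftrightarrow> (\<exists>A B X y. conflation \<C> A B X x y)"

definition deflation :: "('o, 'm, 'e, 'z) extri_category_scheme \<Rightarrow> 'm \<Rightarrow> bool" where
  "deflation \<C> y \<longleftrightarrow> (\<exists>A B X x. conflation \<C> A B X x y)"

definition WIC :: "('o, 'm, 'e, 'z) extri_category_scheme \<Rightarrow> bool" where
  "WIC \<C> \<longleftrightarrow> (\<forall>A B D. \<forall>f \<in> Hom \<C> A B. \<forall>g \<in> Hom \<C> B D.
     (inflation \<C> (g \<cdot>\<^bsub>\<C>\<^esub> f) \<longrightarrow> inflation \<C> f) \<and>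
     (deflation \<C> (g \<cdot>\<^bsub>\<C>\<^esub> f) \<longrightarrow> deflation \<C> g))"


section \<open>Cotorsion pairs\<close>

text \<open>Full subcategories of \<open>\<C>\<close> are given by their sets of objects.\<close>

definition additive_summand_closed ::
  "('o, 'm, 'z) add_category_scheme \<Rightarrow> 'o set \<Rightarrow> bool" where
  "additive_summand_closed \<C> \<U> \<longleftrightarrow> \<U> \<subseteq> Obj \<C> \<and>
     (\<exists>Z \<in> \<U>. is_zero_object \<C> Z) \<and>
     (\<forall>A \<in> \<U>. \<forall>B \<in> \<U>. \<forall>P i j p q. is_biproduct \<C> A B P i j p q \<longrightarrow> P \<in> \<U>) \<and>
     (\<forall>A \<in> \<U>. \<forall>B. isomorphic \<C> A B \<longrightarrow> B \<in> \<U>) \<and>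
     (\<forall>P \<in> \<U>. \<forall>A B i j p q. is_biproduct \<C> A B P i j p q \<longrightarrow> A \<in> \<U>)"

definition Ext_vanishes ::
  "('o, 'm, 'e, 'z) extri_category_scheme \<Rightarrow> 'o set \<Rightarrow> 'o set \<Rightarrow> bool" where
  "Ext_vanishes \<C> \<U> \<V> \<longleftrightarrow> (\<forall>U \<in> \<U>. \<forall>V \<in> \<V>. carrier (Ext \<C> U V) = {\<one>\<^bsub>Ext \<C> U V\<^esub>})"

definition cotorsion_pair ::
  "('o, 'm, 'e, 'z) extri_category_scheme \<Rightarrow> 'o set \<times> 'o set \<Rightarrow> bool" where
  "cotorsion_pair \<C> = (\<lambda>(\<U>, \<V>).
     additive_summand_closed \<C> \<U> \<and> additive_summand_closed \<C> \<V> \<and>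
     Ext_vanishes \<C> \<U> \<V> \<and>
     (\<forall>X \<in> Obj \<C>. \<exists>U \<in> \<U>. \<exists>V \<in> \<V>. \<exists>x y. conflation \<C> V U X x y) \<and>
     (\<forall>X \<in> Obj \<C>. \<exists>U \<in> \<U>. \<exists>V \<in> \<V>. \<exists>x y. conflation \<C> X V U x y))"

type_synonym 'o twin = "('o set \<times> 'o set) \<times> ('o set \<times> 'o set)"

definition twin_cotorsion_pair ::
  "('o, 'm, 'e, 'z) extri_category_scheme \<Rightarrow> 'o twin \<Rightarrow> bool" where
  "twin_cotorsion_pair \<C> = (\<lambda>((\<S>, \<T>), (\<U>, \<V>)).
     cotorsion_pair \<C> (\<S>, \<T>) \<and> cotorsion_pair \<C> (\<U>, \<V>) \<and> Ext_vanishes \<C> \<S> \<V>)"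

definition N_i :: "('o, 'm, 'e, 'z) extri_category_scheme \<Rightarrow> 'o twin \<Rightarrow> 'o set" where
  "N_i \<C> = (\<lambda>((\<S>, \<T>), (\<U>, \<V>)).
     {X \<in> Obj \<C>. \<exists>V \<in> \<V>. \<exists>S \<in> \<S>. \<exists>x y. conflation \<C> V S X x y})"

definition N_f :: "('o, 'm, 'e, 'z) extri_category_scheme \<Rightarrow> 'o twin \<Rightarrow> 'o set" where
  "N_f \<C> = (\<lambda>((\<S>, \<T>), (\<U>, \<V>)).
     {X \<in> Obj \<C>. \<exists>V \<in> \<V>. \<exists>S \<in> \<S>. \<exists>x y. conflation \<C> X V S x y})"

definition hovey_twin_cotorsion_pair ::
  "('o, 'm, 'e, 'z) extri_category_scheme \<Rightarrow> 'o twin \<Rightarrow> bool" where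
  "hovey_twin_cotorsion_pair \<C> \<P> \<longleftrightarrow> twin_cotorsion_pair \<C> \<P> \<and> N_i \<C> \<P> = N_f \<C> \<P>"

definition wFib :: "('o, 'm, 'e, 'z) extri_category_scheme \<Rightarrow> 'o set \<Rightarrow> 'm set" where
  "wFib \<C> \<V> = {f. \<exists>V \<in> \<V>. \<exists>A B x. conflation \<C> V A B x f}"

definition wCof :: "('o, 'm, 'e, 'z) extri_category_scheme \<Rightarrow> 'o set \<Rightarrow> 'm set" where
  "wCof \<C> \<S> = {f. \<exists>S \<in> \<S>. \<exists>A B y. conflation \<C> A B S f y}"

definition weak_equivs ::
  "('o, 'm, 'e, 'z) extri_category_scheme \<Rightarrow> 'o set \<Rightarrow> 'o set \<Rightarrow> 'm set" where
  "weak_equivs \<C> \<S> \<V> = {p \<cdot>\<^bsub>\<C>\<^esub> i | p i. i \<in> wCof \<C> \<S> \<and> p \<in> wFib \<C> \<V> \<and> Cod \<C> i = Dom \<C> p}"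

end

theory Submission
  imports Defs
begin

text \<open>Every object \<open>X\<close> has a replacement \<open>X \<leftarrow> A \<rightarrow> R\<close> consisting of a morphism in \<open>wFib\<close> with
  \<open>A \<in> \<U>\<close> and one in \<open>wCof\<close> with \<open>R \<in> \<Z>\<close>. Because \<open>\<E>(\<U>, \<V>) = 0 = \<E>(\<S>, \<T>)\<close>, a morphism \<open>X \<rightarrow> Y\<close> lifts to
  replacements, uniquely modulo \<open>\<I>\<close> on \<open>R\<close>; this is a functor \<open>\<C> \<rightarrow> \<Z>/\<I>\<close>. It visibly inverts \<open>wFib\<close>,
  and \<open>wCof\<close> between objects of \<open>\<U>\<close>. That it inverts all of \<open>wCof\<close> is where \<open>\<N>\<^sup>i = \<N>\<^sup>f\<close> enters: if
  \<open>A \<rightarrow> B\<close> is a \<open>\<U>\<close>-approximation and \<open>B \<rightarrow> D\<close> is in \<open>wCof\<close> with \<open>D \<in> \<U>\<close>, then \<open>A \<rightarrow> B \<rightarrow> D\<close> is also the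
  composite of a morphism in \<open>wCof\<close> and one in \<open>wFib\<close> between objects of \<open>\<U>\<close>. The functor therefore
  descends to the localization, and there it is inverse to \<open>f \<mapsto> \<ell>(f)\<close>, the replacement spans
  providing the natural isomorphism.\<close>

section \<open>Categories\<close>

text \<open>The third term of an inflation is only a weak cokernel, so objects obtained from one
  inflation by two applications of (ET4) are not identified by a universal property. They are
  identified because an endomorphism of such a term that fixes the deflation and the extension has
  the form 1 - z with z z = 0.

  The difficulty with a weak cofibration \<open>j : B \<rightarrow> D\<close> is that a
  \<U>-approximation \<open>p : A \<rightarrow> B\<close> spoils it: \<open>j p\<close> need not be
  an inflation. Enlarging the target by an object of \<U> \<inter> \<V> into which A embeds repairs
  this. The cone of the enlarged map can be computed in two ways, one placing it in \<U>, the other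
  in \<N>, and \<U> \<inter> \<N> = \<S>.

  The replacement is chosen to be the identity on \<Z>, so that the inverse functor is strict there
  and the statement on Hom sets can be read off from it.\<close>

context category
begin

text \<open>Composition laws phrased through \<open>Dom\<close> and \<open>Cod\<close>: their side
  conditions can be discharged by rewriting, whereas the \<open>Hom\<close> forms leave intermediate
  objects to be guessed.\<close>

lemma Comp_Mor: "\<lbrakk>f \<in> Mor \<C>; g \<in> Mor \<C>; Dom \<C> g = Cod \<C> f\<rbrakk> \<Longrightarrow> g \<cdot> f \<in> Mor \<C>"
  and Dom_Comp: "\<lbrakk>f \<in> Mor \<C>; g \<in> Mor \<C>; Dom \<C> g = Cod \<C> f\<rbrakk> \<Longrightarrow> Dom \<C> (g \<cdot> f) = Dom \<C> f"
  and Cod_Comp: "\<lbrakk>f \<in> Mor \<C>; g \<in> Mor \<C>; Dom \<C> g = Cod \<C> f\<rbrakk> \<Longrightarrow> Cod \<C> (g \<cdot> f) = Cod \<C> g"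
  using Comp_Hom[of f "Dom \<C> f" "Cod \<C> f" g "Cod \<C> g"] by (auto simp: Hom_iff)

lemma Ident_Mor: "A \<in> Obj \<C> \<Longrightarrow> Ident \<C> A \<in> Mor \<C>"
  and Dom_Ident: "A \<in> Obj \<C> \<Longrightarrow> Dom \<C> (Ident \<C> A) = A"
  and Cod_Ident: "A \<in> Obj \<C> \<Longrightarrow> Cod \<C> (Ident \<C> A) = A"
  using Ident_Hom[of A] by (auto simp: Hom_iff)

lemma Comp_Ident: "\<lbrakk>f \<in> Mor \<C>; Dom \<C> f = A\<rbrakk> \<Longrightarrow> f \<cdot> Ident \<C> A = f"
  and Ident_Comp: "\<lbrakk>f \<in> Mor \<C>; Cod \<C> f = A\<rbrakk> \<Longrightarrow> Ident \<C> A \<cdot> f = f"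
  by (auto intro!: Comp_Ident_left Comp_Ident_right simp: Hom_iff)

lemma Comp_Comp: "\<lbrakk>f \<in> Mor \<C>; g \<in> Mor \<C>; h \<in> Mor \<C>; Dom \<C> g = Cod \<C> f; Dom \<C> h = Cod \<C> g\<rbrakk>
    \<Longrightarrow> (h \<cdot> g) \<cdot> f = h \<cdot> (g \<cdot> f)"
  by (rule Comp_assoc[symmetric]) (auto simp: Hom_iff)

lemmas cat_simps = Comp_Mor Dom_Comp Cod_Comp Ident_Mor Dom_Ident Cod_Ident Comp_Ident Ident_Comp
  Comp_Comp Dom_Obj Cod_Obj

text \<open>Rewriting nests composites to the right, which hides the factor
  \<open>g \<cdot> f\<close> of a known equation \<open>g \<cdot> f = k\<close>; this form applies
  the equation inside a longer composite.\<close>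

lemma Comp_reassoc:
  "\<lbrakk>g \<cdot> f = k; f \<in> Mor \<C>; g \<in> Mor \<C>; Dom \<C> g = Cod \<C> f; h \<in> Mor \<C>; Cod \<C> h = Dom \<C> f\<rbrakk>
    \<Longrightarrow> g \<cdot> (f \<cdot> h) = k \<cdot> h"
  using Comp_Comp[of h f g] by simp

lemma iso_morI:
  assumes "f \<in> Hom \<C> A B" "g \<in> Hom \<C> B A" "g \<cdot> f = Ident \<C> A" "f \<cdot> g = Ident \<C> B"
  shows "iso_mor \<C> f"
  using assms by (auto simp: iso_mor_def Hom_iff)

lemma iso_morE:
  assumes "iso_mor \<C> f" "f \<in> Hom \<C> A B"
  obtains g where "g \<in> Hom \<C> B A" "g \<cdot> f = Ident \<C> A" "f \<cdot> g = Ident \<C> B" "iso_mor \<C> g"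
  using assms by (fastforce simp: iso_mor_def Hom_iff)

lemma iso_Ident: "A \<in> Obj \<C> \<Longrightarrow> iso_mor \<C> (Ident \<C> A)"
  by (rule iso_morI[of _ A A "Ident \<C> A"]) (auto simp: Hom_iff cat_simps)

lemma iso_Comp:
  assumes f: "f \<in> Hom \<C> A B" "iso_mor \<C> f" and g: "g \<in> Hom \<C> B D" "iso_mor \<C> g"
  shows "iso_mor \<C> (g \<cdot> f)"
proof -
  obtain f' where f': "f' \<in> Hom \<C> B A" "f' \<cdot> f = Ident \<C> A" "f \<cdot> f' = Ident \<C> B"
    using iso_morE[OF f(2,1)] .
  obtain g' where g': "g' \<in> Hom \<C> D B" "g' \<cdot> g = Ident \<C> B" "g \<cdot> g' = Ident \<C> D"
    using iso_morE[OF g(2,1)] .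
  have "g' \<cdot> (g \<cdot> f) = f" "f \<cdot> (f' \<cdot> g') = g'"
    using f f' g g' by (auto simp: Hom_iff cat_simps Comp_reassoc[OF g'(2)] Comp_reassoc[OF f'(3)])
  then show ?thesis
    using f f' g g' by (intro iso_morI[of _ A D "f' \<cdot> g'"]) (auto simp: Hom_iff cat_simps)
qed

lemma iso_cancel_right:
  assumes f: "f \<in> Hom \<C> A B" "iso_mor \<C> f" and g: "g \<in> Hom \<C> B D" and gf: "iso_mor \<C> (g \<cdot> f)"
  shows "iso_mor \<C> g"
proof -
  obtain f' where f': "f' \<in> Hom \<C> B A" "f' \<cdot> f = Ident \<C> A" "f \<cdot> f' = Ident \<C> B" "iso_mor \<C> f'"
    using iso_morE[OF f(2,1)] .
  have "g = (g \<cdot> f) \<cdot> f'" using f f' g by (auto simp: Hom_iff cat_simps)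
  then show ?thesis
    using iso_Comp[OF f'(1,4) Comp_Hom[OF f(1) g] gf] by simp
qed

text \<open>The composites give \<open>f\<close> a left and a right inverse, and these agree. Meant
  for comparison maps whose composites are known to be invertible but not to be identities.\<close>

lemma iso_of_iso_composites:
  assumes f: "f \<in> Hom \<C> A B" and g: "g \<in> Hom \<C> B A" and "iso_mor \<C> (g \<cdot> f)" "iso_mor \<C> (f \<cdot> g)"
  shows "iso_mor \<C> f"
proof -
  have gf: "g \<cdot> f \<in> Hom \<C> A A" and fg: "f \<cdot> g \<in> Hom \<C> B B" using f g by (auto intro: Comp_Hom)
  obtain l where l: "l \<in> Hom \<C> A A" "l \<cdot> (g \<cdot> f) = Ident \<C> A" using iso_morE[OF assms(3) gf] .
  obtain r where r: "r \<in> Hom \<C> B B" "(f \<cdot> g) \<cdot> r = Ident \<C> B" using iso_morE[OF assms(4) fg] .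
  have "(l \<cdot> g) \<cdot> f = Ident \<C> A" "f \<cdot> (g \<cdot> r) = Ident \<C> B"
    using f g l r by (auto simp: Hom_iff cat_simps)
  moreover have lg: "l \<cdot> g \<in> Hom \<C> B A" "g \<cdot> r \<in> Hom \<C> B A" using f g l r by (auto intro: Comp_Hom)
  ultimately have "l \<cdot> g = g \<cdot> r" by (intro inverse_unique[OF f lg])
  with lg f show ?thesis
    using \<open>(l \<cdot> g) \<cdot> f = Ident \<C> A\<close> \<open>f \<cdot> (g \<cdot> r) = Ident \<C> B\<close> by (auto intro: iso_morI)
qed

lemma iso_left_cancel:
  assumes "f \<in> Hom \<C> A B" "iso_mor \<C> f" "g \<in> Hom \<C> E A" "h \<in> Hom \<C> E A" "f \<cdot> g = f \<cdot> h"
  shows "g = h"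
proof -
  obtain f' where f': "f' \<in> Hom \<C> B A" "f' \<cdot> f = Ident \<C> A" using iso_morE[OF assms(2,1)] .
  have "g = f' \<cdot> (f \<cdot> g)" "h = f' \<cdot> (f \<cdot> h)"
    using assms(1,3,4) f' by (auto simp: Hom_iff cat_simps Comp_reassoc[OF f'(2)])
  with assms(5) show ?thesis by simp
qed

lemma full_subcategory_Hom:
  "Hom (full_subcategory \<C> \<Z>) A B = (if A \<in> \<Z> \<and> B \<in> \<Z> then Hom \<C> A B else {})"
  by (auto simp: full_subcategory_def Hom_def)

lemma category_full_subcategory:
  assumes "\<Z> \<subseteq> Obj \<C>"
  shows "category (full_subcategory \<C> \<Z>)"
proof -
  have *: "Obj (full_subcategory \<C> \<Z>) = \<Z>" "Ident (full_subcategory \<C> \<Z>) = Ident \<C>"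
    "Comp (full_subcategory \<C> \<Z>) = Comp \<C>" "Dom (full_subcategory \<C> \<Z>) = Dom \<C>"
    "Cod (full_subcategory \<C> \<Z>) = Cod \<C>"
    "Mor (full_subcategory \<C> \<Z>) = {f \<in> Mor \<C>. Dom \<C> f \<in> \<Z> \<and> Cod \<C> f \<in> \<Z>}"
    by (auto simp: full_subcategory_def)
  show ?thesis
    using assms by unfold_locales (auto simp: * Hom_iff cat_simps)
qed

end

lemma (in category) is_functor_inclusion:
  assumes "\<Z> \<subseteq> Obj \<C>"
  shows "is_functor (full_subcategory \<C> \<Z>) \<C> inclusion_functor"
  using assms category_full_subcategory[OF assms] category_axioms
  by (auto simp: is_functor_def inclusion_functor_def full_subcategory_def Hom_iff)

lemma (in category) is_functor_inclusion_self: "is_functor \<C> \<C> inclusion_functor"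
  using category_axioms by (auto simp: is_functor_def inclusion_functor_def Hom_iff)

lemma is_functor_compose:
  assumes F: "is_functor \<A> \<B> F" and G: "is_functor \<B> \<D> G"
  shows "is_functor \<A> \<D> (G \<circ>\<^sub>F F)"
proof -
  have *: "on_mor F f \<in> Mor \<B>" "Dom \<B> (on_mor F f) = on_obj F (Dom \<A> f)"
    "Cod \<B> (on_mor F f) = on_obj F (Cod \<A> f)" if "f \<in> Mor \<A>" for f
    using F that by (auto simp: is_functor_def Hom_iff)
  show ?thesis
    using F G by (auto simp: is_functor_def compose_functor_def Hom_iff *)
qed

lemma is_functor_Hom:
  "\<lbrakk>is_functor \<A> \<B> F; f \<in> Hom \<A> X Y\<rbrakk> \<Longrightarrow> on_mor F f \<in> Hom \<B> (on_obj F X) (on_obj F Y)"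
  by (auto simp: is_functor_def Hom_iff)

lemma is_functor_Comp:
  "\<lbrakk>is_functor \<A> \<B> F; f \<in> Hom \<A> X Y; g \<in> Hom \<A> Y Z\<rbrakk>
    \<Longrightarrow> on_mor F (g \<cdot>\<^bsub>\<A>\<^esub> f) = on_mor F g \<cdot>\<^bsub>\<B>\<^esub> on_mor F f"
  by (auto simp: is_functor_def Hom_iff)

lemma is_functor_Ident:
  "\<lbrakk>is_functor \<A> \<B> F; X \<in> Obj \<A>\<rbrakk> \<Longrightarrow> on_mor F (Ident \<A> X) = Ident \<B> (on_obj F X)"
  by (auto simp: is_functor_def)

text \<open>The components of a functor are total functions, so two functors that agree on the
  category may still differ as records; identity morphisms provide the natural isomorphism.\<close>

lemma naturally_isomorphic_if_eq:
  assumes F: "is_functor \<A> \<B> F" and G: "is_functor \<A> \<B> G"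
    and obj: "\<And>X. X \<in> Obj \<A> \<Longrightarrow> on_obj F X = on_obj G X"
    and mor: "\<And>f. f \<in> Mor \<A> \<Longrightarrow> on_mor F f = on_mor G f"
  shows "naturally_isomorphic \<A> \<B> F G"
proof -
  interpret A: category \<A> using F by (simp add: is_functor_def)
  interpret B: category \<B> using F by (simp add: is_functor_def)
  have GH: "on_mor G f \<in> Hom \<B> (on_obj G (Dom \<A> f)) (on_obj G (Cod \<A> f))" if "f \<in> Mor \<A>" for f
    using G that by (auto simp: is_functor_def)
  have GO: "on_obj G X \<in> Obj \<B>" if "X \<in> Obj \<A>" for X
    using G that by (auto simp: is_functor_def)
  have "nat_iso \<A> \<B> F G (\<lambda>X. Ident \<B> (on_obj F X))"
    using F G GH GO obj mor
    by (auto simp: nat_iso_def A.cat_simps B.Comp_Ident_left[OF GH] B.Comp_Ident_right[OF GH] B.iso_Ident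
        intro: B.Ident_Hom)
  then show ?thesis by (auto simp: naturally_isomorphic_def)
qed

section \<open>Additive categories and ideal quotients\<close>

text \<open>Inversion depends on the Hom group that is meant; the group is read off from the domain
  and codomain of \<open>f\<close>.\<close>

definition mneg :: "('o, 'm, 'z) add_category_scheme \<Rightarrow> 'm \<Rightarrow> 'm" where
  "mneg \<C> f = inv\<^bsub>Hom_group \<C> (Dom \<C> f) (Cod \<C> f)\<^esub> f"

context additive_category
begin

lemma Hom_group_simps:
  "carrier (Hom_group \<C> A B) = Hom \<C> A B" "mult (Hom_group \<C> A B) = MAdd \<C>"
  "one (Hom_group \<C> A B) = MZero \<C> A B"
  by (auto simp: Hom_group_def)

lemma MAdd_Hom: "\<lbrakk>f \<in> Hom \<C> A B; g \<in> Hom \<C> A B\<rbrakk> \<Longrightarrow> f \<boxplus> g \<in> Hom \<C> A B"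
  and MZero_Hom: "\<lbrakk>A \<in> Obj \<C>; B \<in> Obj \<C>\<rbrakk> \<Longrightarrow> MZero \<C> A B \<in> Hom \<C> A B"
  and mneg_Hom: "f \<in> Hom \<C> A B \<Longrightarrow> mneg \<C> f \<in> Hom \<C> A B"
proof -
  show "f \<boxplus> g \<in> Hom \<C> A B" if "f \<in> Hom \<C> A B" "g \<in> Hom \<C> A B"
  proof -
    interpret G: comm_group "Hom_group \<C> A B" using that Hom_Obj[OF that(1)] by (intro Hom_comm_group) auto
    show ?thesis using G.m_closed[of f g] that by (simp add: Hom_group_simps)
  qed
  show "MZero \<C> A B \<in> Hom \<C> A B" if "A \<in> Obj \<C>" "B \<in> Obj \<C>"
  proof -
    interpret G: comm_group "Hom_group \<C> A B" using that by (intro Hom_comm_group)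
    show ?thesis using G.one_closed by (simp add: Hom_group_simps)
  qed
  show "mneg \<C> f \<in> Hom \<C> A B" if "f \<in> Hom \<C> A B"
  proof -
    interpret G: comm_group "Hom_group \<C> A B" using that Hom_Obj[OF that(1)] by (intro Hom_comm_group) auto
    show ?thesis using G.inv_closed[of f] that by (simp add: Hom_group_simps mneg_def Hom_iff)
  qed
qed

lemma MAdd_Mor: "\<lbrakk>f \<in> Mor \<C>; g \<in> Mor \<C>; Dom \<C> f = Dom \<C> g; Cod \<C> f = Cod \<C> g\<rbrakk> \<Longrightarrow> f \<boxplus> g \<in> Mor \<C>"
  and Dom_MAdd: "\<lbrakk>f \<in> Mor \<C>; g \<in> Mor \<C>; Dom \<C> f = Dom \<C> g; Cod \<C> f = Cod \<C> g\<rbrakk> \<Longrightarrow> Dom \<C> (f \<boxplus> g) = Dom \<C> g"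
  and Cod_MAdd: "\<lbrakk>f \<in> Mor \<C>; g \<in> Mor \<C>; Dom \<C> f = Dom \<C> g; Cod \<C> f = Cod \<C> g\<rbrakk> \<Longrightarrow> Cod \<C> (f \<boxplus> g) = Cod \<C> g"
  using MAdd_Hom[of f "Dom \<C> g" "Cod \<C> g" g] by (auto simp: Hom_iff)

lemma MZero_Mor: "\<lbrakk>A \<in> Obj \<C>; B \<in> Obj \<C>\<rbrakk> \<Longrightarrow> MZero \<C> A B \<in> Mor \<C>"
  and Dom_MZero: "\<lbrakk>A \<in> Obj \<C>; B \<in> Obj \<C>\<rbrakk> \<Longrightarrow> Dom \<C> (MZero \<C> A B) = A"
  and Cod_MZero: "\<lbrakk>A \<in> Obj \<C>; B \<in> Obj \<C>\<rbrakk> \<Longrightarrow> Cod \<C> (MZero \<C> A B) = B"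
  using MZero_Hom[of A B] by (auto simp: Hom_iff)

lemma mneg_Mor: "f \<in> Mor \<C> \<Longrightarrow> mneg \<C> f \<in> Mor \<C>"
  and Dom_mneg: "f \<in> Mor \<C> \<Longrightarrow> Dom \<C> (mneg \<C> f) = Dom \<C> f"
  and Cod_mneg: "f \<in> Mor \<C> \<Longrightarrow> Cod \<C> (mneg \<C> f) = Cod \<C> f"
  using mneg_Hom[of f "Dom \<C> f" "Cod \<C> f"] by (auto simp: Hom_iff)

lemma comm_group_of_Mor:
  "f \<in> Mor \<C> \<Longrightarrow> comm_group (Hom_group \<C> (Dom \<C> f) (Cod \<C> f))"
  by (intro Hom_comm_group Dom_Obj Cod_Obj)

lemma MAdd_assoc:
  assumes "f \<in> Mor \<C>" "g \<in> Mor \<C>" "h \<in> Mor \<C>" "Dom \<C> f = Dom \<C> g" "Cod \<C> f = Cod \<C> g"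
    "Dom \<C> g = Dom \<C> h" "Cod \<C> g = Cod \<C> h"
  shows "(f \<boxplus> g) \<boxplus> h = f \<boxplus> (g \<boxplus> h)"
proof -
  interpret G: comm_group "Hom_group \<C> (Dom \<C> f) (Cod \<C> f)" by (rule comm_group_of_Mor) fact
  show ?thesis using G.m_assoc[of f g h] assms by (simp add: Hom_group_simps Hom_iff)
qed

lemma MAdd_commute:
  assumes "f \<in> Mor \<C>" "g \<in> Mor \<C>" "Dom \<C> f = Dom \<C> g" "Cod \<C> f = Cod \<C> g"
  shows "f \<boxplus> g = g \<boxplus> f"
proof -
  interpret G: comm_group "Hom_group \<C> (Dom \<C> f) (Cod \<C> f)" by (rule comm_group_of_Mor) fact
  show ?thesis using G.m_comm[of f g] assms by (simp add: Hom_group_simps Hom_iff)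
qed

lemma MAdd_left_commute:
  assumes "f \<in> Mor \<C>" "g \<in> Mor \<C>" "h \<in> Mor \<C>" "Dom \<C> f = Dom \<C> g" "Cod \<C> f = Cod \<C> g"
    "Dom \<C> g = Dom \<C> h" "Cod \<C> g = Cod \<C> h"
  shows "f \<boxplus> (g \<boxplus> h) = g \<boxplus> (f \<boxplus> h)"
proof -
  interpret G: comm_group "Hom_group \<C> (Dom \<C> f) (Cod \<C> f)" by (rule comm_group_of_Mor) fact
  show ?thesis using G.m_lcomm[of f g h] assms by (simp add: Hom_group_simps Hom_iff)
qed

lemma MAdd_MZero: "\<lbrakk>f \<in> Mor \<C>; Dom \<C> f = A; Cod \<C> f = B\<rbrakk> \<Longrightarrow> f \<boxplus> MZero \<C> A B = f"
  and MZero_MAdd: "\<lbrakk>f \<in> Mor \<C>; Dom \<C> f = A; Cod \<C> f = B\<rbrakk> \<Longrightarrow> MZero \<C> A B \<boxplus> f = f"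
proof -
  assume *: "f \<in> Mor \<C>" "Dom \<C> f = A" "Cod \<C> f = B"
  interpret G: comm_group "Hom_group \<C> (Dom \<C> f) (Cod \<C> f)" by (rule comm_group_of_Mor) fact
  show "f \<boxplus> MZero \<C> A B = f" "MZero \<C> A B \<boxplus> f = f"
    using G.r_one[of f] G.l_one[of f] * by (simp_all add: Hom_group_simps Hom_iff)
qed

lemma MAdd_mneg: "f \<in> Mor \<C> \<Longrightarrow> f \<boxplus> mneg \<C> f = MZero \<C> (Dom \<C> f) (Cod \<C> f)"
  and mneg_mneg: "f \<in> Mor \<C> \<Longrightarrow> mneg \<C> (mneg \<C> f) = f"
proof -
  assume *: "f \<in> Mor \<C>"
  interpret G: comm_group "Hom_group \<C> (Dom \<C> f) (Cod \<C> f)" by (rule comm_group_of_Mor) fact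
  show "f \<boxplus> mneg \<C> f = MZero \<C> (Dom \<C> f) (Cod \<C> f)"
    using G.r_inv[of f] * by (simp add: Hom_group_simps Hom_iff mneg_def)
  show "mneg \<C> (mneg \<C> f) = f"
    using G.inv_inv[of f] * Dom_mneg[OF *] Cod_mneg[OF *] by (simp add: Hom_group_simps Hom_iff mneg_def)
qed

lemma mneg_MAdd: "f \<in> Mor \<C> \<Longrightarrow> mneg \<C> f \<boxplus> f = MZero \<C> (Dom \<C> f) (Cod \<C> f)"
  using MAdd_mneg[of f] MAdd_commute[of f "mneg \<C> f"] by (simp add: mneg_Mor Dom_mneg Cod_mneg)

lemma Comp_MAdd:
  "\<lbrakk>f \<in> Mor \<C>; f' \<in> Mor \<C>; g \<in> Mor \<C>; Dom \<C> f = Dom \<C> f'; Cod \<C> f = Cod \<C> f'; Dom \<C> g = Cod \<C> f'\<rbrakk>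
    \<Longrightarrow> g \<cdot> (f \<boxplus> f') = (g \<cdot> f) \<boxplus> (g \<cdot> f')"
  by (rule Comp_MAdd_right[of _ "Dom \<C> f'" "Cod \<C> f'"]) (auto simp: Hom_iff)

lemma MAdd_Comp:
  "\<lbrakk>f \<in> Mor \<C>; g \<in> Mor \<C>; g' \<in> Mor \<C>; Dom \<C> g = Dom \<C> g'; Cod \<C> g = Cod \<C> g'; Dom \<C> g' = Cod \<C> f\<rbrakk>
    \<Longrightarrow> (g \<boxplus> g') \<cdot> f = (g \<cdot> f) \<boxplus> (g' \<cdot> f)"
  by (rule Comp_MAdd_left[of _ "Dom \<C> f" "Cod \<C> f" _ "Cod \<C> g'"]) (auto simp: Hom_iff)

lemma MAdd_mneg_cancel:
  assumes "f \<in> Mor \<C>" "g \<in> Mor \<C>" "Dom \<C> f = Dom \<C> g" "Cod \<C> f = Cod \<C> g"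
  shows "f \<boxplus> (mneg \<C> f \<boxplus> g) = g" "mneg \<C> f \<boxplus> (f \<boxplus> g) = g"
  using assms MAdd_assoc[of f "mneg \<C> f" g] MAdd_assoc[of "mneg \<C> f" f g]
  by (auto simp: mneg_Mor Dom_mneg Cod_mneg MAdd_mneg mneg_MAdd MZero_MAdd)

lemma MAdd_self_eq_zero:
  assumes "f \<in> Mor \<C>" "f \<boxplus> f = f" shows "f = MZero \<C> (Dom \<C> f) (Cod \<C> f)"
  using MAdd_mneg_cancel(2)[of f f] assms by (simp add: mneg_MAdd)

lemma Comp_MZero: "\<lbrakk>g \<in> Mor \<C>; Dom \<C> g = B; A \<in> Obj \<C>\<rbrakk> \<Longrightarrow> g \<cdot> MZero \<C> A B = MZero \<C> A (Cod \<C> g)"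
proof -
  assume *: "g \<in> Mor \<C>" "Dom \<C> g = B" "A \<in> Obj \<C>"
  then have B: "B \<in> Obj \<C>" by (auto simp: Dom_Obj)
  let ?h = "g \<cdot> MZero \<C> A B"
  have h: "?h \<in> Mor \<C>" "Dom \<C> ?h = A" "Cod \<C> ?h = Cod \<C> g"
    using * B by (auto simp: cat_simps MZero_Mor Dom_MZero Cod_MZero)
  have "?h \<boxplus> ?h = g \<cdot> (MZero \<C> A B \<boxplus> MZero \<C> A B)"
    using * B by (simp add: Comp_MAdd MZero_Mor Dom_MZero Cod_MZero)
  then have "?h \<boxplus> ?h = ?h" using * B by (simp add: MZero_Mor Dom_MZero Cod_MZero MAdd_MZero)
  then show ?thesis using MAdd_self_eq_zero[OF h(1)] h by simp
qed

lemma MZero_Comp: "\<lbrakk>g \<in> Mor \<C>; Cod \<C> g = A; B \<in> Obj \<C>\<rbrakk> \<Longrightarrow> MZero \<C> A B \<cdot> g = MZero \<C> (Dom \<C> g) B"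
proof -
  assume *: "g \<in> Mor \<C>" "Cod \<C> g = A" "B \<in> Obj \<C>"
  then have A: "A \<in> Obj \<C>" by (auto simp: Cod_Obj)
  let ?h = "MZero \<C> A B \<cdot> g"
  have h: "?h \<in> Mor \<C>" "Dom \<C> ?h = Dom \<C> g" "Cod \<C> ?h = B"
    using * A by (auto simp: cat_simps MZero_Mor Dom_MZero Cod_MZero)
  have "?h \<boxplus> ?h = (MZero \<C> A B \<boxplus> MZero \<C> A B) \<cdot> g"
    using * A by (simp add: MAdd_Comp MZero_Mor Dom_MZero Cod_MZero)
  then have "?h \<boxplus> ?h = ?h" using * A by (simp add: MZero_Mor Dom_MZero Cod_MZero MAdd_MZero)
  then show ?thesis using MAdd_self_eq_zero[OF h(1)] h by simp
qed

lemma mneg_unique: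
  assumes "f \<in> Mor \<C>" "g \<in> Mor \<C>" "Dom \<C> f = Dom \<C> g" "Cod \<C> f = Cod \<C> g"
    "f \<boxplus> g = MZero \<C> (Dom \<C> g) (Cod \<C> g)"
  shows "g = mneg \<C> f"
  using MAdd_mneg_cancel(2)[of f g] assms by (simp add: MAdd_MZero mneg_Mor Dom_mneg Cod_mneg)

lemma Comp_mneg: "\<lbrakk>f \<in> Mor \<C>; g \<in> Mor \<C>; Dom \<C> g = Cod \<C> f\<rbrakk> \<Longrightarrow> g \<cdot> mneg \<C> f = mneg \<C> (g \<cdot> f)"
  by (rule mneg_unique)
    (auto simp: cat_simps mneg_Mor Dom_mneg Cod_mneg MAdd_mneg Comp_MZero simp flip: Comp_MAdd)

lemma mneg_Comp: "\<lbrakk>f \<in> Mor \<C>; g \<in> Mor \<C>; Dom \<C> g = Cod \<C> f\<rbrakk> \<Longrightarrow> mneg \<C> g \<cdot> f = mneg \<C> (g \<cdot> f)"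
  by (rule mneg_unique)
    (auto simp: cat_simps mneg_Mor Dom_mneg Cod_mneg MAdd_mneg MZero_Comp simp flip: MAdd_Comp)

lemma mneg_MAdd_distrib:
  assumes "f \<in> Mor \<C>" "g \<in> Mor \<C>" "Dom \<C> f = Dom \<C> g" "Cod \<C> f = Cod \<C> g"
  shows "mneg \<C> (f \<boxplus> g) = mneg \<C> f \<boxplus> mneg \<C> g"
  using assms
  by (intro mneg_unique[symmetric])
    (auto simp: MAdd_Mor Dom_MAdd Cod_MAdd mneg_Mor Dom_mneg Cod_mneg MAdd_mneg
      MAdd_assoc MAdd_left_commute[of g "mneg \<C> f"] MAdd_mneg_cancel MAdd_MZero)

lemma mneg_MZero: "\<lbrakk>A \<in> Obj \<C>; B \<in> Obj \<C>\<rbrakk> \<Longrightarrow> mneg \<C> (MZero \<C> A B) = MZero \<C> A B"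
  by (rule mneg_unique[symmetric]) (auto simp: MZero_Mor Dom_MZero Cod_MZero MAdd_MZero)

text \<open>Sums become right-nested, with composition and negation distributed over them.
  Commutativity is left out of this normal form and is supplied instance by instance.\<close>

lemmas add_simps = cat_simps MAdd_Mor Dom_MAdd Cod_MAdd MZero_Mor Dom_MZero Cod_MZero
  mneg_Mor Dom_mneg Cod_mneg MAdd_assoc MAdd_MZero MZero_MAdd MAdd_mneg mneg_MAdd mneg_mneg
  Comp_MAdd MAdd_Comp MAdd_mneg_cancel Comp_MZero MZero_Comp Comp_mneg mneg_Comp
  mneg_MAdd_distrib mneg_MZero

lemma zero_object_Obj: "is_zero_object \<C> Z \<Longrightarrow> Z \<in> Obj \<C>"
  by (simp add: is_zero_object_def)

lemma Hom_zero_object: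
  assumes "is_zero_object \<C> Z" "A \<in> Obj \<C>"
  shows "Hom \<C> A Z = {MZero \<C> A Z}" "Hom \<C> Z A = {MZero \<C> Z A}"
  using assms MZero_Hom[of A Z] MZero_Hom[of Z A] unfolding is_zero_object_def by auto

lemma Ident_zero_object: "is_zero_object \<C> Z \<Longrightarrow> Ident \<C> Z = MZero \<C> Z Z"
  using Hom_zero_object[of Z Z] Ident_Hom zero_object_Obj by blast

lemma zero_objects_isomorphic:
  assumes "is_zero_object \<C> Z" "is_zero_object \<C> Z'" shows "isomorphic \<C> Z Z'"
proof -
  have "Z \<in> Obj \<C>" "Z' \<in> Obj \<C>" using assms by (auto dest: zero_object_Obj)
  moreover then have "iso_mor \<C> (MZero \<C> Z Z')"
    using assms by (intro iso_morI[of _ Z Z' "MZero \<C> Z' Z"]) (auto simp: Hom_iff add_simps Ident_zero_object)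
  ultimately show ?thesis using MZero_Hom by (auto simp: isomorphic_def)
qed

lemma biproduct_sym:
  "is_biproduct \<C> A B P i j p q \<Longrightarrow> is_biproduct \<C> B A P j i q p"
  unfolding is_biproduct_def Hom_iff using MAdd_commute[of "i \<cdot> p" "j \<cdot> q"] by (auto simp: cat_simps)

lemma biproductD:
  assumes "is_biproduct \<C> A B P i j p q"
  shows "A \<in> Obj \<C>" "B \<in> Obj \<C>" "P \<in> Obj \<C>"
    "i \<in> Mor \<C>" "Dom \<C> i = A" "Cod \<C> i = P" "j \<in> Mor \<C>" "Dom \<C> j = B" "Cod \<C> j = P"
    "p \<in> Mor \<C>" "Dom \<C> p = P" "Cod \<C> p = A" "q \<in> Mor \<C>" "Dom \<C> q = P" "Cod \<C> q = B"
    "p \<cdot> i = Ident \<C> A" "q \<cdot> j = Ident \<C> B" "q \<cdot> i = MZero \<C> A B" "p \<cdot> j = MZero \<C> B A"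
    "(i \<cdot> p) \<boxplus> (j \<cdot> q) = Ident \<C> P"
  using assms by (auto simp: is_biproduct_def Hom_iff)

lemma biproduct_reassoc:
  assumes "is_biproduct \<C> A B P i j p q" "h \<in> Mor \<C>"
  shows "Cod \<C> h = A \<Longrightarrow> p \<cdot> (i \<cdot> h) = h" "Cod \<C> h = B \<Longrightarrow> q \<cdot> (j \<cdot> h) = h"
    "Cod \<C> h = A \<Longrightarrow> q \<cdot> (i \<cdot> h) = MZero \<C> (Dom \<C> h) B"
    "Cod \<C> h = B \<Longrightarrow> p \<cdot> (j \<cdot> h) = MZero \<C> (Dom \<C> h) A"
  using assms(2) biproductD[OF assms(1)]
    Comp_reassoc[OF biproductD(16)[OF assms(1)], of h] Comp_reassoc[OF biproductD(17)[OF assms(1)], of h]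
    Comp_reassoc[OF biproductD(18)[OF assms(1)], of h] Comp_reassoc[OF biproductD(19)[OF assms(1)], of h]
  by (auto simp: add_simps)

lemma biproduct_zero_left:
  assumes "is_zero_object \<C> Z" "A \<in> Obj \<C>"
  shows "is_biproduct \<C> Z A A (MZero \<C> Z A) (Ident \<C> A) (MZero \<C> A Z) (Ident \<C> A)"
  using assms zero_object_Obj[OF assms(1)] by (auto simp: is_biproduct_def Hom_iff add_simps Ident_zero_object)

text \<open>The decomposition \<open>A \<oplus> B\<close> in which \<open>A\<close> is embedded as the graph of \<open>f : A \<rightarrow> B\<close>.\<close>

lemma biproduct_graph:
  assumes b: "is_biproduct \<C> A B P i j p q" and f: "f \<in> Hom \<C> A B"
  shows "is_biproduct \<C> A B P (i \<boxplus> j \<cdot> f) j p (q \<boxplus> mneg \<C> (f \<cdot> p))"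
proof -
  note d = biproductD[OF b]
  have f': "f \<in> Mor \<C>" "Dom \<C> f = A" "Cod \<C> f = B" using f by (auto simp: Hom_iff)
  have "(i \<boxplus> j \<cdot> f) \<cdot> p \<boxplus> j \<cdot> (q \<boxplus> mneg \<C> (f \<cdot> p)) = i \<cdot> p \<boxplus> j \<cdot> q"
    by (simp add: d(1-15) f' add_simps MAdd_left_commute[of "j \<cdot> (f \<cdot> p)" "j \<cdot> q"])
  then show ?thesis
    by (simp add: is_biproduct_def Hom_iff d f' add_simps biproduct_reassoc[OF b])
qed

lemma biproduct_iso:
  assumes b: "is_biproduct \<C> A B P i j p q" and u: "u \<in> Hom \<C> P P'" "v \<in> Hom \<C> P' P"
    and vu: "v \<cdot> u = Ident \<C> P" and uv: "u \<cdot> v = Ident \<C> P'"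
  shows "is_biproduct \<C> A B P' (u \<cdot> i) (u \<cdot> j) (p \<cdot> v) (q \<cdot> v)"
proof -
  note d = biproductD[OF b]
  have u': "u \<in> Mor \<C>" "Dom \<C> u = P" "Cod \<C> u = P'" "v \<in> Mor \<C>" "Dom \<C> v = P'" "Cod \<C> v = P"
    "P' \<in> Obj \<C>"
    using u Hom_Obj[OF u(1)] by (auto simp: Hom_iff)
  have "u \<cdot> ((i \<cdot> p) \<boxplus> (j \<cdot> q)) \<cdot> v = Ident \<C> P'"
    by (simp add: d u' uv cat_simps)
  then have "u \<cdot> (i \<cdot> (p \<cdot> v)) \<boxplus> u \<cdot> (j \<cdot> (q \<cdot> v)) = Ident \<C> P'"
    by (simp add: d(1-15) u' add_simps)
  then show ?thesis
    by (simp add: is_biproduct_def Hom_iff d(1-19) u' add_simps Comp_reassoc[OF vu])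
qed

end

lemma (in additive_category) additive_full_subcategory:
  assumes sub: "\<Z> \<subseteq> Obj \<C>" and zero: "\<exists>Z \<in> \<Z>. is_zero_object \<C> Z"
    and sum: "\<And>A B. \<lbrakk>A \<in> \<Z>; B \<in> \<Z>\<rbrakk> \<Longrightarrow> \<exists>P \<in> \<Z>. \<exists>i j p q. is_biproduct \<C> A B P i j p q"
  shows "additive_category (full_subcategory \<C> \<Z>)"
proof -
  let ?Z = "full_subcategory \<C> \<Z>"
  have *: "Obj ?Z = \<Z>" "Ident ?Z = Ident \<C>" "Comp ?Z = Comp \<C>" "Dom ?Z = Dom \<C>"
    "Cod ?Z = Cod \<C>" "MAdd ?Z = MAdd \<C>" "MZero ?Z = MZero \<C>"
    by (auto simp: full_subcategory_def)
  interpret Z: category ?Z by (rule category_full_subcategory[OF sub])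
  show ?thesis
  proof (intro additive_category.intro additive_category_axioms.intro Z.category_axioms)
    fix A B assume "A \<in> Obj ?Z" "B \<in> Obj ?Z"
    then have AB: "A \<in> \<Z>" "B \<in> \<Z>" by (simp_all add: *)
    then have "Hom_group ?Z A B = Hom_group \<C> A B"
      by (simp add: Hom_group_def * full_subcategory_Hom)
    then show "comm_group (Hom_group ?Z A B)" using AB sub by (auto intro!: Hom_comm_group)
  next
    fix A B assume "A \<in> Obj ?Z" "B \<in> Obj ?Z"
    then have AB: "A \<in> \<Z>" "B \<in> \<Z>" by (simp_all add: *)
    obtain P i j p q where "P \<in> \<Z>" "is_biproduct \<C> A B P i j p q" using sum[OF AB] by blast
    then have "is_biproduct ?Z A B P i j p q"
      using AB by (simp add: is_biproduct_def * full_subcategory_Hom)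
    then show "\<exists>P i j p q. is_biproduct ?Z A B P i j p q" by blast
  next
    fix f A B f' g D
    assume "f \<in> Hom ?Z A B" "f' \<in> Hom ?Z A B" "g \<in> Hom ?Z B D"
    then show "g \<cdot>\<^bsub>?Z\<^esub> (f \<boxplus>\<^bsub>?Z\<^esub> f') = (g \<cdot>\<^bsub>?Z\<^esub> f) \<boxplus>\<^bsub>?Z\<^esub> (g \<cdot>\<^bsub>?Z\<^esub> f')"
      by (auto simp: * full_subcategory_Hom split: if_splits intro: Comp_MAdd_right)
  next
    fix f A B g D g'
    assume "f \<in> Hom ?Z A B" "g \<in> Hom ?Z B D" "g' \<in> Hom ?Z B D"
    then show "(g \<boxplus>\<^bsub>?Z\<^esub> g') \<cdot>\<^bsub>?Z\<^esub> f = (g \<cdot>\<^bsub>?Z\<^esub> f) \<boxplus>\<^bsub>?Z\<^esub> (g' \<cdot>\<^bsub>?Z\<^esub> f)"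
      by (auto simp: * full_subcategory_Hom split: if_splits intro: Comp_MAdd_left)
  next
    obtain Z where Z: "Z \<in> \<Z>" "is_zero_object \<C> Z" using zero by blast
    then have "is_zero_object ?Z Z"
      using sub by (simp add: is_zero_object_def * full_subcategory_Hom subset_eq)
    then show "\<exists>Z. is_zero_object ?Z Z" by blast
  qed
qed

section \<open>The ideal of morphisms factoring through a class of objects\<close>

locale additive_ideal = additive_category \<C>
  for \<C> :: "('o, 'm, 'z) add_category_scheme" (structure) +
  fixes \<I> :: "'o set"
  assumes I_Obj: "\<I> \<subseteq> Obj \<C>"
    and I_zero: "\<exists>Z \<in> \<I>. is_zero_object \<C> Z"
    and I_biproduct: "\<lbrakk>A \<in> \<I>; B \<in> \<I>\<rbrakk> \<Longrightarrow> \<exists>P \<in> \<I>. \<exists>i j p q. is_biproduct \<C> A B P i j p q"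
begin

abbreviation null :: "'m \<Rightarrow> bool" where "null h \<equiv> factors_through \<C> \<I> h"

lemma nullI: "\<lbrakk>J \<in> \<I>; u \<in> Hom \<C> X J; v \<in> Hom \<C> J Y\<rbrakk> \<Longrightarrow> null (v \<cdot> u)"
  unfolding factors_through_def
  by (rule bexI[of _ J], rule bexI[of _ u], rule bexI[of _ v]) (auto simp: Hom_iff cat_simps)

lemma nullE:
  assumes "null h"
  obtains J u v where "J \<in> \<I>" "J \<in> Obj \<C>" "u \<in> Hom \<C> (Dom \<C> h) J" "v \<in> Hom \<C> J (Cod \<C> h)" "h = v \<cdot> u"
  using assms I_Obj by (auto simp: factors_through_def)

lemma null_MZero: "\<lbrakk>A \<in> Obj \<C>; B \<in> Obj \<C>\<rbrakk> \<Longrightarrow> null (MZero \<C> A B)"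
proof -
  assume AB: "A \<in> Obj \<C>" "B \<in> Obj \<C>"
  obtain Z where Z: "Z \<in> \<I>" "Z \<in> Obj \<C>" using I_zero I_Obj by blast
  have "null (MZero \<C> Z B \<cdot> MZero \<C> A Z)" using AB Z by (intro nullI[OF Z(1) MZero_Hom MZero_Hom])
  then show ?thesis using AB Z by (simp add: add_simps)
qed

lemma null_Comp:
  assumes "null h" "h \<in> Hom \<C> A B"
  shows "g \<in> Hom \<C> B D \<Longrightarrow> null (g \<cdot> h)" "f \<in> Hom \<C> E A \<Longrightarrow> null (h \<cdot> f)"
proof -
  obtain J u v where J: "J \<in> \<I>" "u \<in> Hom \<C> A J" "v \<in> Hom \<C> J B" "h = v \<cdot> u"
    using nullE[OF assms(1)] assms(2) by (metis Hom_iff)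
  { assume g: "g \<in> Hom \<C> B D"
    have "null ((g \<cdot> v) \<cdot> u)" using g J by (intro nullI[OF J(1,2)] Comp_Hom)
    then show "null (g \<cdot> h)" using g J by (simp add: Comp_assoc) }
  { assume f: "f \<in> Hom \<C> E A"
    have "null (v \<cdot> (u \<cdot> f))" using f J by (intro nullI[OF J(1) _ J(3)] Comp_Hom)
    then show "null (h \<cdot> f)" using f J by (simp add: Comp_assoc) }
qed

text \<open>The factorizations \<open>v \<cdot> u\<close> and \<open>t \<cdot> s\<close> combine
  into the column (u, s) followed by the row (v, t) through J \<oplus> K; this is where closure of
  \<I> under biproducts is used.\<close>

lemma null_MAdd:
  assumes "null f" "f \<in> Hom \<C> A B" "null g" "g \<in> Hom \<C> A B"
  shows "null (f \<boxplus> g)"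
proof -
  obtain J u v where J: "J \<in> \<I>" "u \<in> Hom \<C> A J" "v \<in> Hom \<C> J B" "f = v \<cdot> u"
    using nullE[OF assms(1)] assms(2) by (metis Hom_iff)
  obtain K s t where K: "K \<in> \<I>" "s \<in> Hom \<C> A K" "t \<in> Hom \<C> K B" "g = t \<cdot> s"
    using nullE[OF assms(3)] assms(4) by (metis Hom_iff)
  obtain P i j p q where P: "P \<in> \<I>" and b: "is_biproduct \<C> J K P i j p q"
    using I_biproduct[OF J(1) K(1)] by blast
  note d = biproductD[OF b]
  have m: "u \<in> Mor \<C>" "Dom \<C> u = A" "Cod \<C> u = J" "v \<in> Mor \<C>" "Dom \<C> v = J" "Cod \<C> v = B"
    "s \<in> Mor \<C>" "Dom \<C> s = A" "Cod \<C> s = K" "t \<in> Mor \<C>" "Dom \<C> t = K" "Cod \<C> t = B"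
    using J K by (auto simp: Hom_iff)
  have A: "A \<in> Obj \<C>" "B \<in> Obj \<C>" using Hom_Obj assms(2) by auto
  have "null ((v \<cdot> p \<boxplus> t \<cdot> q) \<cdot> (i \<cdot> u \<boxplus> j \<cdot> s))"
    by (rule nullI[OF P, of _ A _ B]) (simp_all add: Hom_iff d m add_simps)
  also have "(v \<cdot> p \<boxplus> t \<cdot> q) \<cdot> (i \<cdot> u \<boxplus> j \<cdot> s) = f \<boxplus> g"
    by (simp add: d m A J(4) K(4) add_simps biproduct_reassoc[OF b])
  finally show ?thesis .
qed

lemma null_mneg: assumes "null f" "f \<in> Hom \<C> A B" shows "null (mneg \<C> f)"
proof -
  have "null (mneg \<C> (Ident \<C> B) \<cdot> f)"
    using assms Hom_Obj[OF assms(2)] by (intro null_Comp(1)[OF assms, of _ B] mneg_Hom Ident_Hom) auto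
  then show ?thesis using assms(2) Hom_Obj[OF assms(2)] by (auto simp: Hom_iff add_simps)
qed

text \<open>With the relation stated for the difference f - g, reflexivity, symmetry and
  transitivity become closure of the null morphisms under zero, negation and sums.\<close>

lemma ideal_rel_iff:
  "(f, g) \<in> ideal_rel \<C> \<I> \<longleftrightarrow>
    f \<in> Mor \<C> \<and> g \<in> Mor \<C> \<and> Dom \<C> f = Dom \<C> g \<and> Cod \<C> f = Cod \<C> g \<and> null (f \<boxplus> mneg \<C> g)"
proof
  assume "(f, g) \<in> ideal_rel \<C> \<I>"
  then obtain X Y h where h: "f \<in> Hom \<C> X Y" "g \<in> Hom \<C> X Y" "h \<in> Hom \<C> X Y" "null h" "f = g \<boxplus> h"
    by (auto simp: ideal_rel_def)
  have "f \<boxplus> mneg \<C> g = h"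
    using h by (simp add: Hom_iff add_simps MAdd_commute[of g h])
  with h show "f \<in> Mor \<C> \<and> g \<in> Mor \<C> \<and> Dom \<C> f = Dom \<C> g \<and> Cod \<C> f = Cod \<C> g \<and> null (f \<boxplus> mneg \<C> g)"
    by (simp add: Hom_iff)
next
  assume *: "f \<in> Mor \<C> \<and> g \<in> Mor \<C> \<and> Dom \<C> f = Dom \<C> g \<and> Cod \<C> f = Cod \<C> g \<and> null (f \<boxplus> mneg \<C> g)"
  have "f = g \<boxplus> (f \<boxplus> mneg \<C> g)"
    using * by (simp add: add_simps MAdd_left_commute[of g f])
  moreover have "f \<boxplus> mneg \<C> g \<in> Hom \<C> (Dom \<C> g) (Cod \<C> g)" using * by (simp add: Hom_iff add_simps)
  ultimately show "(f, g) \<in> ideal_rel \<C> \<I>"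
    using * unfolding ideal_rel_def by (auto simp: Hom_iff Dom_Obj Cod_Obj)
qed

lemma equiv_ideal_rel: "equiv (Mor \<C>) (ideal_rel \<C> \<I>)"
proof (rule equivI)
  show "ideal_rel \<C> \<I> \<subseteq> Mor \<C> \<times> Mor \<C>" by (auto simp: ideal_rel_iff)
  show "refl_on (Mor \<C>) (ideal_rel \<C> \<I>)"
    by (auto simp: refl_on_def ideal_rel_iff add_simps null_MZero)
  show "sym (ideal_rel \<C> \<I>)"
  proof (rule symI)
    fix f g assume "(f, g) \<in> ideal_rel \<C> \<I>"
    then have *: "f \<in> Mor \<C>" "g \<in> Mor \<C>" "Dom \<C> f = Dom \<C> g" "Cod \<C> f = Cod \<C> g" "null (f \<boxplus> mneg \<C> g)"
      by (auto simp: ideal_rel_iff)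
    have "null (mneg \<C> (f \<boxplus> mneg \<C> g))"
      by (rule null_mneg[of _ "Dom \<C> g" "Cod \<C> g"]) (use * in \<open>auto simp: Hom_iff add_simps\<close>)
    also have "mneg \<C> (f \<boxplus> mneg \<C> g) = g \<boxplus> mneg \<C> f"
      using * by (simp add: add_simps MAdd_commute[of g])
    finally show "(g, f) \<in> ideal_rel \<C> \<I>" using * by (simp add: ideal_rel_iff)
  qed
  show "trans (ideal_rel \<C> \<I>)"
  proof (rule transI)
    fix f g h assume "(f, g) \<in> ideal_rel \<C> \<I>" "(g, h) \<in> ideal_rel \<C> \<I>"
    then have *: "f \<in> Mor \<C>" "g \<in> Mor \<C>" "h \<in> Mor \<C>" "Dom \<C> f = Dom \<C> h" "Cod \<C> f = Cod \<C> h"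
      "Dom \<C> g = Dom \<C> h" "Cod \<C> g = Cod \<C> h" "null (f \<boxplus> mneg \<C> g)" "null (g \<boxplus> mneg \<C> h)"
      by (auto simp: ideal_rel_iff)
    have "null ((f \<boxplus> mneg \<C> g) \<boxplus> (g \<boxplus> mneg \<C> h))"
      by (rule null_MAdd[of _ "Dom \<C> h" "Cod \<C> h"]) (use * in \<open>auto simp: Hom_iff add_simps\<close>)
    also have "(f \<boxplus> mneg \<C> g) \<boxplus> (g \<boxplus> mneg \<C> h) = f \<boxplus> mneg \<C> h" using * by (simp add: add_simps)
    finally show "(f, h) \<in> ideal_rel \<C> \<I>" using * by (simp add: ideal_rel_iff)
  qed
qed

lemma ideal_class_eq_iff:
  assumes "f \<in> Hom \<C> X Y" "g \<in> Hom \<C> X Y"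
  shows "ideal_class \<C> \<I> f = ideal_class \<C> \<I> g \<longleftrightarrow> null (f \<boxplus> mneg \<C> g)"
  using assms eq_equiv_class_iff[OF equiv_ideal_rel, of f g]
  by (auto simp: ideal_class_def ideal_rel_iff Hom_iff)

lemma ideal_class_SOME:
  assumes "f \<in> Hom \<C> X Y"
  shows "(SOME g. g \<in> ideal_class \<C> \<I> f) \<in> Hom \<C> X Y"
    "ideal_class \<C> \<I> (SOME g. g \<in> ideal_class \<C> \<I> f) = ideal_class \<C> \<I> f"
proof -
  have "f \<in> ideal_class \<C> \<I> f"
    using assms equiv_class_self[OF equiv_ideal_rel] by (auto simp: ideal_class_def Hom_iff)
  then have *: "(f, SOME g. g \<in> ideal_class \<C> \<I> f) \<in> ideal_rel \<C> \<I>"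
    using someI[of "\<lambda>g. g \<in> ideal_class \<C> \<I> f"] by (simp add: ideal_class_def)
  then show "(SOME g. g \<in> ideal_class \<C> \<I> f) \<in> Hom \<C> X Y"
    using assms by (simp add: ideal_rel_iff Hom_iff)
  show "ideal_class \<C> \<I> (SOME g. g \<in> ideal_class \<C> \<I> f) = ideal_class \<C> \<I> f"
    using equiv_class_eq[OF equiv_ideal_rel *] unfolding ideal_class_def by (rule HOL.sym)
qed

lemma ideal_quotient_Obj: "Obj (ideal_quotient \<C> \<I>) = Obj \<C>"
  by (simp add: ideal_quotient_def)

lemma ideal_quotient_Ident: "Ident (ideal_quotient \<C> \<I>) X = ideal_class \<C> \<I> (Ident \<C> X)"
  by (simp add: ideal_quotient_def)

lemma ideal_quotient_Hom: "Hom (ideal_quotient \<C> \<I>) X Y = ideal_class \<C> \<I> ` Hom \<C> X Y"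
proof -
  have mor: "Mor (ideal_quotient \<C> \<I>) = ideal_class \<C> \<I> ` Mor \<C>"
    by (auto simp: ideal_quotient_def quotient_def ideal_class_def)
  have "Dom (ideal_quotient \<C> \<I>) (ideal_class \<C> \<I> f) = Dom \<C> f"
    "Cod (ideal_quotient \<C> \<I>) (ideal_class \<C> \<I> f) = Cod \<C> f" if "f \<in> Mor \<C>" for f
    using ideal_class_SOME(1)[of f "Dom \<C> f" "Cod \<C> f"] that by (simp_all add: ideal_quotient_def Hom_iff)
  then show ?thesis by (auto simp: Hom_def mor)
qed

lemma ideal_class_Comp_cong:
  assumes f: "f \<in> Hom \<C> X Y" "f' \<in> Hom \<C> X Y" and g: "g \<in> Hom \<C> Y Z" "g' \<in> Hom \<C> Y Z"
    and eq: "ideal_class \<C> \<I> f = ideal_class \<C> \<I> f'" "ideal_class \<C> \<I> g = ideal_class \<C> \<I> g'"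
  shows "ideal_class \<C> \<I> (g \<cdot> f) = ideal_class \<C> \<I> (g' \<cdot> f')"
proof -
  have n: "null (f \<boxplus> mneg \<C> f')" "null (g \<boxplus> mneg \<C> g')"
    using eq f g by (simp_all add: ideal_class_eq_iff)
  have h: "f \<boxplus> mneg \<C> f' \<in> Hom \<C> X Y" "g \<boxplus> mneg \<C> g' \<in> Hom \<C> Y Z"
    using f g by (auto intro: MAdd_Hom mneg_Hom)
  \<comment> \<open>Splits \<open>g f - g' f'\<close> as \<open>g (f - f') + (g - g') f'\<close>;
    both terms are null because null morphisms form a two-sided ideal.\<close>
  have "null (g \<cdot> (f \<boxplus> mneg \<C> f') \<boxplus> (g \<boxplus> mneg \<C> g') \<cdot> f')"
    by (rule null_MAdd[of _ X Z])
      (use n h f g in \<open>auto intro: Comp_Hom null_Comp(1)[OF n(1) h(1)] null_Comp(2)[OF n(2) h(2)]\<close>)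
  also have "g \<cdot> (f \<boxplus> mneg \<C> f') \<boxplus> (g \<boxplus> mneg \<C> g') \<cdot> f' = g \<cdot> f \<boxplus> mneg \<C> (g' \<cdot> f')"
    using f g by (auto simp: Hom_iff add_simps)
  finally show ?thesis
    using ideal_class_eq_iff[OF Comp_Hom[OF f(1) g(1)] Comp_Hom[OF f(2) g(2)]] by simp
qed

lemma ideal_quotient_Comp:
  assumes f: "f \<in> Hom \<C> X Y" and g: "g \<in> Hom \<C> Y Z"
  shows "ideal_class \<C> \<I> g \<cdot>\<^bsub>ideal_quotient \<C> \<I>\<^esub> ideal_class \<C> \<I> f = ideal_class \<C> \<I> (g \<cdot> f)"
  using ideal_class_Comp_cong[OF ideal_class_SOME(1)[OF f] f ideal_class_SOME(1)[OF g] g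
      ideal_class_SOME(2)[OF f] ideal_class_SOME(2)[OF g]]
  by (simp add: ideal_quotient_def)

lemma category_ideal_quotient: "category (ideal_quotient \<C> \<I>)"
proof
  fix F assume "F \<in> Mor (ideal_quotient \<C> \<I>)"
  then have "F \<in> Hom (ideal_quotient \<C> \<I>) (Dom (ideal_quotient \<C> \<I>) F) (Cod (ideal_quotient \<C> \<I>) F)"
    by (simp add: Hom_iff)
  then show "Dom (ideal_quotient \<C> \<I>) F \<in> Obj (ideal_quotient \<C> \<I>)"
    "Cod (ideal_quotient \<C> \<I>) F \<in> Obj (ideal_quotient \<C> \<I>)"
    using Hom_Obj unfolding ideal_quotient_Hom ideal_quotient_Obj by blast+
qed (auto simp: ideal_quotient_Hom ideal_quotient_Obj ideal_quotient_Ident ideal_quotient_Comp[OF _ Ident_Hom]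
    ideal_quotient_Comp[OF Ident_Hom] ideal_quotient_Comp Comp_Ident_left Comp_Ident_right Hom_Obj Comp_assoc
    ideal_quotient_Comp[OF Comp_Hom] ideal_quotient_Comp[OF _ Comp_Hom]
    intro: Ident_Hom Comp_Hom)

lemma is_functor_quotient: "is_functor \<C> (ideal_quotient \<C> \<I>) (quotient_functor \<C> \<I>)"
proof -
  have "ideal_class \<C> \<I> f \<in> Hom (ideal_quotient \<C> \<I>) (Dom \<C> f) (Cod \<C> f)" if "f \<in> Mor \<C>" for f
    using that by (auto simp: ideal_quotient_Hom Hom_iff)
  moreover have "ideal_class \<C> \<I> (g \<cdot> f) = ideal_class \<C> \<I> g \<cdot>\<^bsub>ideal_quotient \<C> \<I>\<^esub> ideal_class \<C> \<I> f"
    if "f \<in> Mor \<C>" "g \<in> Mor \<C>" "Cod \<C> f = Dom \<C> g" for f g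
    using that by (intro ideal_quotient_Comp[symmetric, of _ "Dom \<C> f" "Dom \<C> g" _ "Cod \<C> g"])
      (auto simp: Hom_iff)
  ultimately show ?thesis
    using category_axioms category_ideal_quotient
    by (auto simp: is_functor_def quotient_functor_def ideal_quotient_Obj ideal_quotient_Ident)
qed

end

section \<open>Extriangulated categories\<close>

text \<open>Vanishing for a single pair of objects, so that it can be propagated along a triangle
  with the other argument fixed.\<close>

definition Ext_trivial :: "('o, 'm, 'e, 'z) extri_category_scheme \<Rightarrow> 'o \<Rightarrow> 'o \<Rightarrow> bool" where
  "Ext_trivial \<C> X A \<longleftrightarrow> carrier (Ext \<C> X A) = {\<one>\<^bsub>Ext \<C> X A\<^esub>}"

context extriangulated_category
begin

subsection \<open>The bifunctor \<open>\<E>\<close>\<close>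

lemma Ext_comm_group: "\<lbrakk>X \<in> Obj \<C>; A \<in> Obj \<C>\<rbrakk> \<Longrightarrow> comm_group (Ext \<C> X A)"
  using Ext_bifunctor by (simp add: ext_bifunctor_def)

lemma ExtMap_hom:
  "\<lbrakk>c \<in> Hom \<C> X' X; a \<in> Hom \<C> A A'\<rbrakk> \<Longrightarrow> ExtMap \<C> c a \<in> hom (Ext \<C> X A) (Ext \<C> X' A')"
  using Ext_bifunctor Hom_Obj[of c X' X] Hom_Obj[of a A A'] unfolding ext_bifunctor_def by blast

lemma ExtMap_Comp:
  "\<lbrakk>c \<in> Hom \<C> X' X; c' \<in> Hom \<C> X'' X'; a \<in> Hom \<C> A A'; a' \<in> Hom \<C> A' A''; \<delta> \<in> carrier (Ext \<C> X A)\<rbrakk>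
    \<Longrightarrow> ExtMap \<C> (c \<cdot> c') (a' \<cdot> a) \<delta> = ExtMap \<C> c' a' (ExtMap \<C> c a \<delta>)"
  using Ext_bifunctor unfolding ext_bifunctor_def by blast

lemma Ext_Ident:
  assumes "\<delta> \<in> carrier (Ext \<C> X A)" "X \<in> Obj \<C>" "A \<in> Obj \<C>"
  shows "push \<C> X (Ident \<C> A) \<delta> = \<delta>" "pull \<C> A (Ident \<C> X) \<delta> = \<delta>"
  using assms Ext_bifunctor by (simp_all add: ext_bifunctor_def push_def pull_def)

lemma push_carrier:
  "\<lbrakk>\<delta> \<in> carrier (Ext \<C> X A); a \<in> Hom \<C> A A'; X \<in> Obj \<C>\<rbrakk> \<Longrightarrow> push \<C> X a \<delta> \<in> carrier (Ext \<C> X A')"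
  using ExtMap_hom[OF Ident_Hom] by (fastforce simp: push_def hom_def)

lemma pull_carrier:
  "\<lbrakk>\<delta> \<in> carrier (Ext \<C> X A); c \<in> Hom \<C> X' X; A \<in> Obj \<C>\<rbrakk> \<Longrightarrow> pull \<C> A c \<delta> \<in> carrier (Ext \<C> X' A)"
  using ExtMap_hom[OF _ Ident_Hom] by (fastforce simp: pull_def hom_def)

lemma ExtMap_one:
  assumes "c \<in> Hom \<C> X' X" "a \<in> Hom \<C> A A'"
  shows "ExtMap \<C> c a \<one>\<^bsub>Ext \<C> X A\<^esub> = \<one>\<^bsub>Ext \<C> X' A'\<^esub>"
  using assms Hom_Obj[OF assms(1)] Hom_Obj[OF assms(2)]
  by (intro hom_one[OF ExtMap_hom] comm_group.axioms(2) Ext_comm_group) auto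

lemma push_one:
  "\<lbrakk>X \<in> Obj \<C>; a \<in> Hom \<C> A A'\<rbrakk> \<Longrightarrow> push \<C> X a \<one>\<^bsub>Ext \<C> X A\<^esub> = \<one>\<^bsub>Ext \<C> X A'\<^esub>"
  by (simp add: push_def ExtMap_one Ident_Hom)

lemma pull_one:
  "\<lbrakk>A \<in> Obj \<C>; c \<in> Hom \<C> X' X\<rbrakk> \<Longrightarrow> pull \<C> A c \<one>\<^bsub>Ext \<C> X A\<^esub> = \<one>\<^bsub>Ext \<C> X' A\<^esub>"
  by (simp add: pull_def ExtMap_one Ident_Hom)

lemma one_carrier: "\<lbrakk>X \<in> Obj \<C>; A \<in> Obj \<C>\<rbrakk> \<Longrightarrow> \<one>\<^bsub>Ext \<C> X A\<^esub> \<in> carrier (Ext \<C> X A)"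
  using Ext_comm_group[of X A] by (simp add: comm_group_def monoid.one_closed group.is_monoid)

lemma push_Comp:
  assumes "\<delta> \<in> carrier (Ext \<C> X A)" "a \<in> Hom \<C> A A'" "a' \<in> Hom \<C> A' A''" "X \<in> Obj \<C>"
  shows "push \<C> X (a' \<cdot> a) \<delta> = push \<C> X a' (push \<C> X a \<delta>)"
  using ExtMap_Comp[OF Ident_Hom Ident_Hom assms(2,3,1)] assms(4) by (simp add: push_def cat_simps)

lemma pull_Comp:
  assumes "\<delta> \<in> carrier (Ext \<C> X A)" "c \<in> Hom \<C> X' X" "c' \<in> Hom \<C> X'' X'" "A \<in> Obj \<C>"
  shows "pull \<C> A (c \<cdot> c') \<delta> = pull \<C> A c' (pull \<C> A c \<delta>)"
  using ExtMap_Comp[OF assms(2,3) Ident_Hom Ident_Hom assms(1)] assms(4) by (simp add: pull_def cat_simps)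

lemma ExtMap_eq:
  assumes "\<delta> \<in> carrier (Ext \<C> X A)" "c \<in> Hom \<C> X' X" "a \<in> Hom \<C> A A'"
  shows "ExtMap \<C> c a \<delta> = push \<C> X' a (pull \<C> A c \<delta>)" "ExtMap \<C> c a \<delta> = pull \<C> A' c (push \<C> X a \<delta>)"
proof -
  have o: "X \<in> Obj \<C>" "X' \<in> Obj \<C>" "A \<in> Obj \<C>" "A' \<in> Obj \<C>" using assms Hom_Obj by auto
  have m: "c \<cdot> Ident \<C> X' = c" "Ident \<C> X \<cdot> c = c" "a \<cdot> Ident \<C> A = a" "Ident \<C> A' \<cdot> a = a"
    using assms by (auto simp: Hom_iff cat_simps)
  show "ExtMap \<C> c a \<delta> = push \<C> X' a (pull \<C> A c \<delta>)"
    using ExtMap_Comp[OF assms(2) Ident_Hom[OF o(2)] Ident_Hom[OF o(3)] assms(3,1)]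
    by (simp add: push_def pull_def m)
  show "ExtMap \<C> c a \<delta> = pull \<C> A' c (push \<C> X a \<delta>)"
    using ExtMap_Comp[OF Ident_Hom[OF o(1)] assms(2,3) Ident_Hom[OF o(4)] assms(1)]
    by (simp add: push_def pull_def m)
qed

lemma push_pull:
  assumes "\<delta> \<in> carrier (Ext \<C> X A)" "c \<in> Hom \<C> X' X" "a \<in> Hom \<C> A A'"
  shows "push \<C> X' a (pull \<C> A c \<delta>) = pull \<C> A' c (push \<C> X a \<delta>)"
  using ExtMap_eq[OF assms] by simp

lemma push_MAdd:
  "\<lbrakk>\<delta> \<in> carrier (Ext \<C> X A); a \<in> Hom \<C> A A'; a' \<in> Hom \<C> A A'; X \<in> Obj \<C>\<rbrakk>
    \<Longrightarrow> push \<C> X (a \<boxplus> a') \<delta> = push \<C> X a \<delta> \<otimes>\<^bsub>Ext \<C> X A'\<^esub> push \<C> X a' \<delta>"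
  using ET1 unfolding ext_biadditive_def by blast

lemma pull_MAdd:
  "\<lbrakk>\<delta> \<in> carrier (Ext \<C> X A); c \<in> Hom \<C> X' X; c' \<in> Hom \<C> X' X; A \<in> Obj \<C>\<rbrakk>
    \<Longrightarrow> pull \<C> A (c \<boxplus> c') \<delta> = pull \<C> A c \<delta> \<otimes>\<^bsub>Ext \<C> X' A\<^esub> pull \<C> A c' \<delta>"
  using ET1 unfolding ext_biadditive_def by blast

lemma push_MZero:
  assumes "\<delta> \<in> carrier (Ext \<C> X A)" "X \<in> Obj \<C>" "A \<in> Obj \<C>" "A' \<in> Obj \<C>"
  shows "push \<C> X (MZero \<C> A A') \<delta> = \<one>\<^bsub>Ext \<C> X A'\<^esub>"
proof -
  interpret G: comm_group "Ext \<C> X A'" using assms by (intro Ext_comm_group)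
  have z: "MZero \<C> A A' \<in> Hom \<C> A A'" using assms by (intro MZero_Hom)
  have "push \<C> X (MZero \<C> A A') \<delta> = push \<C> X (MZero \<C> A A') \<delta> \<otimes>\<^bsub>Ext \<C> X A'\<^esub> push \<C> X (MZero \<C> A A') \<delta>"
    using push_MAdd[OF assms(1) z z assms(2)] assms by (simp add: add_simps)
  then show ?thesis using push_carrier[OF assms(1) z assms(2)] by simp
qed

lemma pull_MZero:
  assumes "\<delta> \<in> carrier (Ext \<C> X A)" "X \<in> Obj \<C>" "A \<in> Obj \<C>" "X' \<in> Obj \<C>"
  shows "pull \<C> A (MZero \<C> X' X) \<delta> = \<one>\<^bsub>Ext \<C> X' A\<^esub>"
proof -
  interpret G: comm_group "Ext \<C> X' A" using assms by (intro Ext_comm_group)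
  have z: "MZero \<C> X' X \<in> Hom \<C> X' X" using assms by (intro MZero_Hom)
  have "pull \<C> A (MZero \<C> X' X) \<delta> = pull \<C> A (MZero \<C> X' X) \<delta> \<otimes>\<^bsub>Ext \<C> X' A\<^esub> pull \<C> A (MZero \<C> X' X) \<delta>"
    using pull_MAdd[OF assms(1) z z assms(3)] assms by (simp add: add_simps)
  then show ?thesis using pull_carrier[OF assms(1) z assms(3)] by simp
qed

lemma Ext_trivialD: "\<lbrakk>Ext_trivial \<C> X A; \<delta> \<in> carrier (Ext \<C> X A)\<rbrakk> \<Longrightarrow> \<delta> = \<one>\<^bsub>Ext \<C> X A\<^esub>"
  by (simp add: Ext_trivial_def)

lemma Ext_trivialI:
  "\<lbrakk>X \<in> Obj \<C>; A \<in> Obj \<C>; \<And>\<delta>. \<delta> \<in> carrier (Ext \<C> X A) \<Longrightarrow> \<delta> = \<one>\<^bsub>Ext \<C> X A\<^esub>\<rbrakk> \<Longrightarrow> Ext_trivial \<C> X A"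
  using one_carrier[of X A] unfolding Ext_trivial_def by blast

subsection \<open>\<open>\<E>\<close>-triangles\<close>

lemma seq_rel_sym: "(s, t) \<in> seq_rel \<C> A X \<Longrightarrow> (t, s) \<in> seq_rel \<C> A X"
proof -
  assume "(s, t) \<in> seq_rel \<C> A X"
  then obtain x y x' y' b where *: "s = (x, y)" "t = (x', y')" "(x, y) \<in> sequences \<C> A X"
      "(x', y') \<in> sequences \<C> A X" "b \<in> Hom \<C> (Cod \<C> x) (Cod \<C> x')" "iso_mor \<C> b" "b \<cdot> x = x'" "y' \<cdot> b = y"
    by (auto simp: seq_rel_def)
  obtain b' where b': "b' \<in> Hom \<C> (Cod \<C> x') (Cod \<C> x)" "b' \<cdot> b = Ident \<C> (Cod \<C> x)"
      "b \<cdot> b' = Ident \<C> (Cod \<C> x')" "iso_mor \<C> b'"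
    using iso_morE[OF *(6,5)] .
  have m: "x \<in> Mor \<C>" "x' \<in> Mor \<C>" "y \<in> Mor \<C>" "y' \<in> Mor \<C>" "Dom \<C> y = Cod \<C> x" "Dom \<C> y' = Cod \<C> x'"
    "b \<in> Mor \<C>" "Dom \<C> b = Cod \<C> x" "Cod \<C> b = Cod \<C> x'" "b' \<in> Mor \<C>" "Dom \<C> b' = Cod \<C> x'" "Cod \<C> b' = Cod \<C> x"
    using *(3,4,5) b'(1) by (auto simp: sequences_def Hom_iff)
  have "b' \<cdot> x' = x" "y \<cdot> b' = y'"
    unfolding *(7)[symmetric] *(8)[symmetric]
    by (simp_all add: m cat_simps b' Comp_reassoc[OF b'(2)])
  then show ?thesis using * b' by (auto simp: seq_rel_def)
qed

lemma seq_rel_trans: "\<lbrakk>(s, t) \<in> seq_rel \<C> A X; (t, r) \<in> seq_rel \<C> A X\<rbrakk> \<Longrightarrow> (s, r) \<in> seq_rel \<C> A X"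
proof -
  assume "(s, t) \<in> seq_rel \<C> A X" "(t, r) \<in> seq_rel \<C> A X"
  then obtain x y x' y' b x'' y'' c where *: "s = (x, y)" "t = (x', y')" "r = (x'', y'')"
      "(x, y) \<in> sequences \<C> A X" "(x', y') \<in> sequences \<C> A X" "(x'', y'') \<in> sequences \<C> A X"
      "b \<in> Hom \<C> (Cod \<C> x) (Cod \<C> x')" "iso_mor \<C> b" "b \<cdot> x = x'" "y' \<cdot> b = y"
      "c \<in> Hom \<C> (Cod \<C> x') (Cod \<C> x'')" "iso_mor \<C> c" "c \<cdot> x' = x''" "y'' \<cdot> c = y'"
    by (auto simp: seq_rel_def)
  have m: "x \<in> Mor \<C>" "y'' \<in> Mor \<C>" "Dom \<C> y'' = Cod \<C> x''"
    "b \<in> Mor \<C>" "Dom \<C> b = Cod \<C> x" "Cod \<C> b = Cod \<C> x'" "c \<in> Mor \<C>" "Dom \<C> c = Cod \<C> x'" "Cod \<C> c = Cod \<C> x''"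
    using * by (auto simp: sequences_def Hom_iff)
  have "(c \<cdot> b) \<cdot> x = x''" "y'' \<cdot> (c \<cdot> b) = y"
    unfolding *(9,13)[symmetric] *(10,14)[symmetric] by (simp_all add: m cat_simps)
  moreover have "iso_mor \<C> (c \<cdot> b)" "c \<cdot> b \<in> Hom \<C> (Cod \<C> x) (Cod \<C> x'')"
    using * iso_Comp Comp_Hom by blast+
  ultimately show ?thesis unfolding *(1,3) seq_rel_def using *(4,6) by blast
qed

lemma seq_rel_refl: "(x, y) \<in> sequences \<C> A X \<Longrightarrow> ((x, y), (x, y)) \<in> seq_rel \<C> A X"
proof -
  assume *: "(x, y) \<in> sequences \<C> A X"
  then have "Ident \<C> (Cod \<C> x) \<in> Hom \<C> (Cod \<C> x) (Cod \<C> x)" "iso_mor \<C> (Ident \<C> (Cod \<C> x))"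
    "Ident \<C> (Cod \<C> x) \<cdot> x = x" "y \<cdot> Ident \<C> (Cod \<C> x) = y"
    by (auto simp: sequences_def Hom_iff cat_simps iso_Ident)
  with * show ?thesis unfolding seq_rel_def by blast
qed

lemma seq_class_eq_iff:
  assumes "(x, y) \<in> sequences \<C> A X"
  shows "seq_class \<C> A X x' y' = seq_class \<C> A X x y \<longleftrightarrow> ((x', y'), (x, y)) \<in> seq_rel \<C> A X"
  unfolding seq_class_def using seq_rel_refl[OF assms] seq_rel_sym seq_rel_trans by blast

lemma etriangleD:
  assumes "etriangle \<C> A B X x y \<delta>"
  shows "A \<in> Obj \<C>" "B \<in> Obj \<C>" "X \<in> Obj \<C>" "x \<in> Hom \<C> A B" "y \<in> Hom \<C> B X" "\<delta> \<in> carrier (Ext \<C> X A)"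
    "x \<in> Mor \<C>" "Dom \<C> x = A" "Cod \<C> x = B" "y \<in> Mor \<C>" "Dom \<C> y = B" "Cod \<C> y = X"
  using assms by (auto simp: etriangle_def Hom_iff)

lemma etriangle_sequences: "etriangle \<C> A B X x y \<delta> \<Longrightarrow> (x, y) \<in> sequences \<C> A X"
  by (auto simp: etriangle_def sequences_def)

lemma etriangle_ex:
  assumes "\<delta> \<in> carrier (Ext \<C> X A)" "X \<in> Obj \<C>" "A \<in> Obj \<C>"
  obtains B x y where "etriangle \<C> A B X x y \<delta>"
proof -
  have "Real \<C> X A \<delta> \<in> sequences \<C> A X // seq_rel \<C> A X"
    using ET2(1) assms by (simp add: is_realization_def)
  then obtain x y B where "Real \<C> X A \<delta> = seq_class \<C> A X x y" "B \<in> Obj \<C>" "x \<in> Hom \<C> A B" "y \<in> Hom \<C> B X"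
    by (auto simp: quotient_def seq_class_def sequences_def)
  with assms that show ?thesis by (auto simp: etriangle_def)
qed

lemma etriangle_compare:
  assumes "etriangle \<C> A B X x y \<delta>" "etriangle \<C> A B' X x' y' \<delta>"
  obtains b where "b \<in> Hom \<C> B B'" "iso_mor \<C> b" "b \<cdot> x = x'" "y' \<cdot> b = y"
proof -
  have "((x, y), (x', y')) \<in> seq_rel \<C> A X"
    using assms seq_class_eq_iff[OF etriangle_sequences[OF assms(2)], of x y] by (simp add: etriangle_def)
  then show ?thesis
    using that etriangleD(9)[OF assms(1)] etriangleD(9)[OF assms(2)] by (auto simp: seq_rel_def)
qed

text \<open>A realization is a class of sequences modulo isomorphisms of the middle term, so the
  extension does not change. Also used to insert a sign into an inflation.\<close>

lemma etriangle_mid_iso: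
  assumes t: "etriangle \<C> A B X x y \<delta>" and b: "b \<in> Hom \<C> B B'" "b' \<in> Hom \<C> B' B"
    and inv: "b' \<cdot> b = Ident \<C> B" "b \<cdot> b' = Ident \<C> B'"
  shows "etriangle \<C> A B' X (b \<cdot> x) (y \<cdot> b') \<delta>"
proof -
  note d = etriangleD[OF t]
  have h: "b \<cdot> x \<in> Hom \<C> A B'" "y \<cdot> b' \<in> Hom \<C> B' X" "B' \<in> Obj \<C>"
    using d(4,5) b Hom_Obj by (auto intro: Comp_Hom)
  then have s: "(b \<cdot> x, y \<cdot> b') \<in> sequences \<C> A X" by (auto simp: sequences_def)
  have m: "b \<in> Mor \<C>" "Dom \<C> b = B" "Cod \<C> b = B'" "b' \<in> Mor \<C>" "Dom \<C> b' = B'" "Cod \<C> b' = B"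
    using b by (auto simp: Hom_iff)
  have "((x, y), (b \<cdot> x, y \<cdot> b')) \<in> seq_rel \<C> A X"
    using etriangle_sequences[OF t] s b iso_morI[OF b inv]
    by (auto simp: seq_rel_def d m cat_simps inv intro!: bexI[of _ b])
  then show ?thesis
    using t h seq_class_eq_iff[OF s, of x y] by (auto simp: etriangle_def)
qed

lemma etriangle_biproduct:
  assumes "is_biproduct \<C> A X P i j p q"
  shows "etriangle \<C> A P X i q \<one>\<^bsub>Ext \<C> X A\<^esub>"
proof -
  have "Real \<C> X A \<one>\<^bsub>Ext \<C> X A\<^esub> = seq_class \<C> A X i q"
    using ET2(2) assms unfolding additive_realization_def by blast
  then show ?thesis
    using biproductD[OF assms] by (simp add: etriangle_def Hom_iff one_carrier)
qed

lemma etriangle_Ident: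
  assumes "is_zero_object \<C> Z" "A \<in> Obj \<C>"
  shows "etriangle \<C> Z A A (MZero \<C> Z A) (Ident \<C> A) \<one>\<^bsub>Ext \<C> A Z\<^esub>"
    "etriangle \<C> A A Z (Ident \<C> A) (MZero \<C> A Z) \<one>\<^bsub>Ext \<C> Z A\<^esub>"
  using etriangle_biproduct biproduct_zero_left[OF assms] biproduct_sym by blast+

text \<open>This sequence and the canonical A \<rightarrow> A \<oplus> X \<rightarrow> X both
  realize 0, so the biproduct structure is transported along the isomorphism of middle
  terms.\<close>

lemma etriangle_splits:
  assumes "etriangle \<C> A B X x y \<one>\<^bsub>Ext \<C> X A\<^esub>"
  obtains j p where "is_biproduct \<C> A X B x j p y"
proof -
  note d = etriangleD[OF assms]
  obtain P i j p q where b: "is_biproduct \<C> A X P i j p q" using biproduct_ex d by blast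
  obtain u where u: "u \<in> Hom \<C> P B" "iso_mor \<C> u" "u \<cdot> i = x" "y \<cdot> u = q"
    using etriangle_compare[OF etriangle_biproduct[OF b] assms] .
  obtain v where v: "v \<in> Hom \<C> B P" "v \<cdot> u = Ident \<C> P" "u \<cdot> v = Ident \<C> B"
    using iso_morE[OF u(2,1)] .
  have "q \<cdot> v = y" using u(1,4) v d by (auto simp: Hom_iff cat_simps)
  with biproduct_iso[OF b u(1) v] show ?thesis using that u by simp
qed

section \<open>Exactness of Hom and \<E> along an \<E>-triangle\<close>

lemma ET3E:
  assumes "etriangle \<C> A B X x y \<delta>" "etriangle \<C> A' B' X' x' y' \<delta>'"
    "a \<in> Hom \<C> A A'" "b \<in> Hom \<C> B B'" "b \<cdot> x = x' \<cdot> a"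
  obtains c where "c \<in> Hom \<C> X X'" "push \<C> X a \<delta> = pull \<C> A' c \<delta>'" "y' \<cdot> b = c \<cdot> y"
  using ET3[OF assms] by (auto simp: ext_morphism_def)

lemma ET3_opE:
  assumes "etriangle \<C> A B X x y \<delta>" "etriangle \<C> A' B' X' x' y' \<delta>'"
    "b \<in> Hom \<C> B B'" "c \<in> Hom \<C> X X'" "y' \<cdot> b = c \<cdot> y"
  obtains a where "a \<in> Hom \<C> A A'" "push \<C> X a \<delta> = pull \<C> A' c \<delta>'" "b \<cdot> x = x' \<cdot> a"
  using ET3_op[OF assms] by (auto simp: ext_morphism_def)

text \<open>Exactness of Hom(B, Y) \<rightarrow> Hom(A, Y) \<rightarrow> \<E>(X, Y): as
  \<open>f\<close> pushes the extension to 0, the pair (f, 1) is a morphism of extensions into 0. It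
  is realized by a map B \<rightarrow> Y \<oplus> X, whose Y-component extends
  \<open>f\<close>.\<close>

lemma inflation_extends:
  assumes t: "etriangle \<C> A B X x y \<delta>" and f: "f \<in> Hom \<C> A Y" and "push \<C> X f \<delta> = \<one>\<^bsub>Ext \<C> X Y\<^esub>"
  obtains g where "g \<in> Hom \<C> B Y" "g \<cdot> x = f"
proof -
  note d = etriangleD[OF t]
  have Y: "Y \<in> Obj \<C>" using Hom_Obj f by blast
  obtain P i j p q where b: "is_biproduct \<C> Y X P i j p q" using biproduct_ex Y d by blast
  have "ext_morphism \<C> X A \<delta> X Y \<one>\<^bsub>Ext \<C> X Y\<^esub> f (Ident \<C> X)"
    using f d Y assms(3) by (auto simp: ext_morphism_def Ident_Hom one_carrier Ext_Ident)
  then obtain h where h: "h \<in> Hom \<C> B P" "h \<cdot> x = i \<cdot> f"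
    using ET2(1) t etriangle_biproduct[OF b] unfolding is_realization_def by blast
  note db = biproductD[OF b]
  have "p \<cdot> h \<in> Hom \<C> B Y" using h db by (auto simp: Hom_iff cat_simps)
  moreover have "(p \<cdot> h) \<cdot> x = p \<cdot> (i \<cdot> f)" using h db d by (auto simp: Hom_iff cat_simps)
  then have "(p \<cdot> h) \<cdot> x = f" using f by (simp add: Hom_iff biproduct_reassoc[OF b])
  ultimately show ?thesis using that by blast
qed

text \<open>Dually, exactness of Hom(W, B) \<rightarrow> Hom(W, X) \<rightarrow> \<E>(W, A): here
  (1, h) is a morphism from 0, and a realization A \<oplus> W \<rightarrow> B is restricted to
  W.\<close>

lemma deflation_lifts:
  assumes t: "etriangle \<C> A B X x y \<delta>" and h: "h \<in> Hom \<C> W X" and "pull \<C> A h \<delta> = \<one>\<^bsub>Ext \<C> W A\<^esub>"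
  obtains g where "g \<in> Hom \<C> W B" "y \<cdot> g = h"
proof -
  note d = etriangleD[OF t]
  have W: "W \<in> Obj \<C>" using Hom_Obj h by blast
  obtain P i j p q where b: "is_biproduct \<C> A W P i j p q" using biproduct_ex W d by blast
  have "ext_morphism \<C> W A \<one>\<^bsub>Ext \<C> W A\<^esub> X A \<delta> (Ident \<C> A) h"
    using h d W assms(3) by (auto simp: ext_morphism_def Ident_Hom one_carrier Ext_Ident)
  then obtain g where g: "g \<in> Hom \<C> P B" "y \<cdot> g = h \<cdot> q"
    using ET2(1) t etriangle_biproduct[OF b] unfolding is_realization_def by blast
  note db = biproductD[OF b]
  have "g \<cdot> j \<in> Hom \<C> W B" using g db by (auto simp: Hom_iff cat_simps)
  moreover have "y \<cdot> (g \<cdot> j) = (y \<cdot> g) \<cdot> j" using g(1) db d by (auto simp: Hom_iff cat_simps)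
  then have "y \<cdot> (g \<cdot> j) = h" using h g db by (auto simp: Hom_iff cat_simps)
  ultimately show ?thesis using that by blast
qed

text \<open>A weak cokernel property, without uniqueness of \<open>c\<close>: (ET3) applied to a map
  into the triangle 0 \<rightarrow> Y \<rightarrow> Y.\<close>

lemma deflation_factors:
  assumes t: "etriangle \<C> A B X x y \<delta>" and g: "g \<in> Hom \<C> B Y" and "g \<cdot> x = MZero \<C> A Y"
  obtains c where "c \<in> Hom \<C> X Y" "g = c \<cdot> y"
proof -
  note d = etriangleD[OF t]
  have Y: "Y \<in> Obj \<C>" using Hom_Obj g by blast
  obtain Z where Z: "is_zero_object \<C> Z" using zero_object_ex by blast
  note Z' = zero_object_Obj[OF Z]
  obtain c where "c \<in> Hom \<C> X Y" "Ident \<C> Y \<cdot> g = c \<cdot> y"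
    by (rule ET3E[OF t etriangle_Ident(1)[OF Z Y] MZero_Hom[OF d(1) Z'] g])
      (simp_all add: assms(3) d Y Z' add_simps)
  then show ?thesis using that g by (auto simp: Hom_iff cat_simps)
qed

text \<open>The weak kernel property, from (ET3)^op and the triangle W \<rightarrow> W \<rightarrow>
  0.\<close>

lemma inflation_factors:
  assumes t: "etriangle \<C> A B X x y \<delta>" and g: "g \<in> Hom \<C> W B" and "y \<cdot> g = MZero \<C> W X"
  obtains a where "a \<in> Hom \<C> W A" "g = x \<cdot> a"
proof -
  note d = etriangleD[OF t]
  have W: "W \<in> Obj \<C>" using Hom_Obj g by blast
  obtain Z where Z: "is_zero_object \<C> Z" using zero_object_ex by blast
  note Z' = zero_object_Obj[OF Z]
  obtain a where "a \<in> Hom \<C> W A" "g \<cdot> Ident \<C> W = x \<cdot> a"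
    by (rule ET3_opE[OF etriangle_Ident(2)[OF Z W] t g MZero_Hom[OF Z' d(3)]])
      (simp_all add: assms(3) d W Z' add_simps)
  then show ?thesis using that g by (auto simp: Hom_iff cat_simps)
qed

text \<open>Exactness of \<E>(X, Y) \<rightarrow> \<E>(B, Y) \<rightarrow> \<E>(A, Y) by (ET4)^op:
  composing a deflation of \<open>\<epsilon>\<close> with \<open>y\<close> gives a triangle whose
  extension \<open>\<eta>\<close> satisfies
  \<open>push \<C> B k \<epsilon> = pull \<C> E y \<eta>\<close>. As the pullback of
  \<open>\<epsilon>\<close> to A is 0, \<open>k\<close> has a retraction, and applying it exhibits
  \<open>\<epsilon>\<close> as pulled back from X.\<close>

lemma Ext_trivial_extension_left:
  assumes t: "etriangle \<C> A B X x y \<delta>" and A: "Ext_trivial \<C> A Y" and X: "Ext_trivial \<C> X Y" and Y: "Y \<in> Obj \<C>"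
  shows "Ext_trivial \<C> B Y"
proof (rule Ext_trivialI)
  note d = etriangleD[OF t]
  show "B \<in> Obj \<C>" "Y \<in> Obj \<C>" using d Y by auto
  fix \<epsilon> assume e: "\<epsilon> \<in> carrier (Ext \<C> B Y)"
  obtain D u r where t': "etriangle \<C> Y D B u r \<epsilon>" using etriangle_ex[OF e d(2) Y] .
  obtain E h \<eta> k l where E: "etriangle \<C> E D X h (y \<cdot> r) \<eta>" "etriangle \<C> Y E A k l (pull \<C> Y x \<epsilon>)"
    "push \<C> B k \<epsilon> = pull \<C> E y \<eta>"
    using ET4_op[OF t' t] by blast
  note dE = etriangleD[OF E(1)] etriangleD[OF E(2)]
  have "pull \<C> Y x \<epsilon> = \<one>\<^bsub>Ext \<C> A Y\<^esub>" using Ext_trivialD[OF A] dE by simp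
  with E(2) obtain s \<rho> where b: "is_biproduct \<C> Y A E k s \<rho> l" using etriangle_splits by metis
  have \<rho>: "\<rho> \<in> Hom \<C> E Y" "\<rho> \<cdot> k = Ident \<C> Y" using biproductD[OF b] by (auto simp: Hom_iff)
  have "\<epsilon> = push \<C> B \<rho> (push \<C> B k \<epsilon>)"
    using push_Comp[OF e dE(16) \<rho>(1) d(2)] \<rho>(2) Ext_Ident[OF e d(2) Y] by simp
  also have "\<dots> = pull \<C> Y y (push \<C> X \<rho> \<eta>)"
    using E(3) push_pull[OF dE(6) d(5) \<rho>(1)] by simp
  also have "push \<C> X \<rho> \<eta> = \<one>\<^bsub>Ext \<C> X Y\<^esub>" by (rule Ext_trivialD[OF X push_carrier[OF dE(6) \<rho>(1) d(3)]])
  finally show "\<epsilon> = \<one>\<^bsub>Ext \<C> B Y\<^esub>" using pull_one[OF Y d(5)] by simp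
qed

text \<open>The dual argument with (ET4): a section of \<open>l\<close> exhibits
  \<open>\<epsilon>\<close> as pushed out along \<open>x\<close> from \<E>(Y, A).\<close>

lemma Ext_trivial_extension_right:
  assumes t: "etriangle \<C> A B X x y \<delta>" and A: "Ext_trivial \<C> Y A" and X: "Ext_trivial \<C> Y X" and Y: "Y \<in> Obj \<C>"
  shows "Ext_trivial \<C> Y B"
proof (rule Ext_trivialI)
  note d = etriangleD[OF t]
  show "B \<in> Obj \<C>" "Y \<in> Obj \<C>" using d Y by auto
  fix \<epsilon> assume e: "\<epsilon> \<in> carrier (Ext \<C> Y B)"
  obtain D u r where t': "etriangle \<C> B D Y u r \<epsilon>" using etriangle_ex[OF e Y d(2)] .
  obtain E h \<eta> k l where E: "etriangle \<C> A D E (u \<cdot> x) h \<eta>" "etriangle \<C> X E Y k l (push \<C> Y y \<epsilon>)"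
    "push \<C> E x \<eta> = pull \<C> B l \<epsilon>"
    using ET4[OF t t'] by blast
  note dE = etriangleD[OF E(1)] etriangleD[OF E(2)]
  have "push \<C> Y y \<epsilon> = \<one>\<^bsub>Ext \<C> Y X\<^esub>" using Ext_trivialD[OF X] dE by simp
  with E(2) obtain s \<rho> where b: "is_biproduct \<C> X Y E k s \<rho> l" using etriangle_splits by metis
  have s: "s \<in> Hom \<C> Y E" "l \<cdot> s = Ident \<C> Y" using biproductD[OF b] by (auto simp: Hom_iff)
  have "\<epsilon> = pull \<C> B s (pull \<C> B l \<epsilon>)"
    using pull_Comp[OF e dE(17) s(1) d(2)] s(2) Ext_Ident[OF e Y d(2)] by simp
  also have "\<dots> = push \<C> Y x (pull \<C> A s \<eta>)"
    using E(3) push_pull[OF dE(6) s(1) d(4)] by simp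
  also have "pull \<C> A s \<eta> = \<one>\<^bsub>Ext \<C> Y A\<^esub>" by (rule Ext_trivialD[OF A pull_carrier[OF dE(6) s(1) d(1)]])
  finally show "\<epsilon> = \<one>\<^bsub>Ext \<C> Y B\<^esub>" using push_one[OF Y d(4)] by simp
qed

subsection \<open>Cokernels, direct sums and pushouts of inflations\<close>

text \<open>An endomorphism that fixes both the deflation and the extension is unipotent.\<close>

lemma etriangle_endo_iso:
  assumes t: "etriangle \<C> A B X x y \<delta>" and g: "g \<in> Hom \<C> X X" "g \<cdot> y = y" "pull \<C> A g \<delta> = \<delta>"
  shows "iso_mor \<C> g"
proof -
  note d = etriangleD[OF t]
  have m: "g \<in> Mor \<C>" "Dom \<C> g = X" "Cod \<C> g = X" using g by (auto simp: Hom_iff)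
  \<comment> \<open>The deviation of \<open>g\<close> from the identity. It kills \<open>y\<close>,
    and it pulls \<open>\<delta>\<close> back to 0 and hence factors through \<open>y\<close>; so z
    z = 0, and 1 + z inverts g = 1 - z.\<close>
  define z where "z = Ident \<C> X \<boxplus> mneg \<C> g"
  have z: "z \<in> Hom \<C> X X" using m d by (simp add: z_def Hom_iff add_simps)
  note mz = z[unfolded Hom_iff]
  have gz: "g = Ident \<C> X \<boxplus> mneg \<C> z"
    using m d by (simp add: z_def Hom_iff add_simps)
  have zy: "z \<cdot> y = MZero \<C> B X" using m d g(2) by (simp add: z_def add_simps)
  interpret G: comm_group "Ext \<C> X A" using d by (intro Ext_comm_group)
  have "\<delta> = pull \<C> A (z \<boxplus> g) \<delta>"
    using m d by (simp add: z_def add_simps Ext_Ident)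
  also have "\<dots> = pull \<C> A z \<delta> \<otimes>\<^bsub>Ext \<C> X A\<^esub> \<delta>"
    using pull_MAdd[OF d(6) z g(1) d(1)] g(3) by simp
  finally have "pull \<C> A z \<delta> = \<one>\<^bsub>Ext \<C> X A\<^esub>"
    using d(6) pull_carrier[OF d(6) z d(1)] by simp
  then obtain w where w: "w \<in> Hom \<C> X B" "y \<cdot> w = z" using deflation_lifts[OF t z] by blast
  have "z \<cdot> z = (z \<cdot> y) \<cdot> w" using w mz d by (auto simp: Hom_iff cat_simps)
  then have zz: "z \<cdot> z = MZero \<C> X X" using w d by (auto simp: zy Hom_iff add_simps)
  show ?thesis
    by (rule iso_morI[OF g(1), of "Ident \<C> X \<boxplus> z"]) (use mz d in \<open>simp_all add: gz Hom_iff add_simps zz\<close>)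
qed

text \<open>(ET3) over the identities of A and B gives comparison maps in both directions. Their
  composites need not be identities, but they fix the deflation and the extension and are therefore
  invertible.\<close>

lemma cokernel_unique:
  assumes t: "etriangle \<C> A B X x y \<delta>" and t': "etriangle \<C> A B X' x y' \<delta>'"
  obtains c where "c \<in> Hom \<C> X X'" "iso_mor \<C> c" "c \<cdot> y = y'"
proof -
  note d = etriangleD[OF t] etriangleD[OF t']
  have *: "Ident \<C> B \<cdot> x = x \<cdot> Ident \<C> A" using d by (simp add: cat_simps)
  obtain c where c: "c \<in> Hom \<C> X X'" "push \<C> X (Ident \<C> A) \<delta> = pull \<C> A c \<delta>'" "y' \<cdot> Ident \<C> B = c \<cdot> y"
    using ET3E[OF t t' Ident_Hom[OF d(1)] Ident_Hom[OF d(2)] *] .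
  obtain c' where c': "c' \<in> Hom \<C> X' X" "push \<C> X' (Ident \<C> A) \<delta>' = pull \<C> A c' \<delta>" "y \<cdot> Ident \<C> B = c' \<cdot> y'"
    using ET3E[OF t' t Ident_Hom[OF d(1)] Ident_Hom[OF d(2)] *] .
  have e: "\<delta> = pull \<C> A c \<delta>'" "\<delta>' = pull \<C> A c' \<delta>"
    using c(2) c'(2) Ext_Ident(1)[OF d(6) d(3) d(1)] Ext_Ident(1)[OF d(18) d(15) d(1)] by simp_all
  have y: "c \<cdot> y = y'" "c' \<cdot> y' = y"
    using c(3) c'(3) d by (simp_all add: cat_simps)
  have m: "c \<in> Mor \<C>" "Dom \<C> c = X" "Cod \<C> c = X'" "c' \<in> Mor \<C>" "Dom \<C> c' = X'" "Cod \<C> c' = X"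
    using c(1) c'(1) by (auto simp: Hom_iff)
  have "iso_mor \<C> (c' \<cdot> c)"
    by (rule etriangle_endo_iso[OF t Comp_Hom[OF c(1) c'(1)]])
      (simp_all add: d m y cat_simps pull_Comp[OF d(6) c'(1) c(1) d(1)] flip: e)
  moreover have "iso_mor \<C> (c \<cdot> c')"
    by (rule etriangle_endo_iso[OF t' Comp_Hom[OF c'(1) c(1)]])
      (simp_all add: d m y cat_simps pull_Comp[OF d(18) c(1) c'(1) d(1)] flip: e)
  ultimately have "iso_mor \<C> c" by (rule iso_of_iso_composites[OF c(1) c'(1)])
  with c(1) y(1) that show ?thesis by blast
qed

text \<open>The direct sum of D \<rightarrow> D \<rightarrow> 0 with the given triangle, where 0
  \<oplus> X is taken to be X itself.\<close>

lemma etriangle_biproduct_left: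
  assumes t: "etriangle \<C> A B X x y \<delta>"
    and b: "is_biproduct \<C> D A P i j p q" and b': "is_biproduct \<C> D B P' i' j' p' q'"
  shows "etriangle \<C> P P' X (i' \<cdot> p \<boxplus> j' \<cdot> (x \<cdot> q)) (y \<cdot> q') (push \<C> X j \<delta>)"
proof -
  note d = etriangleD[OF t] note db = biproductD[OF b] note db' = biproductD[OF b']
  obtain Z where Z: "is_zero_object \<C> Z" using zero_object_ex by blast
  note Z' = zero_object_Obj[OF Z]
  let ?\<epsilon> = "push \<C> X j \<delta>"
  have h: "j \<in> Hom \<C> A P" "p \<in> Hom \<C> P D" "q \<in> Hom \<C> P A" using db by (auto simp: Hom_iff)
  have e: "?\<epsilon> \<in> carrier (Ext \<C> X P)" by (rule push_carrier[OF d(6) h(1) d(3)])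
  have pZ: "pull \<C> P (MZero \<C> Z X) ?\<epsilon> = \<one>\<^bsub>Ext \<C> Z P\<^esub>" by (rule pull_MZero[OF e d(3) db(3) Z'])
  have pI: "pull \<C> P (Ident \<C> X) ?\<epsilon> = ?\<epsilon>" by (rule Ext_Ident(2)[OF e d(3) db(3)])
  have "push \<C> X p ?\<epsilon> = push \<C> X (p \<cdot> j) \<delta>" by (rule push_Comp[OF d(6) h(1,2) d(3), symmetric])
  also have "\<dots> = \<one>\<^bsub>Ext \<C> X D\<^esub>" unfolding db(19) by (rule push_MZero[OF d(6) d(3) d(1) db(1)])
  finally have 1: "push \<C> X p ?\<epsilon> = \<one>\<^bsub>Ext \<C> X D\<^esub>" .
  have "push \<C> X q ?\<epsilon> = push \<C> X (q \<cdot> j) \<delta>" by (rule push_Comp[OF d(6) h(1,3) d(3), symmetric])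
  also have "\<dots> = \<delta>" unfolding db(17) by (rule Ext_Ident(1)[OF d(6) d(3) d(1)])
  finally have 2: "push \<C> X q ?\<epsilon> = \<delta>" .
  have zX: "MZero \<C> Z X \<in> Hom \<C> Z X" "Ident \<C> X \<in> Hom \<C> X X" using Z' d by (auto intro: MZero_Hom Ident_Hom)
  \<comment> \<open>Additivity of the realization asks for the four components of the extension; for
    the pushout along \<open>j\<close> they are 0, 0, 0 and \<open>\<delta>\<close>, by the facts
    collected above.\<close>
  have "Real \<C> X P ?\<epsilon> = seq_class \<C> P X
      ((i' \<cdot> Ident \<C> D \<cdot> p) \<boxplus> (j' \<cdot> x \<cdot> q))
      ((MZero \<C> Z X \<cdot> MZero \<C> D Z \<cdot> p') \<boxplus> (Ident \<C> X \<cdot> y \<cdot> q'))"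
    using ET2(2)[unfolded additive_realization_def, THEN conjunct2, rule_format,
        of D D Z "Ident \<C> D" "MZero \<C> D Z" "\<one>\<^bsub>Ext \<C> Z D\<^esub>" A B X x y \<delta> P i j p q P' i' j' p' q'
          X "MZero \<C> Z X" "Ident \<C> X" "MZero \<C> X Z" "Ident \<C> X" ?\<epsilon>]
      etriangle_Ident(2)[OF Z db(1)] t b b' biproduct_zero_left[OF Z d(3)] e
    by (simp add: ExtMap_eq(1)[OF e zX(1) h(2)] ExtMap_eq(1)[OF e zX(1) h(3)] ExtMap_eq(1)[OF e zX(2) h(2)]
        ExtMap_eq(1)[OF e zX(2) h(3)] pZ pI 1 2 push_one[OF Z' h(2)] push_one[OF Z' h(3)])
  also have "(i' \<cdot> Ident \<C> D \<cdot> p) \<boxplus> (j' \<cdot> x \<cdot> q) = i' \<cdot> p \<boxplus> j' \<cdot> (x \<cdot> q)"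
    by (simp add: d db(1-15) db'(1-15) cat_simps)
  also have "(MZero \<C> Z X \<cdot> MZero \<C> D Z \<cdot> p') \<boxplus> (Ident \<C> X \<cdot> y \<cdot> q') = y \<cdot> q'"
    by (simp add: d db(1-15) db'(1-15) Z' add_simps)
  finally show ?thesis
    using e by (simp add: etriangle_def d db(1-15) db'(1-15) Hom_iff add_simps)
qed

text \<open>\<open>(x, f)\<close> is the composite of the split inflation \<open>(1, f) : A \<rightarrow> D \<oplus> A\<close> and \<open>1 \<oplus> x\<close>.\<close>

lemma inflation_pair:
  assumes t: "etriangle \<C> A B X x y \<delta>" and b: "is_biproduct \<C> D B P i j p q" and f: "f \<in> Hom \<C> A D"
  obtains N y' \<delta>' k l where "etriangle \<C> A P N (i \<cdot> f \<boxplus> j \<cdot> x) y' \<delta>'"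
    "etriangle \<C> D N X k l (push \<C> X (mneg \<C> f) \<delta>)"
proof -
  note d = etriangleD[OF t] note db = biproductD[OF b]
  have m: "f \<in> Mor \<C>" "Dom \<C> f = A" "Cod \<C> f = D" using f by (auto simp: Hom_iff)
  obtain Q i' j' p' q' where b': "is_biproduct \<C> D A Q i' j' p' q'" using biproduct_ex d db by blast
  note db' = biproductD[OF b']
  let ?r = "p' \<boxplus> mneg \<C> (f \<cdot> q')"
  have g: "etriangle \<C> A Q D (j' \<boxplus> i' \<cdot> f) ?r \<one>\<^bsub>Ext \<C> D A\<^esub>"
    by (rule etriangle_biproduct[OF biproduct_graph[OF biproduct_sym[OF b'] f]])
  note s = etriangle_biproduct_left[OF t b' b]
  obtain N h' \<delta>' k l where N: "etriangle \<C> A P N ((i \<cdot> p' \<boxplus> j \<cdot> (x \<cdot> q')) \<cdot> (j' \<boxplus> i' \<cdot> f)) h' \<delta>'"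
    "etriangle \<C> D N X k l (push \<C> X ?r (push \<C> X j' \<delta>))"
    using ET4[OF g s] by blast
  have "(i \<cdot> p' \<boxplus> j \<cdot> (x \<cdot> q')) \<cdot> (j' \<boxplus> i' \<cdot> f) = i \<cdot> f \<boxplus> j \<cdot> x"
    by (simp add: d db(1-15) db' m add_simps biproduct_reassoc[OF b'] MAdd_commute[of "j \<cdot> x"])
  moreover have "push \<C> X ?r (push \<C> X j' \<delta>) = push \<C> X (?r \<cdot> j') \<delta>"
    by (rule push_Comp[OF d(6) _ _ d(3), symmetric]) (simp_all add: Hom_iff d db' m add_simps)
  \<comment> \<open>Origin of the sign in the new extension: the cokernel of the graph embedding (1,
    f) is \<open>?r\<close>, which restricts to -f on the summand A.\<close>
  moreover have "?r \<cdot> j' = mneg \<C> f" by (simp add: db' m add_simps)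
  ultimately show ?thesis using N that by simp
qed

text \<open>The cone of (x', x) : A \<rightarrow> B' \<oplus> B is computed twice, once with each
  summand as the base, and uniqueness of the cone identifies the results. Only the two conflations
  through N matter later, so the extensions are dropped.\<close>

lemma inflation_pushout:
  assumes t: "etriangle \<C> A B X x y \<delta>" and t': "etriangle \<C> A B' X' x' y' \<delta>'"
  obtains N where "\<exists>k l. conflation \<C> B' N X k l" "\<exists>k l. conflation \<C> B N X' k l"
proof -
  note d = etriangleD[OF t] note d' = etriangleD[OF t']
  obtain P i j p q where b: "is_biproduct \<C> B' B P i j p q" using biproduct_ex d d' by blast
  note db = biproductD[OF b]
  obtain N z \<epsilon> k l where N: "etriangle \<C> A P N (i \<cdot> x' \<boxplus> j \<cdot> x) z \<epsilon>"
    "etriangle \<C> B' N X k l (push \<C> X (mneg \<C> x') \<delta>)"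
    using inflation_pair[OF t b d'(4)] .
  obtain N' z' \<epsilon>' k' l' where N': "etriangle \<C> A P N' (j \<cdot> x \<boxplus> i \<cdot> x') z' \<epsilon>'"
    "etriangle \<C> B N' X' k' l' (push \<C> X' (mneg \<C> x) \<delta>')"
    using inflation_pair[OF t' biproduct_sym[OF b] d(4)] .
  have "j \<cdot> x \<boxplus> i \<cdot> x' = i \<cdot> x' \<boxplus> j \<cdot> x"
    by (rule MAdd_commute) (simp_all add: d d' db cat_simps)
  with N'(1) obtain c where c: "c \<in> Hom \<C> N' N" "iso_mor \<C> c"
    using cokernel_unique[OF _ N(1)] by metis
  obtain c' where c': "c' \<in> Hom \<C> N N'" "c' \<cdot> c = Ident \<C> N'" "c \<cdot> c' = Ident \<C> N"
    using iso_morE[OF c(2,1)] .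
  from etriangle_mid_iso[OF N'(2) c(1) c'] N(2) that show ?thesis unfolding conflation_def by blast
qed

end

section \<open>Cotorsion pairs\<close>

context extriangulated_category
begin

lemma inflation_extends_trivial:
  assumes "etriangle \<C> A B X x y \<delta>" "f \<in> Hom \<C> A Y" "Ext_trivial \<C> X Y"
  obtains g where "g \<in> Hom \<C> B Y" "g \<cdot> x = f"
  using inflation_extends[OF assms(1,2)] Ext_trivialD[OF assms(3)] push_carrier assms(2)
    etriangleD[OF assms(1)] by metis

lemma deflation_lifts_trivial:
  assumes "etriangle \<C> A B X x y \<delta>" "h \<in> Hom \<C> W X" "Ext_trivial \<C> W A"
  obtains g where "g \<in> Hom \<C> W B" "y \<cdot> g = h"
  using deflation_lifts[OF assms(1,2)] Ext_trivialD[OF assms(3)] pull_carrier assms(2)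
    etriangleD[OF assms(1)] by metis

lemma etriangle_splits_trivial:
  assumes "etriangle \<C> A B X x y \<delta>" "Ext_trivial \<C> X A"
  obtains j p where "is_biproduct \<C> A X B x j p y"
  using etriangle_splits Ext_trivialD[OF assms(2)] assms(1) etriangleD(6)[OF assms(1)] by metis

lemma summand_closedD:
  assumes "additive_summand_closed \<C> \<U>"
  shows "\<U> \<subseteq> Obj \<C>" "is_zero_object \<C> Z \<Longrightarrow> Z \<in> \<U>"
    "\<lbrakk>A \<in> \<U>; B \<in> \<U>; is_biproduct \<C> A B P i j p q\<rbrakk> \<Longrightarrow> P \<in> \<U>"
    "\<lbrakk>A \<in> \<U>; f \<in> Hom \<C> A B; iso_mor \<C> f\<rbrakk> \<Longrightarrow> B \<in> \<U>"
    "\<lbrakk>P \<in> \<U>; is_biproduct \<C> A B P i j p q\<rbrakk> \<Longrightarrow> A \<in> \<U>"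
    "\<lbrakk>P \<in> \<U>; is_biproduct \<C> A B P i j p q\<rbrakk> \<Longrightarrow> B \<in> \<U>"
proof -
  note a = assms[unfolded additive_summand_closed_def]
  show "\<U> \<subseteq> Obj \<C>" using a by blast
  show iso: "B \<in> \<U>" if "A \<in> \<U>" "f \<in> Hom \<C> A B" "iso_mor \<C> f" for A B f
    using a that unfolding isomorphic_def by blast
  show "Z \<in> \<U>" if "is_zero_object \<C> Z"
    using a that zero_objects_isomorphic by blast
  show "P \<in> \<U>" if "A \<in> \<U>" "B \<in> \<U>" "is_biproduct \<C> A B P i j p q" using a that by blast
  show summand: "A \<in> \<U>" if "P \<in> \<U>" "is_biproduct \<C> A B P i j p q" for A B P i j p q using a that by blast
  show "B \<in> \<U>" if "P \<in> \<U>" "is_biproduct \<C> A B P i j p q"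
    using summand[OF that(1) biproduct_sym[OF that(2)]] .
qed

lemma cotorsion_pairD:
  assumes "cotorsion_pair \<C> (\<U>, \<V>)"
  shows "additive_summand_closed \<C> \<U>" "additive_summand_closed \<C> \<V>"
    "\<lbrakk>U \<in> \<U>; V \<in> \<V>\<rbrakk> \<Longrightarrow> Ext_trivial \<C> U V"
  using assms by (auto simp: cotorsion_pair_def Ext_vanishes_def Ext_trivial_def)

lemma cotorsion_pair_right_approx:
  assumes "cotorsion_pair \<C> (\<U>, \<V>)" "X \<in> Obj \<C>"
  obtains U V x y \<delta> where "U \<in> \<U>" "V \<in> \<V>" "etriangle \<C> V U X x y \<delta>"
  using assms unfolding cotorsion_pair_def conflation_def by blast

lemma cotorsion_pair_left_approx:
  assumes "cotorsion_pair \<C> (\<U>, \<V>)" "X \<in> Obj \<C>"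
  obtains U V x y \<delta> where "U \<in> \<U>" "V \<in> \<V>" "etriangle \<C> X V U x y \<delta>"
  using assms unfolding cotorsion_pair_def conflation_def by blast

text \<open>The approximation V \<rightarrow> U \<rightarrow> X splits, making X a summand of U.
  Thus the left class is the full left orthogonal of the right class, which is what makes it
  extension-closed.\<close>

lemma cotorsion_left_classI:
  assumes c: "cotorsion_pair \<C> (\<U>, \<V>)" and "X \<in> Obj \<C>" "\<And>V. V \<in> \<V> \<Longrightarrow> Ext_trivial \<C> X V"
  shows "X \<in> \<U>"
proof -
  obtain U V x y \<delta> where t: "U \<in> \<U>" "V \<in> \<V>" "etriangle \<C> V U X x y \<delta>"
    using cotorsion_pair_right_approx[OF assms(1,2)] .
  obtain j p where "is_biproduct \<C> V X U x j p y"
    using etriangle_splits_trivial[OF t(3) assms(3)[OF t(2)]] .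
  then show ?thesis using summand_closedD(6)[OF cotorsion_pairD(1)[OF c]] t(1) by blast
qed

lemma cotorsion_right_classI:
  assumes c: "cotorsion_pair \<C> (\<U>, \<V>)" and "X \<in> Obj \<C>" "\<And>U. U \<in> \<U> \<Longrightarrow> Ext_trivial \<C> U X"
  shows "X \<in> \<V>"
proof -
  obtain U V x y \<delta> where t: "U \<in> \<U>" "V \<in> \<V>" "etriangle \<C> X V U x y \<delta>"
    using cotorsion_pair_left_approx[OF assms(1,2)] .
  obtain j p where "is_biproduct \<C> X U V x j p y"
    using etriangle_splits_trivial[OF t(3) assms(3)[OF t(1)]] .
  then show ?thesis using summand_closedD(5)[OF cotorsion_pairD(2)[OF c]] t(2) by blast
qed

lemma cotorsion_extension_closed:
  assumes c: "cotorsion_pair \<C> (\<U>, \<V>)" and t: "etriangle \<C> A B X x y \<delta>"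
  shows "\<lbrakk>A \<in> \<U>; X \<in> \<U>\<rbrakk> \<Longrightarrow> B \<in> \<U>" "\<lbrakk>A \<in> \<V>; X \<in> \<V>\<rbrakk> \<Longrightarrow> B \<in> \<V>"
proof -
  note d = etriangleD[OF t] cotorsion_pairD[OF c]
  { assume "A \<in> \<U>" "X \<in> \<U>"
    then show "B \<in> \<U>"
      using d(2) d(15) summand_closedD(1)[OF d(14)]
      by (intro cotorsion_left_classI[OF c] Ext_trivial_extension_left[OF t]) auto }
  { assume "A \<in> \<V>" "X \<in> \<V>"
    then show "B \<in> \<V>"
      using d(2) d(15) summand_closedD(1)[OF d(13)]
      by (intro cotorsion_right_classI[OF c] Ext_trivial_extension_right[OF t]) auto }
qed

end

section \<open>Hovey twin cotorsion pairs\<close>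

locale hovey_twin = extriangulated_category \<C>
  for \<C> :: "('o, 'm, 'e, 'z) extri_category_scheme" (structure) +
  fixes \<S> \<T> \<U> \<V> :: "'o set"
  assumes hovey: "hovey_twin_cotorsion_pair \<C> ((\<S>, \<T>), (\<U>, \<V>))"
begin

lemma ST: "cotorsion_pair \<C> (\<S>, \<T>)" and UV: "cotorsion_pair \<C> (\<U>, \<V>)"
  using hovey by (auto simp: hovey_twin_cotorsion_pair_def twin_cotorsion_pair_def)

lemma Ext_S_V: "\<lbrakk>S \<in> \<S>; V \<in> \<V>\<rbrakk> \<Longrightarrow> Ext_trivial \<C> S V"
  using hovey
  by (auto simp: hovey_twin_cotorsion_pair_def twin_cotorsion_pair_def Ext_vanishes_def Ext_trivial_def)

lemmas S_closed = cotorsion_pairD(1)[OF ST] and T_closed = cotorsion_pairD(2)[OF ST]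
  and U_closed = cotorsion_pairD(1)[OF UV] and V_closed = cotorsion_pairD(2)[OF UV]
  and Ext_S_T = cotorsion_pairD(3)[OF ST] and Ext_U_V = cotorsion_pairD(3)[OF UV]

lemma class_Obj: "X \<in> \<S> \<Longrightarrow> X \<in> Obj \<C>" "X \<in> \<T> \<Longrightarrow> X \<in> Obj \<C>" "X \<in> \<U> \<Longrightarrow> X \<in> Obj \<C>" "X \<in> \<V> \<Longrightarrow> X \<in> Obj \<C>"
  using S_closed T_closed U_closed V_closed summand_closedD(1) by blast+

lemma S_subset_U: "X \<in> \<S> \<Longrightarrow> X \<in> \<U>"
  by (rule cotorsion_left_classI[OF UV]) (auto intro: Ext_S_V class_Obj)

lemma V_subset_T: "X \<in> \<V> \<Longrightarrow> X \<in> \<T>"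
  by (rule cotorsion_right_classI[OF ST]) (auto intro: Ext_S_V class_Obj)

section \<open>Trivial objects\<close>

definition \<N> :: "'o set" where "\<N> = N_i \<C> ((\<S>, \<T>), (\<U>, \<V>))"

text \<open>The first description suits arguments that compose deflations, the second those that
  compose inflations. The Hovey equality enters only through this lemma.\<close>

lemma N_iff:
  "X \<in> \<N> \<longleftrightarrow> (\<exists>V \<in> \<V>. \<exists>S \<in> \<S>. \<exists>x y \<delta>. etriangle \<C> V S X x y \<delta>)"
  "X \<in> \<N> \<longleftrightarrow> (\<exists>V \<in> \<V>. \<exists>S \<in> \<S>. \<exists>x y \<delta>. etriangle \<C> X V S x y \<delta>)"
proof -
  show "X \<in> \<N> \<longleftrightarrow> (\<exists>V \<in> \<V>. \<exists>S \<in> \<S>. \<exists>x y \<delta>. etriangle \<C> V S X x y \<delta>)"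
    unfolding \<N>_def N_i_def conflation_def using etriangleD(3) by fast
  have "\<N> = N_f \<C> ((\<S>, \<T>), (\<U>, \<V>))"
    using hovey by (simp add: \<N>_def hovey_twin_cotorsion_pair_def)
  then show "X \<in> \<N> \<longleftrightarrow> (\<exists>V \<in> \<V>. \<exists>S \<in> \<S>. \<exists>x y \<delta>. etriangle \<C> X V S x y \<delta>)"
    unfolding N_f_def conflation_def using etriangleD(1) by fast
qed

lemma S_subset_N: "X \<in> \<S> \<Longrightarrow> X \<in> \<N>" and V_subset_N: "X \<in> \<V> \<Longrightarrow> X \<in> \<N>"
proof -
  obtain Z where Z: "is_zero_object \<C> Z" using zero_object_ex by blast
  have Z': "Z \<in> \<V>" "Z \<in> \<S>"
    using summand_closedD(2)[OF V_closed Z] summand_closedD(2)[OF S_closed Z] by auto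
  show "X \<in> \<N>" if X: "X \<in> \<S>"
    unfolding N_iff(1) using etriangle_Ident(1)[OF Z class_Obj(1)[OF X]] X Z' by blast
  show "X \<in> \<N>" if X: "X \<in> \<V>"
    unfolding N_iff(2) using etriangle_Ident(2)[OF Z class_Obj(4)[OF X]] X Z' by blast
qed

text \<open>The conflation V \<rightarrow> S \<rightarrow> X splits since \<E>(\<U>, \<V>) = 0, so X
  is a summand of S. Together with \<open>T_inter_N\<close> this gives \<S> = \<U> \<inter> \<N> and
  \<V> = \<T> \<inter> \<N>, hence \<S> \<inter> \<T> = \<U> \<inter> \<V>.\<close>

lemma U_inter_N: "X \<in> \<U> \<Longrightarrow> X \<in> \<N> \<Longrightarrow> X \<in> \<S>"
proof -
  assume X: "X \<in> \<U>" "X \<in> \<N>"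
  then obtain V S x y \<delta> where t: "V \<in> \<V>" "S \<in> \<S>" "etriangle \<C> V S X x y \<delta>" using N_iff(1) by blast
  obtain j p where "is_biproduct \<C> V X S x j p y"
    using etriangle_splits_trivial[OF t(3) Ext_U_V[OF X(1) t(1)]] .
  then show ?thesis using summand_closedD(6)[OF S_closed t(2)] by blast
qed

lemma T_inter_N: "X \<in> \<T> \<Longrightarrow> X \<in> \<N> \<Longrightarrow> X \<in> \<V>"
proof -
  assume X: "X \<in> \<T>" "X \<in> \<N>"
  then obtain V S x y \<delta> where t: "V \<in> \<V>" "S \<in> \<S>" "etriangle \<C> X V S x y \<delta>" using N_iff(2) by blast
  obtain j p where "is_biproduct \<C> X S V x j p y"
    using etriangle_splits_trivial[OF t(3) Ext_S_T[OF t(2) X(1)]] .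
  then show ?thesis using summand_closedD(5)[OF V_closed t(1)] by blast
qed

lemma S_inter_T: "\<S> \<inter> \<T> = \<U> \<inter> \<V>"
  using S_subset_U V_subset_T S_subset_N V_subset_N U_inter_N T_inter_N by blast

section \<open>Weak fibrations, weak cofibrations and their effect on trivial objects\<close>

lemma wFibI: "etriangle \<C> V A B x f \<delta> \<Longrightarrow> V \<in> \<V> \<Longrightarrow> f \<in> wFib \<C> \<V>"
  and wCofI: "etriangle \<C> A B S f y \<delta> \<Longrightarrow> S \<in> \<S> \<Longrightarrow> f \<in> wCof \<C> \<S>"
  unfolding wFib_def wCof_def conflation_def by blast+

lemma wFibE:
  assumes "f \<in> wFib \<C> \<V>" "f \<in> Hom \<C> A B"
  obtains V x \<delta> where "V \<in> \<V>" "etriangle \<C> V A B x f \<delta>"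
proof -
  obtain V A' B' x \<delta> where "V \<in> \<V>" "etriangle \<C> V A' B' x f \<delta>"
    using assms(1) by (auto simp: wFib_def conflation_def)
  moreover from this assms(2) have "A' = A" "B' = B" by (auto simp: Hom_iff dest: etriangleD)
  ultimately show ?thesis using that by blast
qed

lemma wCofE:
  assumes "f \<in> wCof \<C> \<S>" "f \<in> Hom \<C> A B"
  obtains S y \<delta> where "S \<in> \<S>" "etriangle \<C> A B S f y \<delta>"
proof -
  obtain S A' B' y \<delta> where "S \<in> \<S>" "etriangle \<C> A' B' S f y \<delta>"
    using assms(1) by (auto simp: wCof_def conflation_def)
  moreover from this assms(2) have "A' = A" "B' = B" by (auto simp: Hom_iff dest: etriangleD)
  ultimately show ?thesis using that by blast
qed

lemma wFib_Mor: "f \<in> wFib \<C> \<V> \<Longrightarrow> f \<in> Mor \<C>" and wCof_Mor: "f \<in> wCof \<C> \<S> \<Longrightarrow> f \<in> Mor \<C>"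
  by (auto simp: wFib_def wCof_def conflation_def dest: etriangleD)

text \<open>By (ET4)^op the fibre of the composite is an extension of the two fibres, and \<V> is
  extension-closed; for cofibrations the same is done with cokernels in \<S>.\<close>

lemma wFib_Comp:
  assumes "f \<in> wFib \<C> \<V>" "f \<in> Hom \<C> A B" "g \<in> wFib \<C> \<V>" "g \<in> Hom \<C> B D"
  shows "g \<cdot> f \<in> wFib \<C> \<V>"
proof -
  obtain V x \<delta> where f: "V \<in> \<V>" "etriangle \<C> V A B x f \<delta>" using wFibE[OF assms(1,2)] .
  obtain V' x' \<delta>' where g: "V' \<in> \<V>" "etriangle \<C> V' B D x' g \<delta>'" using wFibE[OF assms(3,4)] .
  obtain E h \<epsilon> d e where E: "etriangle \<C> E A D h (g \<cdot> f) \<epsilon>" "etriangle \<C> V E V' d e (pull \<C> V x' \<delta>)"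
    using ET4_op[OF f(2) g(2)] by blast
  show ?thesis using wFibI[OF E(1) cotorsion_extension_closed(2)[OF UV E(2) f(1) g(1)]] .
qed

lemma wCof_Comp:
  assumes "f \<in> wCof \<C> \<S>" "f \<in> Hom \<C> A B" "g \<in> wCof \<C> \<S>" "g \<in> Hom \<C> B D"
  shows "g \<cdot> f \<in> wCof \<C> \<S>"
proof -
  obtain S y \<delta> where f: "S \<in> \<S>" "etriangle \<C> A B S f y \<delta>" using wCofE[OF assms(1,2)] .
  obtain S' y' \<delta>' where g: "S' \<in> \<S>" "etriangle \<C> B D S' g y' \<delta>'" using wCofE[OF assms(3,4)] .
  obtain E h \<epsilon> d e where E: "etriangle \<C> A D E (g \<cdot> f) h \<epsilon>" "etriangle \<C> S E S' d e (push \<C> S' y \<delta>')"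
    using ET4[OF f(2) g(2)] by blast
  show ?thesis using wCofI[OF E(1) cotorsion_extension_closed(1)[OF ST E(2) f(1) g(1)]] .
qed

lemma Ident_wFib: "A \<in> Obj \<C> \<Longrightarrow> Ident \<C> A \<in> wFib \<C> \<V>"
  and Ident_wCof: "A \<in> Obj \<C> \<Longrightarrow> Ident \<C> A \<in> wCof \<C> \<S>"
proof -
  obtain Z where Z: "is_zero_object \<C> Z" using zero_object_ex by blast
  assume A: "A \<in> Obj \<C>"
  show "Ident \<C> A \<in> wFib \<C> \<V>"
    using wFibI[OF etriangle_Ident(1)[OF Z A] summand_closedD(2)[OF V_closed Z]] .
  show "Ident \<C> A \<in> wCof \<C> \<S>"
    using wCofI[OF etriangle_Ident(2)[OF Z A] summand_closedD(2)[OF S_closed Z]] .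
qed

text \<open>An isomorphism is a deflation with fibre 0: the triangle 0 \<rightarrow> B \<rightarrow>
  B is transported along the inverse.\<close>

lemma iso_wFib:
  assumes "f \<in> Hom \<C> A B" "iso_mor \<C> f" shows "f \<in> wFib \<C> \<V>"
proof -
  obtain Z where Z: "is_zero_object \<C> Z" using zero_object_ex by blast
  obtain g where g: "g \<in> Hom \<C> B A" "g \<cdot> f = Ident \<C> A" "f \<cdot> g = Ident \<C> B"
    using iso_morE[OF assms(2,1)] .
  have "B \<in> Obj \<C>" using Hom_Obj assms(1) by blast
  from etriangle_mid_iso[OF etriangle_Ident(1)[OF Z this] g(1) assms(1) g(3,2)]
  show ?thesis
    using wFibI summand_closedD(2)[OF V_closed Z] assms(1) by (auto simp: Hom_iff cat_simps)
qed

text \<open>A weak fibration S \<rightarrow> A remains one after composition with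
  \<open>f\<close>.\<close>

lemma wFib_N: "\<lbrakk>f \<in> wFib \<C> \<V>; f \<in> Hom \<C> A B; A \<in> \<N>\<rbrakk> \<Longrightarrow> B \<in> \<N>"
proof -
  assume f: "f \<in> wFib \<C> \<V>" "f \<in> Hom \<C> A B" and "A \<in> \<N>"
  then obtain V S x y \<delta> where t: "V \<in> \<V>" "S \<in> \<S>" "etriangle \<C> V S A x y \<delta>" using N_iff(1) by blast
  have "f \<cdot> y \<in> wFib \<C> \<V>" "f \<cdot> y \<in> Hom \<C> S B"
    using wFib_Comp[OF wFibI[OF t(3,1)] etriangleD(5)[OF t(3)] f] Comp_Hom[OF etriangleD(5)[OF t(3)] f(2)] by auto
  then obtain V' x' \<delta>' where "V' \<in> \<V>" "etriangle \<C> V' S B x' (f \<cdot> y) \<delta>'" by (rule wFibE)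
  then show ?thesis using N_iff(1) t(2) by blast
qed

text \<open>Dually, a weak cofibration B \<rightarrow> V is precomposed with \<open>f\<close>.
  Passing from source to target is harder, because neither description of \<N> composes with
  \<open>f\<close> in that direction.\<close>

lemma wCof_N_source: "\<lbrakk>f \<in> wCof \<C> \<S>; f \<in> Hom \<C> A B; B \<in> \<N>\<rbrakk> \<Longrightarrow> A \<in> \<N>"
proof -
  assume f: "f \<in> wCof \<C> \<S>" "f \<in> Hom \<C> A B" and "B \<in> \<N>"
  then obtain V S x y \<delta> where t: "V \<in> \<V>" "S \<in> \<S>" "etriangle \<C> B V S x y \<delta>" using N_iff(2) by blast
  have "x \<cdot> f \<in> wCof \<C> \<S>" "x \<cdot> f \<in> Hom \<C> A V"
    using wCof_Comp[OF f wCofI[OF t(3,2)] etriangleD(4)[OF t(3)]] Comp_Hom[OF f(2) etriangleD(4)[OF t(3)]] by auto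
  then obtain S' y' \<delta>' where "S' \<in> \<S>" "etriangle \<C> A V S' (x \<cdot> f) y' \<delta>'" by (rule wCofE)
  then show ?thesis using N_iff(2) t(1) by blast
qed

text \<open>Pushing out \<open>A \<rightarrow> B\<close> along a conflation \<open>A \<rightarrow> V \<rightarrow> S\<close> replaces \<open>B\<close> by \<open>V \<oplus> X\<close>.\<close>

lemma wCof_N_target:
  assumes f: "f \<in> wCof \<C> \<S>" "f \<in> Hom \<C> A B" and A: "A \<in> \<N>"
  shows "B \<in> \<N>"
proof -
  obtain X y \<delta> where X: "X \<in> \<S>" and t: "etriangle \<C> A B X f y \<delta>" using wCofE[OF f] .
  obtain V S x z \<epsilon> where VS: "V \<in> \<V>" "S \<in> \<S>" and t': "etriangle \<C> A V S x z \<epsilon>" using A N_iff(2) by blast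
  obtain P k l k' l' \<eta> \<eta>' where P: "etriangle \<C> V P X k l \<eta>" "etriangle \<C> B P S k' l' \<eta>'"
    using inflation_pushout[OF t t'] unfolding conflation_def by metis
  obtain V' S' x' y' \<delta>' where t'': "V' \<in> \<V>" "S' \<in> \<S>" "etriangle \<C> X V' S' x' y' \<delta>'"
    using S_subset_N[OF X] N_iff(2) by blast
  obtain j p where b: "is_biproduct \<C> V X P k j p l"
    using etriangle_splits_trivial[OF P(1) Ext_S_V[OF X VS(1)]] .
  obtain P' i' j' p' q' where b': "is_biproduct \<C> V V' P' i' j' p' q'"
    using biproduct_ex[OF class_Obj(4)[OF VS(1)] class_Obj(4)[OF t''(1)]] by blast
  \<comment> \<open>As P = V \<oplus> X, adding V to the conflation X \<rightarrow> V' \<rightarrow>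
    S' embeds P into an object of \<V> with cokernel S'. Since B \<rightarrow> P is a weak
    cofibration, triviality then passes back to B.\<close>
  have "P \<in> \<N>"
    unfolding N_iff(2) using etriangle_biproduct_left[OF t''(3) b b'] t''(2)
      summand_closedD(3)[OF V_closed VS(1) t''(1) b'] by blast
  then show ?thesis using wCof_N_source[OF wCofI[OF P(2) VS(2)]] etriangleD(4)[OF P(2)] by blast
qed

text \<open>The composite \<open>B \<leftarrow> A \<rightarrow> M \<rightarrow> D\<close> comes from the inflation \<open>(x, j p) : A \<rightarrow> V\<^sub>1 \<oplus> D\<close>, where
  \<open>p : A \<rightarrow> B\<close> is a \<open>\<U>\<close>-approximation and \<open>x : A \<rightarrow> V\<^sub>1\<close> a \<open>\<V>\<close>-approximation. Its cokernel \<open>N\<close> is an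
  extension of objects of \<open>\<U>\<close>, and it is also an extension of an object of \<open>\<S>\<close> by the cone of
  a morphism in \<open>\<V>\<close>, hence lies in \<open>\<N>\<close>.\<close>

lemma wCof_into_U:
  assumes j: "j \<in> wCof \<C> \<S>" "j \<in> Hom \<C> B D" and D: "D \<in> \<U>"
  obtains A M p k r where "A \<in> \<U>" "M \<in> \<U>" "p \<in> wFib \<C> \<V>" "p \<in> Hom \<C> A B"
    "k \<in> wCof \<C> \<S>" "k \<in> Hom \<C> A M" "r \<in> wFib \<C> \<V>" "r \<in> Hom \<C> M D" "r \<cdot> k = j \<cdot> p"
proof -
  obtain S y \<gamma> where S: "S \<in> \<S>" and tj: "etriangle \<C> B D S j y \<gamma>" using wCofE[OF j] .
  note dj = etriangleD[OF tj]
  obtain A V v p \<alpha> where AV: "A \<in> \<U>" "V \<in> \<V>" and tp: "etriangle \<C> V A B v p \<alpha>"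
    using cotorsion_pair_right_approx[OF UV dj(1)] .
  note dp = etriangleD[OF tp]
  obtain U\<^sub>1 V\<^sub>1 x z \<beta> where UV1: "U\<^sub>1 \<in> \<U>" "V\<^sub>1 \<in> \<V>" and tx: "etriangle \<C> A V\<^sub>1 U\<^sub>1 x z \<beta>"
    using cotorsion_pair_left_approx[OF UV dp(2)] .
  note dx = etriangleD[OF tx]
  have V1: "V\<^sub>1 \<in> \<U>" by (rule cotorsion_extension_closed(1)[OF UV tx AV(1) UV1(1)])
  \<comment> \<open>X is the cone of V \<rightarrow> A \<rightarrow> \<open>V\<^sub>1\<close>. It is
    trivial, because \<open>V\<^sub>1\<close> \<rightarrow> X is a weak fibration from an object of
    \<V>; below it is recognized through its other conflation, from B to
    \<open>U\<^sub>1\<close>.\<close>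
  obtain X h \<xi> d e where X: "etriangle \<C> V V\<^sub>1 X (x \<cdot> v) h \<xi>" "etriangle \<C> B X U\<^sub>1 d e (push \<C> U\<^sub>1 p \<beta>)"
    using ET4[OF tp tx] by blast
  have XN: "X \<in> \<N>"
    using wFib_N[OF wFibI[OF X(1) AV(2)] etriangleD(5)[OF X(1)] V_subset_N[OF UV1(2)]] .
  obtain P iV iB qV qB where b: "is_biproduct \<C> V\<^sub>1 B P iV iB qV qB" using biproduct_ex dj dx by blast
  obtain M jV jD rV rD where b': "is_biproduct \<C> V\<^sub>1 D M jV jD rV rD" using biproduct_ex dj dx by blast
  note db = biproductD[OF b] note db' = biproductD[OF b']
  \<comment> \<open>The minus sign at \<open>p\<close> cancels the one produced by
    \<open>inflation_pair\<close>, so X' realizes the same extension in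
    \<E>(\<open>U\<^sub>1\<close>, B) as X.\<close>
  obtain X' h' \<xi>' d' e' where X': "etriangle \<C> A P X' (iB \<cdot> mneg \<C> p \<boxplus> iV \<cdot> x) h' \<xi>'"
    "etriangle \<C> B X' U\<^sub>1 d' e' (push \<C> U\<^sub>1 (mneg \<C> (mneg \<C> p)) \<beta>)"
    using inflation_pair[OF tx biproduct_sym[OF b] mneg_Hom[OF dp(5)]] .
  have "mneg \<C> (mneg \<C> p) = p" using dp by (simp add: mneg_mneg)
  then obtain \<phi> where \<phi>: "\<phi> \<in> Hom \<C> X X'" "iso_mor \<C> \<phi>"
    using etriangle_compare[OF X(2)] X'(2) by metis
  have X'N: "X' \<in> \<N>" using wFib_N[OF iso_wFib[OF \<phi>] \<phi>(1) XN] .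
  \<comment> \<open>A sign change on D undoes the previous one, so that the composite inflation is
    (x, j p), the map \<open>k\<close> below.\<close>
  let ?s = "mneg \<C> (Ident \<C> D)"
  have s: "?s \<in> Hom \<C> D D" "?s \<cdot> ?s = Ident \<C> D"
    using dj by (auto simp: Hom_iff add_simps)
  note t2 = etriangle_biproduct_left[OF etriangle_mid_iso[OF tj s(1,1) s(2,2)] b b']
  obtain N m \<nu> d'' e'' \<epsilon> where N:
    "etriangle \<C> A M N ((jV \<cdot> qV \<boxplus> jD \<cdot> (?s \<cdot> j \<cdot> qB)) \<cdot> (iB \<cdot> mneg \<C> p \<boxplus> iV \<cdot> x)) m \<nu>"
    "etriangle \<C> X' N S d'' e'' \<epsilon>"
    using ET4[OF X'(1) t2] by blast
  define k where "k = jV \<cdot> x \<boxplus> jD \<cdot> (j \<cdot> p)"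
  have "(jV \<cdot> qV \<boxplus> jD \<cdot> (?s \<cdot> j \<cdot> qB)) \<cdot> (iB \<cdot> mneg \<C> p \<boxplus> iV \<cdot> x) = k"
    by (simp add: k_def dj dp dx db db'(1-15) add_simps biproduct_reassoc[OF b]
        MAdd_commute[of "jV \<cdot> x"])
  with N(1) have tk: "etriangle \<C> A M N k m \<nu>" by simp
  have NN: "N \<in> \<N>" using wCof_N_target[OF wCofI[OF N(2) S] etriangleD(4)[OF N(2)] X'N] .
  have jp: "j \<cdot> p \<in> Hom \<C> A D" using dj dp by (simp add: Hom_iff cat_simps)
  \<comment> \<open>The cone of the same map \<open>k\<close>, computed now as an extension of
    \<open>U\<^sub>1\<close> by D, which places it in \<U>.\<close>
  obtain N' m' \<nu>' l l' where N': "etriangle \<C> A M N' (jD \<cdot> (j \<cdot> p) \<boxplus> jV \<cdot> x) m' \<nu>'"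
    "etriangle \<C> D N' U\<^sub>1 l l' (push \<C> U\<^sub>1 (mneg \<C> (j \<cdot> p)) \<beta>)"
    using inflation_pair[OF tx biproduct_sym[OF b'] jp] .
  have "jD \<cdot> (j \<cdot> p) \<boxplus> jV \<cdot> x = k"
    unfolding k_def by (rule MAdd_commute) (simp_all add: dj dp dx db' cat_simps)
  with N'(1) obtain \<psi> where "\<psi> \<in> Hom \<C> N' N" "iso_mor \<C> \<psi>" using cokernel_unique[OF _ tk] by metis
  moreover have "N' \<in> \<U>" by (rule cotorsion_extension_closed(1)[OF UV N'(2) D UV1(1)])
  ultimately have "N \<in> \<U>" using summand_closedD(4)[OF U_closed] by blast
  then have "N \<in> \<S>" using NN U_inter_N by blast
  then have k: "k \<in> wCof \<C> \<S>" using wCofI[OF tk] by blast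
  have r: "rD \<in> wFib \<C> \<V>" using wFibI[OF etriangle_biproduct[OF b'] UV1(2)] .
  have rk: "rD \<cdot> k = j \<cdot> p"
    by (simp add: k_def dj dp dx db' add_simps biproduct_reassoc[OF b'])
  have M: "M \<in> \<U>" by (rule summand_closedD(3)[OF U_closed V1 D b'])
  show ?thesis
    by (rule that[OF AV(1) M wFibI[OF tp AV(2)] dp(5) k etriangleD(4)[OF tk] r _ rk])
      (simp add: Hom_iff db')
qed

end

section \<open>Replacements and the functor to \<open>\<Z>/\<I>\<close>\<close>

context hovey_twin
begin

abbreviation \<I> :: "'o set" where "\<I> \<equiv> \<S> \<inter> \<T>"

abbreviation \<Z> :: "'o set" where "\<Z> \<equiv> \<T> \<inter> \<U>"

lemma I_subset_Z: "\<I> \<subseteq> \<Z>"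
  using S_subset_U by blast

lemma inter_closed:
  assumes A: "additive_summand_closed \<C> \<A>" and B: "additive_summand_closed \<C> \<B>"
  shows "\<A> \<inter> \<B> \<subseteq> Obj \<C>" "\<exists>Z \<in> \<A> \<inter> \<B>. is_zero_object \<C> Z"
    "\<lbrakk>X \<in> \<A> \<inter> \<B>; Y \<in> \<A> \<inter> \<B>\<rbrakk> \<Longrightarrow> \<exists>P \<in> \<A> \<inter> \<B>. \<exists>i j p q. is_biproduct \<C> X Y P i j p q"
proof -
  note a = summand_closedD[OF A] note b = summand_closedD[OF B]
  show "\<A> \<inter> \<B> \<subseteq> Obj \<C>" using a(1) by blast
  show "\<exists>Z \<in> \<A> \<inter> \<B>. is_zero_object \<C> Z" using zero_object_ex a(2) b(2) by blast
  assume XY: "X \<in> \<A> \<inter> \<B>" "Y \<in> \<A> \<inter> \<B>"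
  then obtain P i j p q where "is_biproduct \<C> X Y P i j p q" using biproduct_ex a(1) by blast
  then show "\<exists>P \<in> \<A> \<inter> \<B>. \<exists>i j p q. is_biproduct \<C> X Y P i j p q" using XY a(3) b(3) by blast
qed

sublocale additive_ideal \<C> \<I>
  by unfold_locales (use inter_closed[OF S_closed T_closed] in blast)+

lemma Z_simps:
  "Obj (full_subcategory \<C> \<Z>) = \<Z>" "Ident (full_subcategory \<C> \<Z>) = Ident \<C>"
  "Comp (full_subcategory \<C> \<Z>) = Comp \<C>" "Dom (full_subcategory \<C> \<Z>) = Dom \<C>"
  "Cod (full_subcategory \<C> \<Z>) = Cod \<C>" "MAdd (full_subcategory \<C> \<Z>) = MAdd \<C>"
  "MZero (full_subcategory \<C> \<Z>) = MZero \<C>"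
  by (simp_all add: full_subcategory_def)

sublocale Z: additive_ideal "full_subcategory \<C> \<Z>" \<I>
proof (intro additive_ideal.intro additive_ideal_axioms.intro)
  note z = inter_closed[OF T_closed U_closed]
  show "additive_category (full_subcategory \<C> \<Z>)" by (rule additive_full_subcategory[OF z])
  show "\<I> \<subseteq> Obj (full_subcategory \<C> \<Z>)" using I_subset_Z by (simp add: Z_simps)
  obtain Z where Z: "Z \<in> \<I>" "is_zero_object \<C> Z" using inter_closed(2)[OF S_closed T_closed] by blast
  then have "is_zero_object (full_subcategory \<C> \<Z>) Z"
    using I_subset_Z z(1) by (simp add: is_zero_object_def Z_simps full_subcategory_Hom subset_eq)
  with Z show "\<exists>Z \<in> \<I>. is_zero_object (full_subcategory \<C> \<Z>) Z" by blast
  fix A B assume AB: "A \<in> \<I>" "B \<in> \<I>"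
  then obtain P i j p q where P: "P \<in> \<I>" "is_biproduct \<C> A B P i j p q"
    using inter_closed(3)[OF S_closed T_closed] by blast
  then have "is_biproduct (full_subcategory \<C> \<Z>) A B P i j p q"
    using AB S_subset_U by (simp add: is_biproduct_def Z_simps full_subcategory_Hom)
  with P show "\<exists>P \<in> \<I>. \<exists>i j p q. is_biproduct (full_subcategory \<C> \<Z>) A B P i j p q" by blast
qed

abbreviation Q :: "('o, 'm set) category" where
  "Q \<equiv> ideal_quotient (full_subcategory \<C> \<Z>) \<I>"

abbreviation cls :: "'m \<Rightarrow> 'm set" where
  "cls \<equiv> ideal_class (full_subcategory \<C> \<Z>) \<I>"

sublocale Q: category Q
  by (rule Z.category_ideal_quotient)

lemma Z_Hom: "\<lbrakk>X \<in> \<Z>; Y \<in> \<Z>\<rbrakk> \<Longrightarrow> Hom (full_subcategory \<C> \<Z>) X Y = Hom \<C> X Y"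
  by (simp add: full_subcategory_Hom)

text \<open>As \<I> is contained in \<Z>, a map between objects of \<Z> is null in the full
  subcategory exactly if it is null in \<C>; the quotient can thus be handled with maps of
  \<C>.\<close>

lemma cls_eq_iff:
  assumes "X \<in> \<Z>" "Y \<in> \<Z>" "f \<in> Hom \<C> X Y" "g \<in> Hom \<C> X Y"
  shows "cls f = cls g \<longleftrightarrow> null (f \<boxplus> mneg \<C> g)"
proof -
  have h: "Dom \<C> g = X" "Cod \<C> g = Y" using assms by (auto simp: Hom_iff)
  have "Hom_group (full_subcategory \<C> \<Z>) X Y = Hom_group \<C> X Y"
    using assms by (simp add: Hom_group_def Z_simps Z_Hom)
  then have m: "mneg (full_subcategory \<C> \<Z>) g = mneg \<C> g"
    by (simp add: mneg_def Z_simps h)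
  have d: "f \<boxplus> mneg \<C> g \<in> Hom \<C> X Y" using assms by (intro MAdd_Hom mneg_Hom)
  then have "Hom (full_subcategory \<C> \<Z>) (Dom \<C> (f \<boxplus> mneg \<C> g)) J = Hom \<C> (Dom \<C> (f \<boxplus> mneg \<C> g)) J"
    "Hom (full_subcategory \<C> \<Z>) J (Cod \<C> (f \<boxplus> mneg \<C> g)) = Hom \<C> J (Cod \<C> (f \<boxplus> mneg \<C> g))"
    if "J \<in> \<I>" for J
    using that assms(1,2) S_subset_U by (auto simp: Hom_iff full_subcategory_Hom)
  then have "Z.null (f \<boxplus> mneg \<C> g) \<longleftrightarrow> null (f \<boxplus> mneg \<C> g)"
    unfolding factors_through_def Z_simps by (intro bex_cong[OF HOL.refl]) simp
  then show ?thesis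
    using Z.ideal_class_eq_iff[of f X Y g] assms by (simp add: Z_Hom m Z_simps)
qed

lemma Q_Hom: "\<lbrakk>X \<in> \<Z>; Y \<in> \<Z>\<rbrakk> \<Longrightarrow> Hom Q X Y = cls ` Hom \<C> X Y"
  by (simp add: Z.ideal_quotient_Hom Z_Hom)

lemma Q_Obj: "Obj Q = \<Z>"
  by (simp add: Z.ideal_quotient_Obj Z_simps)

lemma Q_Ident: "Ident Q X = cls (Ident \<C> X)"
  by (simp add: Z.ideal_quotient_Ident Z_simps)

lemma Q_Comp:
  assumes "X \<in> \<Z>" "Y \<in> \<Z>" "W \<in> \<Z>" "f \<in> Hom \<C> X Y" "g \<in> Hom \<C> Y W"
  shows "cls g \<cdot>\<^bsub>Q\<^esub> cls f = cls (g \<cdot> f)"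
  using Z.ideal_quotient_Comp[of f X Y g W] assms by (simp add: Z_Hom Z_simps)

text \<open>Embed A into an object V' of \<V> with cokernel in \<U>. Extension closure puts V' into
  \<U> \<inter> \<V>, and \<open>f\<close> extends over V' since \<E>(\<U>, \<V>) = 0.
  \<open>null_S_T\<close> repeats this for (\<S>, \<T>).\<close>

lemma null_U_V:
  assumes "A \<in> \<U>" "V \<in> \<V>" "f \<in> Hom \<C> A V"
  shows "null f"
proof -
  obtain U' V' x y \<delta> where t: "U' \<in> \<U>" "V' \<in> \<V>" "etriangle \<C> A V' U' x y \<delta>"
    using cotorsion_pair_left_approx[OF UV class_Obj(3)[OF assms(1)]] .
  have "V' \<in> \<I>"
    unfolding S_inter_T using cotorsion_extension_closed(1)[OF UV t(3) assms(1) t(1)] t(2) by blast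
  moreover obtain g where "g \<in> Hom \<C> V' V" "g \<cdot> x = f"
    using inflation_extends_trivial[OF t(3) assms(3) Ext_U_V[OF t(1) assms(2)]] .
  ultimately show ?thesis using nullI etriangleD(4)[OF t(3)] by blast
qed

lemma null_S_T:
  assumes "S \<in> \<S>" "Y \<in> \<T>" "f \<in> Hom \<C> S Y"
  shows "null f"
proof -
  obtain S' T' x y \<delta> where t: "S' \<in> \<S>" "T' \<in> \<T>" "etriangle \<C> S T' S' x y \<delta>"
    using cotorsion_pair_left_approx[OF ST class_Obj(1)[OF assms(1)]] .
  have "T' \<in> \<I>"
    using cotorsion_extension_closed(1)[OF ST t(3) assms(1) t(1)] t(2) by blast
  moreover obtain g where "g \<in> Hom \<C> T' Y" "g \<cdot> x = f"
    using inflation_extends_trivial[OF t(3) assms(3) Ext_S_T[OF t(1) assms(2)]] .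
  ultimately show ?thesis using nullI etriangleD(4)[OF t(3)] by blast
qed

section \<open>Replacement spans and lifts between them\<close>

definition replacement :: "'o \<Rightarrow> 'o \<Rightarrow> 'o \<Rightarrow> 'm \<Rightarrow> 'm \<Rightarrow> bool" where
  "replacement X A R p i \<longleftrightarrow> A \<in> \<U> \<and> R \<in> \<Z> \<and>
     p \<in> wFib \<C> \<V> \<and> p \<in> Hom \<C> A X \<and> i \<in> wCof \<C> \<S> \<and> i \<in> Hom \<C> A R"

lemma replacementD:
  assumes "replacement X A R p i"
  shows "A \<in> \<U>" "R \<in> \<Z>" "p \<in> wFib \<C> \<V>" "p \<in> Hom \<C> A X" "i \<in> wCof \<C> \<S>" "i \<in> Hom \<C> A R"
    "A \<in> Obj \<C>" "R \<in> Obj \<C>" "X \<in> Obj \<C>" "p \<in> Mor \<C>" "Dom \<C> p = A" "Cod \<C> p = X" "i \<in> Mor \<C>" "Dom \<C> i = A" "Cod \<C> i = R"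
  using assms Hom_Obj[of p A X] Hom_Obj[of i A R] by (auto simp: replacement_def Hom_iff)

text \<open>An object of \<U> needs only the second leg, whose target stays in \<U> because it is an
  extension of an object of \<S> by A.\<close>

lemma replacement_U:
  assumes "A \<in> \<U>"
  obtains R i where "replacement A A R (Ident \<C> A) i"
proof -
  note A = class_Obj(3)[OF assms]
  obtain S T x y \<delta> where t: "S \<in> \<S>" "T \<in> \<T>" "etriangle \<C> A T S x y \<delta>"
    using cotorsion_pair_left_approx[OF ST A] .
  have "T \<in> \<U>" using cotorsion_extension_closed(1)[OF UV t(3) assms S_subset_U[OF t(1)]] .
  then have "replacement A A T (Ident \<C> A) x"
    using assms t(2) Ident_wFib[OF A] Ident_Hom[OF A] wCofI[OF t(3,1)] etriangleD(4)[OF t(3)]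
    by (simp add: replacement_def)
  with that show ?thesis by blast
qed

text \<open>The same A and R serve for Y, so that \<open>f\<close> will act on replacements as the
  identity.\<close>

lemma replacement_wFib:
  assumes "replacement X A R p i" "f \<in> wFib \<C> \<V>" "f \<in> Hom \<C> X Y"
  shows "replacement Y A R (f \<cdot> p) i"
  using replacementD[OF assms(1)] wFib_Comp[OF replacementD(3,4)[OF assms(1)] assms(2,3)]
    Comp_Hom[OF replacementD(4)[OF assms(1)] assms(3)]
  by (simp add: replacement_def)

lemma replacement_ex:
  assumes "X \<in> Obj \<C>"
  obtains A R p i where "replacement X A R p i"
proof -
  obtain A V x p \<delta> where t: "A \<in> \<U>" "V \<in> \<V>" "etriangle \<C> V A X x p \<delta>"
    using cotorsion_pair_right_approx[OF UV assms] .
  obtain R i where "replacement A A R (Ident \<C> A) i" using replacement_U[OF t(1)] .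
  from replacement_wFib[OF this wFibI[OF t(3,2)] etriangleD(5)[OF t(3)]] that show ?thesis by blast
qed

lemma replacement_Ident: "X \<in> \<Z> \<Longrightarrow> replacement X X X (Ident \<C> X) (Ident \<C> X)"
  using class_Obj Ident_wFib Ident_wCof Ident_Hom by (auto simp: replacement_def)

text \<open>The map \<open>h\<close> between the approximations is only required to exist: the class
  of \<open>g\<close> modulo \<I> does not depend on it.\<close>

definition lifts :: "'m \<Rightarrow> 'm \<Rightarrow> 'm \<Rightarrow> 'm \<Rightarrow> 'm \<Rightarrow> 'm \<Rightarrow> bool" where
  "lifts p i q j f g \<longleftrightarrow> g \<in> Hom \<C> (Cod \<C> i) (Cod \<C> j) \<and>
     (\<exists>h \<in> Hom \<C> (Dom \<C> p) (Dom \<C> q). q \<cdot> h = f \<cdot> p \<and> g \<cdot> i = j \<cdot> h)"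

lemma lifts_ex:
  assumes X: "replacement X A R p i" and Y: "replacement Y B R' q j" and f: "f \<in> Hom \<C> X Y"
  obtains g where "lifts p i q j f g"
proof -
  note dX = replacementD[OF X] note dY = replacementD[OF Y]
  obtain V v \<delta> where V: "V \<in> \<V>" "etriangle \<C> V B Y v q \<delta>" using wFibE[OF dY(3,4)] .
  obtain S s \<epsilon> where S: "S \<in> \<S>" "etriangle \<C> A R S i s \<epsilon>" using wCofE[OF dX(5,6)] .
  obtain h where h: "h \<in> Hom \<C> A B" "q \<cdot> h = f \<cdot> p"
    using deflation_lifts_trivial[OF V(2) Comp_Hom[OF dX(4) f] Ext_U_V[OF dX(1) V(1)]] .
  have "R' \<in> \<T>" using dY(2) by blast
  then obtain g where "g \<in> Hom \<C> R R'" "g \<cdot> i = j \<cdot> h"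
    using inflation_extends_trivial[OF S(2) Comp_Hom[OF h(1) dY(6)] Ext_S_T[OF S(1)]] by blast
  then have "lifts p i q j f g" using h dX dY by (auto simp: lifts_def)
  with that show ?thesis by blast
qed

text \<open>Two lifts \<open>A \<rightarrow> B\<close> differ by a morphism through \<open>\<V>\<close>, hence through some \<open>J \<in> \<I>\<close>, and this extends
  along \<open>i\<close>; what remains of the difference \<open>R \<rightarrow> R'\<close> factors through the cokernel of \<open>i\<close>.\<close>

lemma lifts_unique:
  assumes X: "replacement X A R p i" and Y: "replacement Y B R' q j" and f: "f \<in> Hom \<C> X Y"
    and g: "lifts p i q j f g" and g': "lifts p i q j f g'"
  shows "cls g = cls g'"
proof -
  note dX = replacementD[OF X] note dY = replacementD[OF Y]
  obtain V v \<delta> where V: "V \<in> \<V>" "etriangle \<C> V B Y v q \<delta>" using wFibE[OF dY(3,4)] .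
  obtain S s \<epsilon> where S: "S \<in> \<S>" "etriangle \<C> A R S i s \<epsilon>" using wCofE[OF dX(5,6)] .
  note dS = etriangleD[OF S(2)]
  have gH: "g \<in> Hom \<C> R R'" "g' \<in> Hom \<C> R R'" using g g' dX dY by (auto simp: lifts_def)
  obtain h where h: "h \<in> Hom \<C> A B" "q \<cdot> h = f \<cdot> p" "g \<cdot> i = j \<cdot> h"
    using g dX dY by (auto simp: lifts_def)
  obtain h' where h': "h' \<in> Hom \<C> A B" "q \<cdot> h' = f \<cdot> p" "g' \<cdot> i = j \<cdot> h'"
    using g' dX dY by (auto simp: lifts_def)
  let ?d = "h \<boxplus> mneg \<C> h'"
  have m: "h \<in> Mor \<C>" "Dom \<C> h = A" "Cod \<C> h = B" "h' \<in> Mor \<C>" "Dom \<C> h' = A" "Cod \<C> h' = B"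
    "g \<in> Mor \<C>" "Dom \<C> g = R" "Cod \<C> g = R'" "g' \<in> Mor \<C>" "Dom \<C> g' = R" "Cod \<C> g' = R'"
    "f \<in> Mor \<C>" "Dom \<C> f = X" "Cod \<C> f = Y"
    using h h' gH f by (auto simp: Hom_iff)
  have d: "?d \<in> Hom \<C> A B" using m by (simp add: Hom_iff add_simps)
  have "q \<cdot> ?d = MZero \<C> A Y" using m dX dY h(2) h'(2) by (simp add: add_simps)
  then obtain a where a: "a \<in> Hom \<C> A V" "?d = v \<cdot> a" using inflation_factors[OF V(2) d] by blast
  have "null ?d"
    unfolding a(2) using null_Comp(1)[OF null_U_V[OF dX(1) V(1) a(1)] a(1) etriangleD(4)[OF V(2)]] .
  then obtain J u w where J: "J \<in> \<I>" "u \<in> Hom \<C> A J" "w \<in> Hom \<C> J B" "?d = w \<cdot> u"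
    using nullE d by (metis Hom_iff)
  have "J \<in> \<T>" using J(1) by blast
  then obtain u' where u': "u' \<in> Hom \<C> R J" "u' \<cdot> i = u"
    using inflation_extends_trivial[OF S(2) J(2) Ext_S_T[OF S(1)]] by blast
  \<comment> \<open>\<open>?k\<close> is null and has the same composite with \<open>i\<close> as
    \<open>?e\<close>. The difference of the two passes through a map S \<rightarrow> R' with R' in
    \<T>, so it is null as well.\<close>
  let ?k = "j \<cdot> (w \<cdot> u')" and ?e = "g \<boxplus> mneg \<C> g'"
  have m': "w \<in> Mor \<C>" "Dom \<C> w = J" "Cod \<C> w = B" "u' \<in> Mor \<C>" "Dom \<C> u' = R" "Cod \<C> u' = J"
    using J u' by (auto simp: Hom_iff)
  have k: "?k \<in> Hom \<C> R R'" and e: "?e \<in> Hom \<C> R R'"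
    using m m' dY by (simp_all add: Hom_iff add_simps)
  have ki: "?k \<cdot> i = j \<cdot> h \<boxplus> mneg \<C> (j \<cdot> h')"
  proof -
    have "?k \<cdot> i = j \<cdot> (w \<cdot> u)" using m' dX dY by (simp add: cat_simps u'(2))
    then show ?thesis using m dY by (simp add: J(4)[symmetric] add_simps)
  qed
  have ei: "?e \<cdot> i = j \<cdot> h \<boxplus> mneg \<C> (j \<cdot> h')"
    using m dX by (simp add: add_simps h(3) h'(3))
  have "(?e \<boxplus> mneg \<C> ?k) \<cdot> i = (?e \<cdot> i) \<boxplus> mneg \<C> (?k \<cdot> i)"
    using m m' dX dY by (simp add: add_simps)
  also have "\<dots> = MZero \<C> A R'"
    unfolding ki ei using m dX dY by (subst MAdd_mneg) (simp_all add: add_simps)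
  finally have "(?e \<boxplus> mneg \<C> ?k) \<cdot> i = MZero \<C> A R'" .
  moreover have ek: "?e \<boxplus> mneg \<C> ?k \<in> Hom \<C> R R'" by (rule MAdd_Hom[OF e mneg_Hom[OF k]])
  ultimately obtain c where c: "c \<in> Hom \<C> S R'" "?e \<boxplus> mneg \<C> ?k = c \<cdot> s"
    using deflation_factors[OF S(2) ek] by blast
  have "R' \<in> \<T>" using dY(2) by blast
  then have "null (c \<cdot> s)" using null_Comp(2)[OF null_S_T[OF S(1) _ c(1)] c(1) dS(5)] by blast
  moreover have "null ?k"
    using nullI[OF J(1) u'(1) Comp_Hom[OF J(3) dY(6)]] m' dY by (simp add: cat_simps)
  ultimately have "null ((?e \<boxplus> mneg \<C> ?k) \<boxplus> ?k)"
    using null_MAdd[of "c \<cdot> s" R R' ?k] c ek k by simp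
  also have "(?e \<boxplus> mneg \<C> ?k) \<boxplus> ?k = ?e"
  proof -
    have "(?e \<boxplus> mneg \<C> ?k) \<boxplus> ?k = ?e \<boxplus> (mneg \<C> ?k \<boxplus> ?k)"
      using e k by (intro MAdd_assoc) (auto simp: Hom_iff Dom_mneg Cod_mneg mneg_Mor)
    then show ?thesis using e k by (simp add: Hom_iff mneg_MAdd MAdd_MZero)
  qed
  finally show ?thesis using cls_eq_iff[OF dX(2) dY(2) gH] by simp
qed

lemma lifts_Comp:
  assumes "replacement X A R p i" "replacement Y B R' q j" "replacement W D R'' r k"
    and f: "f \<in> Hom \<C> X Y" "f' \<in> Hom \<C> Y W" and g: "lifts p i q j f g" "lifts q j r k f' g'"
  shows "lifts p i r k (f' \<cdot> f) (g' \<cdot> g)"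
proof -
  note d = replacementD[OF assms(1)] replacementD[OF assms(2)] replacementD[OF assms(3)]
  have gH: "g \<in> Hom \<C> R R'" "g' \<in> Hom \<C> R' R''" using g d by (auto simp: lifts_def)
  obtain h where h: "h \<in> Hom \<C> A B" "q \<cdot> h = f \<cdot> p" "g \<cdot> i = j \<cdot> h"
    using g d by (auto simp: lifts_def)
  obtain h' where h': "h' \<in> Hom \<C> B D" "r \<cdot> h' = f' \<cdot> q" "g' \<cdot> j = k \<cdot> h'"
    using g d by (auto simp: lifts_def)
  have "r \<cdot> (h' \<cdot> h) = (f' \<cdot> f) \<cdot> p"
  proof -
    have "r \<cdot> (h' \<cdot> h) = (r \<cdot> h') \<cdot> h" by (rule Comp_assoc[OF h(1) h'(1) d(34)])
    also have "\<dots> = f' \<cdot> (q \<cdot> h)" unfolding h' by (rule Comp_assoc[OF h(1) d(19) f(2), symmetric])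
    also have "\<dots> = (f' \<cdot> f) \<cdot> p" unfolding h by (rule Comp_assoc[OF d(4) f])
    finally show ?thesis .
  qed
  moreover have "(g' \<cdot> g) \<cdot> i = k \<cdot> (h' \<cdot> h)"
  proof -
    have "(g' \<cdot> g) \<cdot> i = g' \<cdot> (g \<cdot> i)" by (rule Comp_assoc[OF d(6) gH, symmetric])
    also have "\<dots> = (g' \<cdot> j) \<cdot> h" unfolding h by (rule Comp_assoc[OF h(1) d(21) gH(2)])
    also have "\<dots> = k \<cdot> (h' \<cdot> h)" unfolding h' by (rule Comp_assoc[OF h(1) h'(1) d(36), symmetric])
    finally show ?thesis .
  qed
  moreover have "h' \<cdot> h \<in> Hom \<C> A D" "g' \<cdot> g \<in> Hom \<C> R R''" using h h' gH Comp_Hom by blast+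
  ultimately show ?thesis using d by (auto simp: lifts_def)
qed

lemma lifts_Ident:
  assumes "replacement X A R p i" shows "lifts p i p i (Ident \<C> X) (Ident \<C> R)"
  using replacementD[OF assms] Ident_Hom by (auto simp: lifts_def cat_simps intro!: bexI[of _ "Ident \<C> A"])

lemma lifts_Hom:
  assumes "replacement X A R p i" "replacement Y B R' q j" "lifts p i q j f g"
  shows "g \<in> Hom \<C> R R'" "R \<in> \<Z>" "R' \<in> \<Z>" "cls g \<in> Hom Q R R'"
  using assms replacementD[OF assms(1)] replacementD[OF assms(2)] Q_Hom[of R R'] by (auto simp: lifts_def)

text \<open>Lifts of the identity in both directions compose to lifts of the identity, hence to
  identities by uniqueness. So all replacements of X agree in \<Z>/\<I>, and convenient ones may be
  used to test the functor.\<close>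

lemma lifts_Ident_iso:
  assumes X: "replacement X A R p i" and Y: "replacement X B R' q j" and g: "lifts p i q j (Ident \<C> X) g"
  shows "iso_mor Q (cls g)"
proof -
  have I: "Ident \<C> X \<in> Hom \<C> X X" "Ident \<C> X \<cdot> Ident \<C> X = Ident \<C> X"
    using replacementD(9)[OF X] by (auto simp: Ident_Hom cat_simps)
  obtain g' where g': "lifts q j p i (Ident \<C> X) g'" using lifts_ex[OF Y X I(1)] .
  note h = lifts_Hom[OF X Y g] note h' = lifts_Hom[OF Y X g']
  have "cls (g' \<cdot> g) = cls (Ident \<C> R)"
    using lifts_unique[OF X X I(1) _ lifts_Ident[OF X]] lifts_Comp[OF X Y X I(1,1) g g'] I(2) by simp
  moreover have "cls (g \<cdot> g') = cls (Ident \<C> R')"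
    using lifts_unique[OF Y Y I(1) _ lifts_Ident[OF Y]] lifts_Comp[OF Y X Y I(1,1) g' g] I(2) by simp
  ultimately show ?thesis
    using h h' by (intro Q.iso_morI[OF h(4) h'(4)]) (simp_all add: Q_Comp Q_Ident)
qed

section \<open>Chosen replacements and the induced functor\<close>

definition rep :: "'o \<Rightarrow> 'o \<times> 'o \<times> 'm \<times> 'm" where
  "rep X = (if X \<in> \<Z> then (X, X, Ident \<C> X, Ident \<C> X)
     else (SOME (A, R, p, i). replacement X A R p i))"

definition "rep_src X = fst (rep X)"
definition "rep_obj X = fst (snd (rep X))"
definition "rep_fib X = fst (snd (snd (rep X)))"
definition "rep_cof X = snd (snd (snd (rep X)))"

lemmas rep_defs = rep_src_def rep_obj_def rep_fib_def rep_cof_def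

text \<open>The case distinction in \<open>rep\<close> is made for this: on \<Z> the functor is the
  quotient functor on the nose, not just up to isomorphism.\<close>

lemma rep_Z:
  assumes "X \<in> \<Z>"
  shows "rep_src X = X" "rep_obj X = X" "rep_fib X = Ident \<C> X" "rep_cof X = Ident \<C> X"
  using assms by (simp_all add: rep_defs rep_def)

lemma replacement_rep:
  assumes "X \<in> Obj \<C>"
  shows "replacement X (rep_src X) (rep_obj X) (rep_fib X) (rep_cof X)"
proof (cases "X \<in> \<Z>")
  case True
  then show ?thesis using replacement_Ident by (simp add: rep_Z)
next
  case False
  have "\<exists>t. case t of (A, R, p, i) \<Rightarrow> replacement X A R p i"
    using replacement_ex[OF assms] by (metis (no_types, lifting) case_prod_conv)
  from someI_ex[OF this] False show ?thesis
    by (auto simp: rep_defs rep_def split: prod.splits)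
qed

text \<open>The choice of a lift is harmless by \<open>lifts_unique\<close>;
  \<open>rep_functor_mor\<close> permits any lift to be used.\<close>

definition rep_functor :: "('o, 'm, 'o, 'm set) cfunctor" where
  "rep_functor = \<lparr>on_obj = rep_obj,
     on_mor = (\<lambda>f. cls (SOME g. lifts (rep_fib (Dom \<C> f)) (rep_cof (Dom \<C> f))
       (rep_fib (Cod \<C> f)) (rep_cof (Cod \<C> f)) f g))\<rparr>"

lemma rep_functor_obj: "on_obj rep_functor X = rep_obj X"
  by (simp add: rep_functor_def)

lemma rep_functor_mor:
  assumes f: "f \<in> Hom \<C> X Y" and g: "lifts (rep_fib X) (rep_cof X) (rep_fib Y) (rep_cof Y) f g"
  shows "on_mor rep_functor f = cls g"
proof -
  have XY: "X \<in> Obj \<C>" "Y \<in> Obj \<C>" "Dom \<C> f = X" "Cod \<C> f = Y" using f Hom_Obj by (auto simp: Hom_iff)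
  show ?thesis
    using lifts_unique[OF replacement_rep[OF XY(1)] replacement_rep[OF XY(2)] f _ g]
      someI[of "lifts (rep_fib X) (rep_cof X) (rep_fib Y) (rep_cof Y) f", OF g]
    by (simp add: rep_functor_def XY)
qed

lemma rep_functor_lift:
  assumes f: "f \<in> Hom \<C> X Y"
  obtains g where "lifts (rep_fib X) (rep_cof X) (rep_fib Y) (rep_cof Y) f g"
    "g \<in> Hom \<C> (rep_obj X) (rep_obj Y)" "on_mor rep_functor f = cls g"
proof -
  have XY: "X \<in> Obj \<C>" "Y \<in> Obj \<C>" using f Hom_Obj by auto
  note r = replacement_rep[OF XY(1)] replacement_rep[OF XY(2)]
  obtain g where "lifts (rep_fib X) (rep_cof X) (rep_fib Y) (rep_cof Y) f g" using lifts_ex[OF r f] .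
  with that lifts_Hom(1)[OF r this] rep_functor_mor[OF f this] show ?thesis by blast
qed

lemma is_functor_rep: "is_functor \<C> Q rep_functor"
  unfolding is_functor_def
proof (intro conjI ballI impI)
  fix X assume X: "X \<in> Obj \<C>"
  note r = replacement_rep[OF X]
  show "on_obj rep_functor X \<in> Obj Q"
    using replacementD(2)[OF r] by (simp add: rep_functor_obj Q_Obj)
  show "on_mor rep_functor (Ident \<C> X) = Ident Q (on_obj rep_functor X)"
    using rep_functor_mor[OF Ident_Hom[OF X] lifts_Ident[OF r]] by (simp add: rep_functor_obj Q_Ident)
next
  fix f assume "f \<in> Mor \<C>"
  then have f: "f \<in> Hom \<C> (Dom \<C> f) (Cod \<C> f)" by (simp add: Hom_iff)
  obtain g where "g \<in> Hom \<C> (rep_obj (Dom \<C> f)) (rep_obj (Cod \<C> f))" "on_mor rep_functor f = cls g"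
    using rep_functor_lift[OF f] .
  moreover have "rep_obj (Dom \<C> f) \<in> \<Z>" "rep_obj (Cod \<C> f) \<in> \<Z>"
    using replacementD(2)[OF replacement_rep] Hom_Obj[OF f] by auto
  ultimately show "on_mor rep_functor f \<in> Hom Q (on_obj rep_functor (Dom \<C> f)) (on_obj rep_functor (Cod \<C> f))"
    by (simp add: rep_functor_obj Q_Hom)
next
  fix f f' assume *: "f \<in> Mor \<C>" "f' \<in> Mor \<C>" "Cod \<C> f = Dom \<C> f'"
  let ?X = "Dom \<C> f" and ?Y = "Dom \<C> f'" and ?W = "Cod \<C> f'"
  have f: "f \<in> Hom \<C> ?X ?Y" "f' \<in> Hom \<C> ?Y ?W" using * by (auto simp: Hom_iff)
  have o: "?X \<in> Obj \<C>" "?Y \<in> Obj \<C>" "?W \<in> Obj \<C>" using * by (auto simp: Dom_Obj Cod_Obj)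
  note r = replacement_rep[OF o(1)] replacement_rep[OF o(2)] replacement_rep[OF o(3)]
  obtain g where g: "lifts (rep_fib ?X) (rep_cof ?X) (rep_fib ?Y) (rep_cof ?Y) f g"
    "g \<in> Hom \<C> (rep_obj ?X) (rep_obj ?Y)" "on_mor rep_functor f = cls g" using rep_functor_lift[OF f(1)] .
  obtain g' where g': "lifts (rep_fib ?Y) (rep_cof ?Y) (rep_fib ?W) (rep_cof ?W) f' g'"
    "g' \<in> Hom \<C> (rep_obj ?Y) (rep_obj ?W)" "on_mor rep_functor f' = cls g'" using rep_functor_lift[OF f(2)] .
  show "on_mor rep_functor (f' \<cdot> f) = on_mor rep_functor f' \<cdot>\<^bsub>Q\<^esub> on_mor rep_functor f"
    using rep_functor_mor[OF Comp_Hom[OF f] lifts_Comp[OF r f g(1) g'(1)]] g g'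
      replacementD(2)[OF r(1)] replacementD(2)[OF r(2)] replacementD(2)[OF r(3)] by (simp add: Q_Comp)
qed (rule category_axioms Q.category_axioms)+

lemma rep_functor_Comp:
  "\<lbrakk>f \<in> Hom \<C> X Y; g \<in> Hom \<C> Y W\<rbrakk>
    \<Longrightarrow> on_mor rep_functor (g \<cdot> f) = on_mor rep_functor g \<cdot>\<^bsub>Q\<^esub> on_mor rep_functor f"
  by (rule is_functor_Comp[OF is_functor_rep])

lemma rep_functor_Hom: "f \<in> Hom \<C> X Y \<Longrightarrow> on_mor rep_functor f \<in> Hom Q (rep_obj X) (rep_obj Y)"
  using is_functor_Hom[OF is_functor_rep] by (simp add: rep_functor_obj)

text \<open>Reduces inversion to finding replacements with a common R. Comparing them with the
  chosen ones writes the value at \<open>f\<close> as a composite of two isomorphisms supplied by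
  \<open>lifts_Ident_iso\<close>.\<close>

lemma rep_functor_iso:
  assumes X: "replacement X A R p i" and Y: "replacement Y B R q j" and f: "f \<in> Hom \<C> X Y"
    and l: "lifts p i q j f (Ident \<C> R)"
  shows "iso_mor Q (on_mor rep_functor f)"
proof -
  have XY: "X \<in> Obj \<C>" "Y \<in> Obj \<C>" using f Hom_Obj by auto
  note r = replacement_rep[OF XY(1)] replacement_rep[OF XY(2)]
  have I: "Ident \<C> X \<in> Hom \<C> X X" "Ident \<C> Y \<in> Hom \<C> Y Y" using XY Ident_Hom by auto
  obtain g where g: "lifts (rep_fib X) (rep_cof X) p i (Ident \<C> X) g" using lifts_ex[OF r(1) X I(1)] .
  obtain g' where g': "lifts q j (rep_fib Y) (rep_cof Y) (Ident \<C> Y) g'" using lifts_ex[OF Y r(2) I(2)] .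
  note h = lifts_Hom[OF r(1) X g] note h' = lifts_Hom[OF Y r(2) g']
  have fi: "f \<cdot> Ident \<C> X = f" "Ident \<C> Y \<cdot> f = f" using f by (auto simp: Hom_iff cat_simps)
  have "lifts (rep_fib X) (rep_cof X) q j f g"
    using lifts_Comp[OF r(1) X Y I(1) f g l] h(1) by (simp add: fi Hom_iff cat_simps)
  from lifts_Comp[OF r(1) Y r(2) f I(2) this g']
  have "on_mor rep_functor f = cls (g' \<cdot> g)" using rep_functor_mor[OF f] by (simp add: fi)
  also have "\<dots> = cls g' \<cdot>\<^bsub>Q\<^esub> cls g" using h h' by (simp add: Q_Comp)
  finally show ?thesis
    using Q.iso_Comp[OF h(4) lifts_Ident_iso[OF r(1) X g] h'(4) lifts_Ident_iso[OF Y r(2) g']] by simp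
qed

section \<open>Inversion of the weak equivalences\<close>

lemma rep_functor_wFib:
  assumes f: "f \<in> wFib \<C> \<V>" "f \<in> Hom \<C> X Y"
  shows "iso_mor Q (on_mor rep_functor f)"
proof -
  have "X \<in> Obj \<C>" using f Hom_Obj by blast
  then obtain A R p i where X: "replacement X A R p i" using replacement_ex by blast
  note d = replacementD[OF X]
  have "lifts p i (f \<cdot> p) i f (Ident \<C> R)"
    using d f(2) by (auto simp: lifts_def Hom_iff cat_simps intro!: bexI[of _ "Ident \<C> A"])
  then show ?thesis using rep_functor_iso[OF X replacement_wFib[OF X f] f(2)] by blast
qed

text \<open>The cofibration leg of a replacement of B is precomposed with \<open>f\<close>. For this
  to be a replacement of A along the identity, A itself has to lie in \<U>.\<close>

lemma rep_functor_wCof_U: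
  assumes f: "f \<in> wCof \<C> \<S>" "f \<in> Hom \<C> A B" and U: "A \<in> \<U>" "B \<in> \<U>"
  shows "iso_mor Q (on_mor rep_functor f)"
proof -
  obtain R i where B: "replacement B B R (Ident \<C> B) i" using replacement_U[OF U(2)] .
  note d = replacementD[OF B]
  have A: "A \<in> Obj \<C>" using class_Obj U by blast
  have "replacement A A R (Ident \<C> A) (i \<cdot> f)"
    using wCof_Comp[OF f d(5,6)] Comp_Hom[OF f(2) d(6)] d(2) U A Ident_wFib Ident_Hom
    by (simp add: replacement_def)
  moreover have "lifts (Ident \<C> A) (i \<cdot> f) (Ident \<C> B) i f (Ident \<C> R)"
    using d f(2) A by (auto simp: lifts_def Hom_iff cat_simps intro!: bexI[of _ f])
  ultimately show ?thesis using rep_functor_iso[OF _ B f(2)] by blast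
qed

text \<open>In \<open>r k = j p\<close> the maps \<open>p\<close>, \<open>k\<close> and
  \<open>r\<close> are already inverted, so \<open>j\<close> is inverted by cancellation.\<close>

lemma rep_functor_wCof_into_U:
  assumes j: "j \<in> wCof \<C> \<S>" "j \<in> Hom \<C> B D" and D: "D \<in> \<U>"
  shows "iso_mor Q (on_mor rep_functor j)"
proof -
  let ?F = "on_mor rep_functor"
  obtain A M p k r where *: "A \<in> \<U>" "M \<in> \<U>" "p \<in> wFib \<C> \<V>" "p \<in> Hom \<C> A B"
    "k \<in> wCof \<C> \<S>" "k \<in> Hom \<C> A M" "r \<in> wFib \<C> \<V>" "r \<in> Hom \<C> M D" "r \<cdot> k = j \<cdot> p"
    using wCof_into_U[OF j D] .
  have "iso_mor Q (?F r \<cdot>\<^bsub>Q\<^esub> ?F k)"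
    by (rule Q.iso_Comp[OF rep_functor_Hom[OF *(6)] rep_functor_wCof_U[OF *(5,6,1,2)]
          rep_functor_Hom[OF *(8)] rep_functor_wFib[OF *(7,8)]])
  then have "iso_mor Q (?F j \<cdot>\<^bsub>Q\<^esub> ?F p)"
    using rep_functor_Comp[OF *(6,8)] rep_functor_Comp[OF *(4) j(2)] *(9) by simp
  then show ?thesis
    by (rule Q.iso_cancel_right[OF rep_functor_Hom[OF *(4)] rep_functor_wFib[OF *(3,4)] rep_functor_Hom[OF j(2)]])
qed

text \<open>Pulling back a \<open>\<U>\<close>-approximation of the target reduces to the previous case.\<close>

lemma rep_functor_wCof:
  assumes j: "j \<in> wCof \<C> \<S>" "j \<in> Hom \<C> B D"
  shows "iso_mor Q (on_mor rep_functor j)"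
proof -
  let ?F = "on_mor rep_functor"
  have D: "D \<in> Obj \<C>" using j Hom_Obj by blast
  obtain S y \<gamma> where S: "S \<in> \<S>" and tj: "etriangle \<C> B D S j y \<gamma>" using wCofE[OF j] .
  obtain A V v p \<alpha> where AV: "A \<in> \<U>" "V \<in> \<V>" and tp: "etriangle \<C> V A D v p \<alpha>"
    using cotorsion_pair_right_approx[OF UV D] .
  \<comment> \<open>In the square \<open>p h = j e\<close> the map \<open>h\<close> keeps the
    cokernel S of \<open>j\<close> and ends in \<U>, while \<open>e\<close> keeps the fibre V of
    \<open>p\<close>.\<close>
  obtain E h \<eta> d e where E: "etriangle \<C> E A S h (y \<cdot> p) \<eta>" "p \<cdot> h = j \<cdot> e"
    "etriangle \<C> V E B d e (pull \<C> V j \<alpha>)"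
    using ET4_op[OF tp tj] by blast
  note hH = etriangleD(4)[OF E(1)] and eH = etriangleD(5)[OF E(3)] and pH = etriangleD(5)[OF tp]
  have "iso_mor Q (?F p \<cdot>\<^bsub>Q\<^esub> ?F h)"
    by (rule Q.iso_Comp[OF rep_functor_Hom[OF hH] rep_functor_wCof_into_U[OF wCofI[OF E(1) S] hH AV(1)]
          rep_functor_Hom[OF pH] rep_functor_wFib[OF wFibI[OF tp AV(2)] pH]])
  then have "iso_mor Q (?F j \<cdot>\<^bsub>Q\<^esub> ?F e)"
    using rep_functor_Comp[OF hH pH] rep_functor_Comp[OF eH j(2)] E(2) by simp
  then show ?thesis
    by (rule Q.iso_cancel_right[OF rep_functor_Hom[OF eH] rep_functor_wFib[OF wFibI[OF E(3) AV(2)] eH]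
          rep_functor_Hom[OF j(2)]])
qed

abbreviation \<W> :: "'m set" where "\<W> \<equiv> weak_equivs \<C> \<S> \<V>"

lemma wFib_W: "f \<in> wFib \<C> \<V> \<Longrightarrow> f \<in> \<W>" and wCof_W: "f \<in> wCof \<C> \<S> \<Longrightarrow> f \<in> \<W>"
proof -
  assume f: "f \<in> wFib \<C> \<V>"
  have "f = f \<cdot> Ident \<C> (Dom \<C> f)" "Ident \<C> (Dom \<C> f) \<in> wCof \<C> \<S>" "Cod \<C> (Ident \<C> (Dom \<C> f)) = Dom \<C> f"
    using wFib_Mor[OF f] by (simp_all add: cat_simps Ident_wCof)
  with f show "f \<in> \<W>" unfolding weak_equivs_def by blast
next
  assume f: "f \<in> wCof \<C> \<S>"
  have "f = Ident \<C> (Cod \<C> f) \<cdot> f" "Ident \<C> (Cod \<C> f) \<in> wFib \<C> \<V>" "Cod \<C> f = Dom \<C> (Ident \<C> (Cod \<C> f))"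
    using wCof_Mor[OF f] by (simp_all add: cat_simps Ident_wFib)
  with f show "f \<in> \<W>" unfolding weak_equivs_def by blast
qed

lemma rep_functor_W:
  assumes "w \<in> \<W>"
  shows "iso_mor Q (on_mor rep_functor w)"
proof -
  obtain p i where w: "w = p \<cdot> i" "i \<in> wCof \<C> \<S>" "p \<in> wFib \<C> \<V>" "Cod \<C> i = Dom \<C> p"
    using assms by (auto simp: weak_equivs_def)
  have h: "i \<in> Hom \<C> (Dom \<C> i) (Dom \<C> p)" "p \<in> Hom \<C> (Dom \<C> p) (Cod \<C> p)"
    using w wFib_Mor wCof_Mor by (auto simp: Hom_iff)
  show ?thesis
    unfolding w(1) rep_functor_Comp[OF h]
    by (rule Q.iso_Comp[OF rep_functor_Hom[OF h(1)] rep_functor_wCof[OF w(2) h(1)]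
          rep_functor_Hom[OF h(2)] rep_functor_wFib[OF w(3) h(2)]])
qed

end

section \<open>The localization\<close>

text \<open>The morphisms at which the naturality square commutes are closed under composition and
  inverses, and zigzags are built from maps of \<C> and inverses of such; so it suffices to check
  maps of \<C>.\<close>

lemma (in category) localization_natural:
  fixes \<D> :: "('p, 'n, 'y) category_scheme"
  assumes F: "is_functor (localization \<C> \<W>) \<D> F" and G: "is_functor (localization \<C> \<W>) \<D> G"
    and \<eta>: "\<And>X. X \<in> Obj \<C> \<Longrightarrow> \<eta> X \<in> Hom \<D> (on_obj F X) (on_obj G X)"
    and nat: "\<And>f X Y. f \<in> Hom \<C> X Y \<Longrightarrow>
      on_mor G (on_mor (localization_functor \<C> \<W>) f) \<cdot>\<^bsub>\<D>\<^esub> \<eta> X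
        = \<eta> Y \<cdot>\<^bsub>\<D>\<^esub> on_mor F (on_mor (localization_functor \<C> \<W>) f)"
    and k: "k \<in> Hom (localization \<C> \<W>) X Y"
  shows "on_mor G k \<cdot>\<^bsub>\<D>\<^esub> \<eta> X = \<eta> Y \<cdot>\<^bsub>\<D>\<^esub> on_mor F k"
proof -
  interpret D: category \<D> using F by (simp add: is_functor_def)
  let ?L = "localization \<C> \<W>" and ?nat = "\<lambda>X k Y. on_mor G k \<cdot>\<^bsub>\<D>\<^esub> \<eta> X = \<eta> Y \<cdot>\<^bsub>\<D>\<^esub> on_mor F k"
  note FH = is_functor_Hom[OF F] and GH = is_functor_Hom[OF G]
  have comp: "?nat X (l \<cdot>\<^bsub>?L\<^esub> k) Z" if k: "k \<in> Hom ?L X Y" "?nat X k Y" and l: "l \<in> Hom ?L Y Z" "?nat Y l Z"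
    and o: "X \<in> Obj \<C>" "Y \<in> Obj \<C>" "Z \<in> Obj \<C>" for X Y Z k l
  proof -
    have "on_mor G (l \<cdot>\<^bsub>?L\<^esub> k) \<cdot>\<^bsub>\<D>\<^esub> \<eta> X = on_mor G l \<cdot>\<^bsub>\<D>\<^esub> (on_mor G k \<cdot>\<^bsub>\<D>\<^esub> \<eta> X)"
      unfolding is_functor_Comp[OF G k(1) l(1)] by (rule D.Comp_assoc[OF \<eta>[OF o(1)] GH[OF k(1)] GH[OF l(1)], symmetric])
    also have "\<dots> = (on_mor G l \<cdot>\<^bsub>\<D>\<^esub> \<eta> Y) \<cdot>\<^bsub>\<D>\<^esub> on_mor F k"
      unfolding k(2) by (rule D.Comp_assoc[OF FH[OF k(1)] \<eta>[OF o(2)] GH[OF l(1)]])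
    also have "\<dots> = \<eta> Z \<cdot>\<^bsub>\<D>\<^esub> on_mor F (l \<cdot>\<^bsub>?L\<^esub> k)"
      unfolding l(2) is_functor_Comp[OF F k(1) l(1)]
      by (rule D.Comp_assoc[OF FH[OF k(1)] FH[OF l(1)] \<eta>[OF o(3)], symmetric])
    finally show ?thesis .
  qed
  have ident: "?nat X (Ident ?L X) X" if "X \<in> Obj \<C>" for X
    using that \<eta>[OF that] is_functor_Ident[OF F] is_functor_Ident[OF G]
    by (simp add: localization_Obj D.Comp_Ident_left[OF \<eta>] D.Comp_Ident_right[OF \<eta>])
  have inverse: "?nat Y l X" if k: "k \<in> Hom ?L X Y" "?nat X k Y" and l: "l \<in> Hom ?L Y X"
    and inv: "l \<cdot>\<^bsub>?L\<^esub> k = Ident ?L X" "k \<cdot>\<^bsub>?L\<^esub> l = Ident ?L Y" and o: "X \<in> Obj \<C>" "Y \<in> Obj \<C>" for X Y k l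
  proof -
    have G1: "on_mor G l \<cdot>\<^bsub>\<D>\<^esub> on_mor G k = Ident \<D> (on_obj G X)"
      using is_functor_Comp[OF G k(1) l] inv(1) is_functor_Ident[OF G] o by (simp add: localization_Obj)
    have F1: "on_mor F k \<cdot>\<^bsub>\<D>\<^esub> on_mor F l = Ident \<D> (on_obj F Y)"
      using is_functor_Comp[OF F l k(1)] inv(2) is_functor_Ident[OF F] o by (simp add: localization_Obj)
    have "on_mor G l \<cdot>\<^bsub>\<D>\<^esub> \<eta> Y = on_mor G l \<cdot>\<^bsub>\<D>\<^esub> (\<eta> Y \<cdot>\<^bsub>\<D>\<^esub> (on_mor F k \<cdot>\<^bsub>\<D>\<^esub> on_mor F l))"
      unfolding F1 D.Comp_Ident_right[OF \<eta>[OF o(2)]] by (rule HOL.refl)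
    also have "\<dots> = on_mor G l \<cdot>\<^bsub>\<D>\<^esub> ((\<eta> Y \<cdot>\<^bsub>\<D>\<^esub> on_mor F k) \<cdot>\<^bsub>\<D>\<^esub> on_mor F l)"
      unfolding D.Comp_assoc[OF FH[OF l] FH[OF k(1)] \<eta>[OF o(2)]] by (rule HOL.refl)
    also have "\<dots> = (on_mor G l \<cdot>\<^bsub>\<D>\<^esub> on_mor G k) \<cdot>\<^bsub>\<D>\<^esub> (\<eta> X \<cdot>\<^bsub>\<D>\<^esub> on_mor F l)"
      using FH[OF l] GH[OF k(1)] GH[OF l] \<eta>[OF o(1)] unfolding k(2)[symmetric]
      by (simp add: Hom_iff D.cat_simps)
    also have "\<dots> = \<eta> X \<cdot>\<^bsub>\<D>\<^esub> on_mor F l"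
      unfolding G1 by (rule D.Comp_Ident_left[OF D.Comp_Hom[OF FH[OF l] \<eta>[OF o(1)]]])
    finally show ?thesis .
  qed
  obtain p where p: "k = zigzag_class \<C> \<W> X p Y" "zigzag \<C> \<W> X p Y"
    using k by (auto simp: localization_Hom)
  have H: "zigzag_class \<C> \<W> X p Y \<in> Hom ?L X Y" if "zigzag \<C> \<W> X p Y" for X p Y
    using that by (auto simp: localization_Hom)
  from p(2) show ?thesis unfolding p(1)
  proof induction
    case (Nil X)
    then show ?case using ident by (simp add: localization_Ident)
  next
    case (Fwd f X Y p Z)
    note o = zigzag_Obj[OF Fwd(2)] Hom_Obj[OF Fwd(1)] and s = zigzag_single[OF Fwd(1)]
    show ?case
      using comp[OF H[OF s] _ H[OF Fwd(2)] Fwd(3)] nat[OF Fwd(1)] o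
      by (simp add: localization_functor_mor[OF Fwd(1)] localization_Comp[OF s Fwd(2)])
  next
    case (Bwd w Y X p Z)
    note o = zigzag_Obj[OF Bwd(3)] Hom_Obj[OF Bwd(2)] and s = zigzag_Bwd[OF Bwd(1,2)]
    note i = localization_inverts[OF Bwd(1,2)]
    have "?nat X (zigzag_class \<C> \<W> X [Bwd w] Y) Y"
      using inverse[OF i(1) _ i(2,3,4)] nat[OF Bwd(2)] o by (simp add: localization_functor_mor[OF Bwd(2)])
    then show ?case
      using comp[OF H[OF s] _ H[OF Bwd(3)] Bwd(4)] o by (simp add: localization_Comp[OF s Bwd(3)])
  qed
qed

context hovey_twin
begin

abbreviation "\<L> \<equiv> localization \<C> \<W>"

sublocale L: category \<L>
  by (rule category_localization)

abbreviation loc :: "'m \<Rightarrow> ('o \<times> 'm step list \<times> 'o) set" where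
  "loc \<equiv> on_mor (localization_functor \<C> \<W>)"

lemma loc_Hom: "f \<in> Hom \<C> X Y \<Longrightarrow> loc f \<in> Hom \<L> X Y"
  using is_functor_Hom[OF localization_functor_is_functor] by (simp add: localization_functor_def)

lemma loc_Comp: "\<lbrakk>f \<in> Hom \<C> X Y; g \<in> Hom \<C> Y W\<rbrakk> \<Longrightarrow> loc (g \<cdot> f) = loc g \<cdot>\<^bsub>\<L>\<^esub> loc f"
  by (rule is_functor_Comp[OF localization_functor_is_functor])

lemma loc_Ident: "X \<in> Obj \<C> \<Longrightarrow> loc (Ident \<C> X) = Ident \<L> X"
  using is_functor_Ident[OF localization_functor_is_functor] by (simp add: localization_functor_def)

lemma loc_wFib: "f \<in> wFib \<C> \<V> \<Longrightarrow> iso_mor \<L> (loc f)"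
  and loc_wCof: "f \<in> wCof \<C> \<S> \<Longrightarrow> iso_mor \<L> (loc f)"
  by (auto intro!: localization_functor_inverts simp: wFib_W wCof_W wFib_Mor wCof_Mor)

text \<open>If \<open>f - g = v u\<close> with \<open>u : X \<rightarrow> J\<close>, then \<open>f\<close> and \<open>g\<close> are the composites of \<open>(g, v) : X \<oplus> J \<rightarrow> Y\<close> with
  the sections \<open>(1, u)\<close> and \<open>(1, 0)\<close> of the projection \<open>X \<oplus> J \<rightarrow> X\<close>, which is inverted.\<close>

lemma loc_eq_if_null:
  assumes f: "f \<in> Hom \<C> X Y" and g: "g \<in> Hom \<C> X Y" and "null (f \<boxplus> mneg \<C> g)"
  shows "loc f = loc g"
proof -
  have "f \<boxplus> mneg \<C> g \<in> Hom \<C> X Y" using f g by (intro MAdd_Hom mneg_Hom)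
  with assms(3) obtain J u v where J: "J \<in> \<I>" "J \<in> Obj \<C>" "u \<in> Hom \<C> X J" "v \<in> Hom \<C> J Y" "f \<boxplus> mneg \<C> g = v \<cdot> u"
    using nullE by (metis Hom_iff)
  have X: "X \<in> Obj \<C>" "Y \<in> Obj \<C>" using f Hom_Obj by auto
  obtain P i j p q where b: "is_biproduct \<C> X J P i j p q" using biproduct_ex X(1) J(2) by blast
  note db = biproductD[OF b]
  have m: "f \<in> Mor \<C>" "Dom \<C> f = X" "Cod \<C> f = Y" "g \<in> Mor \<C>" "Dom \<C> g = X" "Cod \<C> g = Y"
    "u \<in> Mor \<C>" "Dom \<C> u = X" "Cod \<C> u = J" "v \<in> Mor \<C>" "Dom \<C> v = J" "Cod \<C> v = Y"
    using f g J by (auto simp: Hom_iff)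
  \<comment> \<open>The projection has fibre J, so it is a weak fibration because \<I> also equals
    \<U> \<inter> \<V>.\<close>
  have "J \<in> \<V>" using J(1) S_inter_T by blast
  then have p: "p \<in> wFib \<C> \<V>" using wFibI[OF etriangle_biproduct[OF biproduct_sym[OF b]]] by blast
  let ?s = "i \<boxplus> j \<cdot> u" and ?t = "g \<cdot> p \<boxplus> v \<cdot> q"
  have h: "p \<in> Hom \<C> P X" "i \<in> Hom \<C> X P" "?s \<in> Hom \<C> X P" "?t \<in> Hom \<C> P Y"
    using db(1-15) m by (simp_all add: Hom_iff add_simps)
  have "p \<cdot> ?s = p \<cdot> i" by (simp add: db m add_simps biproduct_reassoc[OF b])
  then have "loc p \<cdot>\<^bsub>\<L>\<^esub> loc ?s = loc p \<cdot>\<^bsub>\<L>\<^esub> loc i"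
    using loc_Comp[OF h(3,1)] loc_Comp[OF h(2,1)] by simp
  then have s: "loc ?s = loc i"
    by (rule L.iso_left_cancel[OF loc_Hom[OF h(1)] loc_wFib[OF p] loc_Hom[OF h(3)] loc_Hom[OF h(2)]])
  have "?t \<cdot> ?s = g \<boxplus> v \<cdot> u" "?t \<cdot> i = g"
    by (simp_all add: db m X add_simps biproduct_reassoc[OF b])
  moreover have "g \<boxplus> v \<cdot> u = f"
    unfolding J(5)[symmetric] using m by (simp add: add_simps MAdd_left_commute[of g f])
  ultimately have "loc f = loc ?t \<cdot>\<^bsub>\<L>\<^esub> loc ?s" "loc g = loc ?t \<cdot>\<^bsub>\<L>\<^esub> loc i"
    using loc_Comp[OF h(3,4)] loc_Comp[OF h(2,4)] by simp_all
  with s show ?thesis by simp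
qed

section \<open>The comparison functor and its inverse\<close>

definition \<Phi> :: "('o, 'm set, 'o, ('o \<times> 'm step list \<times> 'o) set) cfunctor" where
  "\<Phi> = \<lparr>on_obj = (\<lambda>X. X), on_mor = (\<lambda>F. loc (SOME f. f \<in> F))\<rparr>"

lemma \<Phi>_obj: "on_obj \<Phi> X = X"
  by (simp add: \<Phi>_def)

text \<open>Independence of the representative is \<open>loc_eq_if_null\<close>.\<close>

lemma \<Phi>_cls:
  assumes "X \<in> \<Z>" "Y \<in> \<Z>" "f \<in> Hom \<C> X Y"
  shows "on_mor \<Phi> (cls f) = loc f"
proof -
  note c = Z.ideal_class_SOME[of f X Y, unfolded Z_Hom[OF assms(1,2)], OF assms(3)]
  show ?thesis
    using loc_eq_if_null[OF c(1) assms(3)] c cls_eq_iff[OF assms(1,2) c(1) assms(3)] by (simp add: \<Phi>_def)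
qed

lemma is_functor_\<Phi>: "is_functor Q \<L> \<Phi>"
  unfolding is_functor_def
proof (intro conjI ballI impI)
  fix X assume "X \<in> Obj Q"
  then have X: "X \<in> \<Z>" "X \<in> Obj \<C>" by (auto simp: Q_Obj class_Obj)
  show "on_obj \<Phi> X \<in> Obj \<L>" using X by (simp add: \<Phi>_obj localization_Obj)
  show "on_mor \<Phi> (Ident Q X) = Ident \<L> (on_obj \<Phi> X)"
    using \<Phi>_cls[OF X(1,1) Ident_Hom[OF X(2)]] X by (simp add: Q_Ident \<Phi>_obj loc_Ident)
next
  fix F assume "F \<in> Mor Q"
  then have F: "F \<in> Hom Q (Dom Q F) (Cod Q F)" by (simp add: Hom_iff)
  then have o: "Dom Q F \<in> \<Z>" "Cod Q F \<in> \<Z>" using Q.Hom_Obj Q_Obj by blast+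
  then obtain f where "f \<in> Hom \<C> (Dom Q F) (Cod Q F)" "F = cls f" using F Q_Hom by blast
  then show "on_mor \<Phi> F \<in> Hom \<L> (on_obj \<Phi> (Dom Q F)) (on_obj \<Phi> (Cod Q F))"
    using \<Phi>_cls[OF o] loc_Hom by (simp add: \<Phi>_obj)
next
  fix F G assume *: "F \<in> Mor Q" "G \<in> Mor Q" "Cod Q F = Dom Q G"
  then have F: "F \<in> Hom Q (Dom Q F) (Dom Q G)" and G: "G \<in> Hom Q (Dom Q G) (Cod Q G)" by (auto simp: Hom_iff)
  then have o: "Dom Q F \<in> \<Z>" "Dom Q G \<in> \<Z>" "Cod Q G \<in> \<Z>" using Q.Hom_Obj Q_Obj by blast+
  obtain f where f: "f \<in> Hom \<C> (Dom Q F) (Dom Q G)" "F = cls f" using F Q_Hom[OF o(1,2)] by blast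
  obtain g where g: "g \<in> Hom \<C> (Dom Q G) (Cod Q G)" "G = cls g" using G Q_Hom[OF o(2,3)] by blast
  show "on_mor \<Phi> (G \<cdot>\<^bsub>Q\<^esub> F) = on_mor \<Phi> G \<cdot>\<^bsub>\<L>\<^esub> on_mor \<Phi> F"
    unfolding f(2) g(2) Q_Comp[OF o f(1) g(1)] \<Phi>_cls[OF o(1,2) f(1)] \<Phi>_cls[OF o(2,3) g(1)]
      \<Phi>_cls[OF o(1,3) Comp_Hom[OF f(1) g(1)]] by (rule loc_Comp[OF f(1) g(1)])
qed (rule Q.category_axioms L.category_axioms)+

lemma rep_functor_Z:
  assumes "X \<in> \<Z>" "Y \<in> \<Z>" "f \<in> Hom \<C> X Y"
  shows "on_mor rep_functor f = cls f"
  using assms by (intro rep_functor_mor[OF assms(3)])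
    (auto simp: rep_Z lifts_def Hom_iff cat_simps class_Obj intro!: bexI[of _ f])

text \<open>The span X \<leftarrow> A \<rightarrow> R read as a morphism R \<rightarrow> X, with its
  cofibration inverted.\<close>

definition \<eta> :: "'o \<Rightarrow> ('o \<times> 'm step list \<times> 'o) set" where
  "\<eta> X = loc (rep_fib X) \<cdot>\<^bsub>\<L>\<^esub> inv_mor \<L> (loc (rep_cof X))"

lemma \<eta>:
  assumes "X \<in> Obj \<C>"
  shows "inv_mor \<L> (loc (rep_cof X)) \<in> Hom \<L> (rep_obj X) (rep_src X)"
    "inv_mor \<L> (loc (rep_cof X)) \<cdot>\<^bsub>\<L>\<^esub> loc (rep_cof X) = Ident \<L> (rep_src X)"
    "loc (rep_cof X) \<cdot>\<^bsub>\<L>\<^esub> inv_mor \<L> (loc (rep_cof X)) = Ident \<L> (rep_obj X)"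
    "\<eta> X \<in> Hom \<L> (rep_obj X) X" "iso_mor \<L> (\<eta> X)"
proof -
  note d = replacementD[OF replacement_rep[OF assms]]
  note i = inv_mor[OF loc_wCof[OF d(5)] loc_Hom[OF d(6)]]
  then show *: "inv_mor \<L> (loc (rep_cof X)) \<in> Hom \<L> (rep_obj X) (rep_src X)"
    "inv_mor \<L> (loc (rep_cof X)) \<cdot>\<^bsub>\<L>\<^esub> loc (rep_cof X) = Ident \<L> (rep_src X)"
    "loc (rep_cof X) \<cdot>\<^bsub>\<L>\<^esub> inv_mor \<L> (loc (rep_cof X)) = Ident \<L> (rep_obj X)" by simp_all
  show "\<eta> X \<in> Hom \<L> (rep_obj X) X" unfolding \<eta>_def by (rule L.Comp_Hom[OF *(1) loc_Hom[OF d(4)]])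
  have "iso_mor \<L> (inv_mor \<L> (loc (rep_cof X)))"
    by (rule L.iso_morI[OF *(1) loc_Hom[OF d(6)] *(3,2)])
  then show "iso_mor \<L> (\<eta> X)" unfolding \<eta>_def
    by (rule L.iso_Comp[OF *(1) _ loc_Hom[OF d(4)] loc_wFib[OF d(3)]])
qed

lemma \<eta>_Z:
  assumes "X \<in> \<Z>" shows "\<eta> X = Ident \<L> X"
proof -
  have X: "X \<in> Obj \<C>" using assms class_Obj by blast
  \<comment> \<open>\<open>inv_mor\<close> is a choice, so even the inverse of an identity has to be
    determined.\<close>
  have "inv_mor \<L> (Ident \<L> X) \<in> Hom \<L> X X" "inv_mor \<L> (Ident \<L> X) \<cdot>\<^bsub>\<L>\<^esub> Ident \<L> X = Ident \<L> X"
    using \<eta>(1,2)[OF X] assms X by (simp_all add: rep_Z loc_Ident)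
  then have "inv_mor \<L> (Ident \<L> X) = Ident \<L> X" using L.Comp_Ident_right by metis
  moreover have "Ident \<L> X \<in> Hom \<L> X X" using X by (simp add: L.Ident_Hom localization_Obj)
  ultimately show ?thesis
    using assms X by (simp add: \<eta>_def rep_Z loc_Ident L.Comp_Ident_left)
qed

text \<open>A lift consists of two commuting squares; the one over the cofibrations is inverted in
  the localization and pasted to the one over the fibrations.\<close>

lemma \<eta>_natural:
  assumes f: "f \<in> Hom \<C> X Y"
  shows "loc f \<cdot>\<^bsub>\<L>\<^esub> \<eta> X = \<eta> Y \<cdot>\<^bsub>\<L>\<^esub> on_mor \<Phi> (on_mor rep_functor f)"
proof -
  have o: "X \<in> Obj \<C>" "Y \<in> Obj \<C>" using f Hom_Obj by auto
  note dX = replacementD[OF replacement_rep[OF o(1)]] note dY = replacementD[OF replacement_rep[OF o(2)]]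
  obtain g where g: "lifts (rep_fib X) (rep_cof X) (rep_fib Y) (rep_cof Y) f g"
    "g \<in> Hom \<C> (rep_obj X) (rep_obj Y)" "on_mor rep_functor f = cls g" using rep_functor_lift[OF f] .
  obtain h where h: "h \<in> Hom \<C> (rep_src X) (rep_src Y)" "rep_fib Y \<cdot> h = f \<cdot> rep_fib X"
    "g \<cdot> rep_cof X = rep_cof Y \<cdot> h"
    using g(1) dX dY by (auto simp: lifts_def)
  let ?bX = "inv_mor \<L> (loc (rep_cof X))" and ?bY = "inv_mor \<L> (loc (rep_cof Y))"
  have e: "loc (rep_fib Y) \<cdot>\<^bsub>\<L>\<^esub> loc h = loc f \<cdot>\<^bsub>\<L>\<^esub> loc (rep_fib X)"
    "loc g \<cdot>\<^bsub>\<L>\<^esub> loc (rep_cof X) = loc (rep_cof Y) \<cdot>\<^bsub>\<L>\<^esub> loc h"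
    using loc_Comp[OF h(1) dY(4)] loc_Comp[OF dX(4) f] loc_Comp[OF dX(6) g(2)] loc_Comp[OF h(1) dY(6)] h(2,3)
    by simp_all
  note H = loc_Hom[OF h(1)] loc_Hom[OF g(2)] loc_Hom[OF dX(4)] loc_Hom[OF dX(6)] loc_Hom[OF dY(4)] loc_Hom[OF dY(6)]
    loc_Hom[OF f]
  note i = \<eta>[OF o(1)] note i' = \<eta>[OF o(2)]
  have "loc g = loc g \<cdot>\<^bsub>\<L>\<^esub> (loc (rep_cof X) \<cdot>\<^bsub>\<L>\<^esub> ?bX)"
    unfolding i(3) by (rule L.Comp_Ident_right[OF H(2), symmetric])
  also have "\<dots> = (loc (rep_cof Y) \<cdot>\<^bsub>\<L>\<^esub> loc h) \<cdot>\<^bsub>\<L>\<^esub> ?bX"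
    unfolding e(2)[symmetric] by (rule L.Comp_assoc[OF i(1) H(4,2)])
  also have "\<dots> = loc (rep_cof Y) \<cdot>\<^bsub>\<L>\<^esub> (loc h \<cdot>\<^bsub>\<L>\<^esub> ?bX)"
    by (rule L.Comp_assoc[OF i(1) H(1,6), symmetric])
  finally have "?bY \<cdot>\<^bsub>\<L>\<^esub> loc g = ?bY \<cdot>\<^bsub>\<L>\<^esub> (loc (rep_cof Y) \<cdot>\<^bsub>\<L>\<^esub> (loc h \<cdot>\<^bsub>\<L>\<^esub> ?bX))"
    by (rule arg_cong)
  also have "\<dots> = (?bY \<cdot>\<^bsub>\<L>\<^esub> loc (rep_cof Y)) \<cdot>\<^bsub>\<L>\<^esub> (loc h \<cdot>\<^bsub>\<L>\<^esub> ?bX)"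
    by (rule L.Comp_assoc[OF L.Comp_Hom[OF i(1) H(1)] H(6) i'(1)])
  also have "\<dots> = loc h \<cdot>\<^bsub>\<L>\<^esub> ?bX"
    unfolding i'(2) by (rule L.Comp_Ident_left[OF L.Comp_Hom[OF i(1) H(1)]])
  finally have b: "?bY \<cdot>\<^bsub>\<L>\<^esub> loc g = loc h \<cdot>\<^bsub>\<L>\<^esub> ?bX" .
  have "\<eta> Y \<cdot>\<^bsub>\<L>\<^esub> loc g = loc (rep_fib Y) \<cdot>\<^bsub>\<L>\<^esub> (?bY \<cdot>\<^bsub>\<L>\<^esub> loc g)"
    unfolding \<eta>_def by (rule L.Comp_assoc[OF H(2) i'(1) H(5), symmetric])
  also have "\<dots> = (loc f \<cdot>\<^bsub>\<L>\<^esub> loc (rep_fib X)) \<cdot>\<^bsub>\<L>\<^esub> ?bX"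
    unfolding b e(1)[symmetric] by (rule L.Comp_assoc[OF i(1) H(1,5)])
  also have "\<dots> = loc f \<cdot>\<^bsub>\<L>\<^esub> \<eta> X"
    unfolding \<eta>_def by (rule L.Comp_assoc[OF i(1) H(3,7), symmetric])
  finally show ?thesis
    using \<Phi>_cls[OF dX(2) dY(2) g(2)] g(3) by simp
qed

text \<open>Keeps the strict identities on \<Z> and the particular transformation
  \<open>\<eta>\<close>, because the statement on Hom sets relies on them.\<close>

lemma localization_equivalence:
  obtains G where "is_functor \<L> Q G"
    "\<forall>X \<in> \<Z>. on_obj G X = X"
    "\<forall>X \<in> \<Z>. \<forall>Y \<in> \<Z>. \<forall>F \<in> Hom Q X Y. on_mor G (on_mor \<Phi> F) = F"
    "nat_iso \<L> \<L> (\<Phi> \<circ>\<^sub>F G) inclusion_functor \<eta>"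
proof -
  obtain G where G: "is_functor \<L> Q G" "\<forall>X \<in> Obj \<C>. on_obj G X = on_obj rep_functor X"
    "\<forall>f \<in> Mor \<C>. on_mor G (loc f) = on_mor rep_functor f"
    using localization_universal(1)[OF is_functor_rep rep_functor_W] by blast
  have \<eta>H: "\<eta> X \<in> Hom \<L> (on_obj (\<Phi> \<circ>\<^sub>F G) X) (on_obj inclusion_functor X)" if "X \<in> Obj \<C>" for X
    using \<eta>(4)[OF that] that G(2) by (simp add: compose_functor_def inclusion_functor_def \<Phi>_obj rep_functor_obj)
  have GO: "on_obj G X = X" if "X \<in> \<Z>" for X
    using G(2) that class_Obj by (simp add: rep_functor_obj rep_Z)
  moreover have "on_mor G (on_mor \<Phi> F) = F" if XY: "X \<in> \<Z>" "Y \<in> \<Z>" and "F \<in> Hom Q X Y" for X Y F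
  proof -
    have "F \<in> cls ` Hom \<C> X Y" using that(3) Q_Hom[OF XY] by simp
    then obtain f where f: "f \<in> Hom \<C> X Y" "F = cls f" by blast
    have "on_mor G (on_mor \<Phi> F) = on_mor G (loc f)" by (simp only: f(2) \<Phi>_cls[OF XY f(1)])
    also have "\<dots> = on_mor rep_functor f" by (rule bspec[OF G(3)]) (use f(1) in \<open>simp add: Hom_iff\<close>)
    also have "\<dots> = F" by (simp only: f(2) rep_functor_Z[OF XY f(1)])
    finally show ?thesis .
  qed
  moreover have "nat_iso \<L> \<L> (\<Phi> \<circ>\<^sub>F G) inclusion_functor \<eta>"
    unfolding nat_iso_def
  proof (intro conjI ballI)
    show \<Phi>G: "is_functor \<L> \<L> (\<Phi> \<circ>\<^sub>F G)" by (rule is_functor_compose[OF G(1) is_functor_\<Phi>])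
    show I: "is_functor \<L> \<L> inclusion_functor" by (rule L.is_functor_inclusion_self)
    fix X assume "X \<in> Obj \<L>"
    then have X: "X \<in> Obj \<C>" by (simp add: localization_Obj)
    show "\<eta> X \<in> Hom \<L> (on_obj (\<Phi> \<circ>\<^sub>F G) X) (on_obj inclusion_functor X)" by (rule \<eta>H[OF X])
    show "iso_mor \<L> (\<eta> X)" by (rule \<eta>(5)[OF X])
  next
    fix k assume "k \<in> Mor \<L>"
    then have k: "k \<in> Hom \<L> (Dom \<L> k) (Cod \<L> k)" by (simp add: Hom_iff)
    show "on_mor (inclusion_functor :: ('o, _, 'o, _) cfunctor) k \<cdot>\<^bsub>\<L>\<^esub> \<eta> (Dom \<L> k) = \<eta> (Cod \<L> k) \<cdot>\<^bsub>\<L>\<^esub> on_mor (\<Phi> \<circ>\<^sub>F G) k"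
    proof (rule localization_natural[OF is_functor_compose[OF G(1) is_functor_\<Phi>] L.is_functor_inclusion_self \<eta>H _ k])
      fix f X Y assume f: "f \<in> Hom \<C> X Y"
      show "on_mor (inclusion_functor :: ('o, _, 'o, _) cfunctor) (loc f) \<cdot>\<^bsub>\<L>\<^esub> \<eta> X = \<eta> Y \<cdot>\<^bsub>\<L>\<^esub> on_mor (\<Phi> \<circ>\<^sub>F G) (loc f)"
        using \<eta>_natural[OF f] G(3) f by (simp add: inclusion_functor_def compose_functor_def Hom_iff)
    qed
  qed
  ultimately show ?thesis by (intro that[OF G(1)] ballI)
qed

lemma is_equivalence_\<Phi>: "is_equivalence Q \<L> \<Phi>"
proof -
  obtain G where G: "is_functor \<L> Q G" "\<forall>X \<in> \<Z>. on_obj G X = X"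
    "\<forall>X \<in> \<Z>. \<forall>Y \<in> \<Z>. \<forall>F \<in> Hom Q X Y. on_mor G (on_mor \<Phi> F) = F"
    "nat_iso \<L> \<L> (\<Phi> \<circ>\<^sub>F G) inclusion_functor \<eta>"
    by (rule localization_equivalence)
  have "naturally_isomorphic Q Q (G \<circ>\<^sub>F \<Phi>) inclusion_functor"
  proof (rule naturally_isomorphic_if_eq[OF is_functor_compose[OF is_functor_\<Phi> G(1)] Q.is_functor_inclusion_self])
    show "on_obj (G \<circ>\<^sub>F \<Phi>) X = on_obj inclusion_functor X" if "X \<in> Obj Q" for X
      using G(2) that by (simp add: compose_functor_def inclusion_functor_def \<Phi>_obj Q_Obj)
    fix F assume "F \<in> Mor Q"
    then have F: "F \<in> Hom Q (Dom Q F) (Cod Q F)" by (simp add: Hom_iff)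
    have "Dom Q F \<in> \<Z>" "Cod Q F \<in> \<Z>" using Q.Hom_Obj[OF F] Q_Obj by blast+
    then show "on_mor (G \<circ>\<^sub>F \<Phi>) F = on_mor inclusion_functor F"
      using G(3) F by (simp add: compose_functor_def inclusion_functor_def)
  qed
  with G(1,4) is_functor_\<Phi> show ?thesis by (auto simp: is_equivalence_def naturally_isomorphic_def)
qed

text \<open>The square commutes strictly on the objects and morphisms of \<Z>, so identities serve
  as the natural isomorphism.\<close>

lemma \<Phi>_quotient:
  "naturally_isomorphic (full_subcategory \<C> \<Z>) \<L> (\<Phi> \<circ>\<^sub>F quotient_functor (full_subcategory \<C> \<Z>) \<I>)
    (localization_functor \<C> \<W> \<circ>\<^sub>F inclusion_functor)"
proof (rule naturally_isomorphic_if_eq)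
  show "is_functor (full_subcategory \<C> \<Z>) \<L> (\<Phi> \<circ>\<^sub>F quotient_functor (full_subcategory \<C> \<Z>) \<I>)"
    by (rule is_functor_compose[OF Z.is_functor_quotient is_functor_\<Phi>])
  show "is_functor (full_subcategory \<C> \<Z>) \<L> (localization_functor \<C> \<W> \<circ>\<^sub>F inclusion_functor)"
    by (rule is_functor_compose[OF is_functor_inclusion localization_functor_is_functor]) (auto simp: class_Obj)
  show "on_obj (\<Phi> \<circ>\<^sub>F quotient_functor (full_subcategory \<C> \<Z>) \<I>) X
      = on_obj (localization_functor \<C> \<W> \<circ>\<^sub>F inclusion_functor) X" for X
    by (simp add: compose_functor_def quotient_functor_def localization_functor_def inclusion_functor_def \<Phi>_obj)
  fix f assume "f \<in> Mor (full_subcategory \<C> \<Z>)"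
  then have f: "Dom \<C> f \<in> \<Z>" "Cod \<C> f \<in> \<Z>" "f \<in> Hom \<C> (Dom \<C> f) (Cod \<C> f)"
    by (auto simp: full_subcategory_def Hom_iff)
  show "on_mor (\<Phi> \<circ>\<^sub>F quotient_functor (full_subcategory \<C> \<Z>) \<I>) f
      = on_mor (localization_functor \<C> \<W> \<circ>\<^sub>F inclusion_functor) f"
    using \<Phi>_cls[OF f] by (simp add: compose_functor_def quotient_functor_def inclusion_functor_def)
qed

text \<open>On \<Z> the components of \<open>\<eta>\<close> are identities, so naturality reads
  \<open>\<Phi> (G k) = k\<close>, and \<open>G\<close> is a two-sided inverse on each Hom
  set.\<close>

lemma \<Phi>_bij:
  assumes XY: "X \<in> \<Z>" "Y \<in> \<Z>"
  shows "bij_betw (on_mor \<Phi>) (Hom Q X Y) (Hom \<L> X Y)"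
proof -
  obtain G where G: "is_functor \<L> Q G" "\<forall>X \<in> \<Z>. on_obj G X = X"
    "\<forall>X \<in> \<Z>. \<forall>Y \<in> \<Z>. \<forall>F \<in> Hom Q X Y. on_mor G (on_mor \<Phi> F) = F"
    "nat_iso \<L> \<L> (\<Phi> \<circ>\<^sub>F G) inclusion_functor \<eta>"
    by (rule localization_equivalence)
  show ?thesis
  proof (rule bij_betwI[where g = "on_mor G"])
    show "on_mor \<Phi> \<in> Hom Q X Y \<rightarrow> Hom \<L> X Y"
      using is_functor_Hom[OF is_functor_\<Phi>] by (fastforce simp: \<Phi>_obj)
    show "on_mor G \<in> Hom \<L> X Y \<rightarrow> Hom Q X Y"
      using is_functor_Hom[OF G(1)] G(2) XY by fastforce
    show "on_mor G (on_mor \<Phi> F) = F" if "F \<in> Hom Q X Y" for F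
      using G(3) XY that by blast
    fix k assume k: "k \<in> Hom \<L> X Y"
    have "on_mor (\<Phi> \<circ>\<^sub>F G) k \<in> Hom \<L> X Y"
      using is_functor_Hom[OF is_functor_compose[OF G(1) is_functor_\<Phi>] k] G(2) XY
      by (simp add: compose_functor_def \<Phi>_obj)
    moreover have "k \<cdot>\<^bsub>\<L>\<^esub> Ident \<L> X = Ident \<L> Y \<cdot>\<^bsub>\<L>\<^esub> on_mor (\<Phi> \<circ>\<^sub>F G) k"
      using G(4) k \<eta>_Z[OF XY(1)] \<eta>_Z[OF XY(2)] by (auto simp: nat_iso_def Hom_iff inclusion_functor_def)
    ultimately show "on_mor \<Phi> (on_mor G k) = k"
      using L.Comp_Ident_right[OF k] L.Comp_Ident_left by (simp add: compose_functor_def)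
  qed
qed

end

theorem corollary5p25:
  fixes \<C> :: "('o, 'm, 'e, 'z) extri_category_scheme"
    and \<S> \<T> \<U> \<V> :: "'o set"
  assumes "extriangulated_category \<C>"
    and "WIC \<C>"
    and "hovey_twin_cotorsion_pair \<C> ((\<S>, \<T>), (\<U>, \<V>))"
  defines "\<Z> \<equiv> full_subcategory \<C> (\<T> \<inter> \<U>)"
    and "\<I> \<equiv> \<S> \<inter> \<T>"
    and "\<W> \<equiv> weak_equivs \<C> \<S> \<V>"
  shows "(\<exists>\<Phi>. is_equivalence (ideal_quotient \<Z> \<I>) (localization \<C> \<W>) \<Phi> \<and>
            naturally_isomorphic \<Z> (localization \<C> \<W>)
              (\<Phi> \<circ>\<^sub>F quotient_functor \<Z> \<I>)
              (localization_functor \<C> \<W> \<circ>\<^sub>F inclusion_functor))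
       \<and> (\<forall>X \<in> Obj \<Z>. \<forall>Y \<in> Obj \<Z>. \<exists>\<phi>.
            (\<forall>f \<in> Hom \<Z> X Y. \<phi> (ideal_class \<Z> \<I> f) = on_mor (localization_functor \<C> \<W>) f) \<and>
            bij_betw \<phi> (Hom (ideal_quotient \<Z> \<I>) X Y) (Hom (localization \<C> \<W>) X Y))"
proof -
  interpret hovey_twin \<C> \<S> \<T> \<U> \<V>
    using assms(1,3) by (intro hovey_twin.intro hovey_twin_axioms.intro)
  have "\<exists>\<phi>. (\<forall>f \<in> Hom \<Z> X Y. \<phi> (ideal_class \<Z> \<I> f) = on_mor (localization_functor \<C> \<W>) f) \<and>
      bij_betw \<phi> (Hom (ideal_quotient \<Z> \<I>) X Y) (Hom (localization \<C> \<W>) X Y)"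
    if "X \<in> Obj \<Z>" "Y \<in> Obj \<Z>" for X Y
  proof -
    have XY: "X \<in> \<T> \<inter> \<U>" "Y \<in> \<T> \<inter> \<U>" using that unfolding \<Z>_def by (simp_all only: Z_simps)
    \<comment> \<open>The bijection is the action on morphisms of the equivalence itself.\<close>
    show ?thesis
      unfolding \<Z>_def \<I>_def \<W>_def Z_Hom[OF XY] using \<Phi>_cls[OF XY] \<Phi>_bij[OF XY] by blast
  qed
  moreover have "is_equivalence (ideal_quotient \<Z> \<I>) (localization \<C> \<W>) \<Phi> \<and>
      naturally_isomorphic \<Z> (localization \<C> \<W>) (\<Phi> \<circ>\<^sub>F quotient_functor \<Z> \<I>)
        (localization_functor \<C> \<W> \<circ>\<^sub>F inclusion_functor)"
    unfolding \<Z>_def \<I>_def \<W>_def using is_equivalence_\<Phi> \<Phi>_quotient by blast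
  ultimately show ?thesis by blast
qed

end
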